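(* There exists a divergence-free vector field $u\in B^{2/3}_{3,\infty}(\mathbb R^3)\cap H^{1/2}(\mathbb R^3)$ whose helicity flux is asymptotically bounded from below in absolute value by a positive constant, i.e. $$\liminf_{Q\to\infty}|\mathcal H_Q|>0 .$$
   Context: Littlewood-Paley notation. $\lambda_q=2^q$. Fix a nonnegative radial $\chi\in C_0^\infty(B(0,1))$ on $\mathbb R^3$ with $\chi(\xi)=1$ for $|\xi|\le 1/2$, and let $\varphi(\xi)=\chi(\xi/2)-\chi(\xi)$. With $\mathcal F$ the Fourier transform, $\Delta_q u=\mathcal F^{-1}(\varphi(\lambda_q^{-1}\xi)\mathcal F u)$ for $q\ge 0$, $\Delta_{-1}u=\mathcal F^{-1}(\chi(\xi)\mathcal F u)$, and $S_Q=\sum_{q=-1}^{Q}\Delta_q$. $B^{2/3}_{3,\infty}(\mathbb R^3)$ is the space of tempered distributions with finite norm $\|\Delta_{-1}u\|_{L^3}+\sup_{q\ge0}\lambda_q^{2/3}\|\Delta_qu\|_{L^3}$. For a divergence-free $u\in H^{1/2}(\mathbb R^3)$ let $\omega=\nabla\times u\in H^{-1/2}$. The truncated helicity flux is $$\mathcal H_Q=\int_{\mathbb R^3}\mathrm{Tr}\left[S_Q(u\otimes u)\cdot\nabla S_Q\omega+S_Q(u\wedge\omega)\cdot\nabla S_Qu\right]dx,\qquad u\wedge\omega=u\otimes\omega-\omega\otimes u,$$ with the convention $\mathrm{Tr}[A\cdot\nabla v]=\sum_{i,j}A_{ij}\partial_iv_j$, $(a\otimes b)_{ij}=a_ib_j$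 (so that for solutions of the Euler equations $\mathcal H_Q$ is the time derivative of $\int S_Qu\cdot S_Q\omega\,dx$). *)

theory Defs
  imports "HOL-Analysis.Analysis"
begin

type_synonym R3 = "real ^ 3"

subsection \<open>Smooth functions and the Schwartz space\<close>

definition partial :: "3 \<Rightarrow> (R3 \<Rightarrow> 'b::real_normed_vector) \<Rightarrow> R3 \<Rightarrow> 'b" where
  "partial i f x = frechet_derivative f (at x) (axis i 1)"

definition partials :: "3 list \<Rightarrow> (R3 \<Rightarrow> 'b::real_normed_vector) \<Rightarrow> R3 \<Rightarrow> 'b" where
  "partials is f = foldr partial is f"

definition smooth :: "(R3 \<Rightarrow> 'b::real_normed_vector) \<Rightarrow> bool" where
  "smooth f \<longleftrightarrow> (\<forall>is. partials is f differentiable_on UNIV)"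

definition schwartz :: "(R3 \<Rightarrow> complex) set" where
  "schwartz = {f. smooth f \<and>
     (\<forall>is k. bdd_above (range (\<lambda>x. (1 + norm x) ^ k * norm (partials is f x))))}"

definition schwartz_seminorm :: "nat \<Rightarrow> (R3 \<Rightarrow> complex) \<Rightarrow> real" where
  "schwartz_seminorm N f =
     (\<Sum>is\<in>{is. length is \<le> N}. SUP x. (1 + norm x) ^ N * norm (partials is f x))"

subsection \<open>Tempered distributions\<close>

text \<open>A distribution is a functional of which only the values on Schwartz functions matter.\<close>

type_synonym distr = "(R3 \<Rightarrow> complex) \<Rightarrow> complex"

definition tempered :: "distr \<Rightarrow> bool" where
  "tempered T \<longleftrightarrow>
     (\<forall>f\<in>schwartz. \<forall>g\<in>schwartz. T (\<lambda>x. f x + g x) = T f + T g) \<and>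
     (\<forall>c. \<forall>f\<in>schwartz. T (\<lambda>x. c * f x) = c * T f) \<and>
     (\<exists>C N. \<forall>f\<in>schwartz. norm (T f) \<le> C * schwartz_seminorm N f)"

definition distr_of :: "(R3 \<Rightarrow> complex) \<Rightarrow> distr" where
  "distr_of g \<phi> = (LINT x|lborel. g x * \<phi> x)"

definition represents :: "(R3 \<Rightarrow> complex) \<Rightarrow> distr \<Rightarrow> bool" where
  "represents g T \<longleftrightarrow> g \<in> borel_measurable lborel \<and>
     (\<forall>\<phi>\<in>schwartz. integrable lborel (\<lambda>x. g x * \<phi> x) \<and> T \<phi> = distr_of g \<phi>)"

text \<open>The continuous function that a distribution is identified with, if there is one
  (it is then unique).\<close>

definition continuous_rep :: "distr \<Rightarrow> R3 \<Rightarrow> complex" where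
  "continuous_rep T = (THE g. continuous_on UNIV g \<and> represents g T)"

definition distr_diff :: "distr \<Rightarrow> distr \<Rightarrow> distr" where
  "distr_diff S T \<phi> = S \<phi> - T \<phi>"

definition distr_partial :: "3 \<Rightarrow> distr \<Rightarrow> distr" where
  "distr_partial i T \<phi> = - T (partial i \<phi>)"

definition distr_mult :: "(R3 \<Rightarrow> complex) \<Rightarrow> distr \<Rightarrow> distr" where
  "distr_mult m T \<phi> = T (\<lambda>x. m x * \<phi> x)"

definition divergence_free :: "(3 \<Rightarrow> distr) \<Rightarrow> bool" where
  "divergence_free U \<longleftrightarrow> (\<forall>\<phi>\<in>schwartz. (\<Sum>i\<in>UNIV. distr_partial i (U i) \<phi>) = 0)"

text \<open>Addition in the index type \<open>3\<close> is modulo 3, so the indices below are cyclic.\<close>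

definition curl :: "(3 \<Rightarrow> distr) \<Rightarrow> 3 \<Rightarrow> distr" where
  "curl U i = distr_diff (distr_partial (i + 1) (U (i + 2))) (distr_partial (i + 2) (U (i + 1)))"

lemma curl_components:
  "curl U 1 = distr_diff (distr_partial 2 (U 3)) (distr_partial 3 (U 2))"
  "curl U 2 = distr_diff (distr_partial 3 (U 1)) (distr_partial 1 (U 3))"
  "curl U 3 = distr_diff (distr_partial 1 (U 2)) (distr_partial 2 (U 1))"
proof -
  have sums: "(1::3) + 1 = 2" "(1::3) + 2 = 3" "(2::3) + 1 = 3" "(2::3) + 2 = 1"
    "(3::3) + 1 = 1" "(3::3) + 2 = 2"
    by simp_all
  show
    "curl U 1 = distr_diff (distr_partial 2 (U 3)) (distr_partial 3 (U 2))"
    "curl U 2 = distr_diff (distr_partial 3 (U 1)) (distr_partial 1 (U 3))"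
    "curl U 3 = distr_diff (distr_partial 1 (U 2)) (distr_partial 2 (U 1))"
    unfolding curl_def sums by (rule refl)+
qed

subsection \<open>Fourier transform\<close>

definition FT :: "(R3 \<Rightarrow> complex) \<Rightarrow> R3 \<Rightarrow> complex" where
  "FT f \<xi> = (LINT x|lborel. cis (- (x \<bullet> \<xi>)) * f x)"

definition IFT :: "(R3 \<Rightarrow> complex) \<Rightarrow> R3 \<Rightarrow> complex" where
  "IFT f x = (LINT \<xi>|lborel. cis (x \<bullet> \<xi>) * f \<xi>) / complex_of_real ((2 * pi) ^ 3)"

definition distr_FT :: "distr \<Rightarrow> distr" where
  "distr_FT T \<phi> = T (FT \<phi>)"

definition distr_IFT :: "distr \<Rightarrow> distr" where
  "distr_IFT T \<phi> = T (IFT \<phi>)"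

subsection \<open>Littlewood-Paley decomposition\<close>

definition lp_cutoff :: "(R3 \<Rightarrow> real) \<Rightarrow> bool" where
  "lp_cutoff chi \<longleftrightarrow> smooth chi \<and> closure {\<xi>. chi \<xi> \<noteq> 0} \<subseteq> ball 0 1 \<and>
     (\<forall>\<xi>. 0 \<le> chi \<xi>) \<and> (\<forall>\<xi> \<eta>. norm \<xi> = norm \<eta> \<longrightarrow> chi \<xi> = chi \<eta>) \<and>
     (\<forall>\<xi>. norm \<xi> \<le> 1 / 2 \<longrightarrow> chi \<xi> = 1)"

definition lp_phi :: "(R3 \<Rightarrow> real) \<Rightarrow> R3 \<Rightarrow> real" where
  "lp_phi chi \<xi> = chi (\<xi> /\<^sub>R 2) - chi \<xi>"

text \<open>Only the values for \<open>q \<ge> -1\<close> are meaningful.\<close>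

definition lp_symbol :: "(R3 \<Rightarrow> real) \<Rightarrow> int \<Rightarrow> R3 \<Rightarrow> real" where
  "lp_symbol chi q \<xi> = (if q = - 1 then chi \<xi> else lp_phi chi (\<xi> /\<^sub>R (2 powi q)))"

definition lp_block :: "(R3 \<Rightarrow> real) \<Rightarrow> int \<Rightarrow> distr \<Rightarrow> distr" where
  "lp_block chi q T =
     distr_IFT (distr_mult (\<lambda>\<xi>. complex_of_real (lp_symbol chi q \<xi>)) (distr_FT T))"

definition lp_sum :: "(R3 \<Rightarrow> real) \<Rightarrow> int \<Rightarrow> distr \<Rightarrow> distr" where
  "lp_sum chi Q T \<phi> = (\<Sum>q\<in>{- 1..Q}. lp_block chi q T \<phi>)"

definition LP_S :: "(R3 \<Rightarrow> real) \<Rightarrow> int \<Rightarrow> distr \<Rightarrow> R3 \<Rightarrow> complex" where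
  "LP_S chi Q T = continuous_rep (lp_sum chi Q T)"

subsection \<open>Function spaces\<close>

definition Lp_norm :: "real \<Rightarrow> (R3 \<Rightarrow> complex) \<Rightarrow> ennreal" where
  "Lp_norm p g =
     (let I = (\<integral>\<^sup>+ x. ennreal (norm (g x) powr p) \<partial>lborel)
      in if I = \<infinity> then \<infinity> else ennreal (enn2real I powr (1 / p)))"

text \<open>The \<open>L\<^sup>p\<close> norm of a distribution is infinite if no function represents it.\<close>

definition distr_Lp_norm :: "real \<Rightarrow> distr \<Rightarrow> ennreal" where
  "distr_Lp_norm p T = (INF g\<in>{g. represents g T}. Lp_norm p g)"

text \<open>The norm of the Besov space with indices \<open>s\<close>, \<open>p\<close> and \<open>\<infinity>\<close>.\<close>

definition besov_norm :: "(R3 \<Rightarrow> real) \<Rightarrow> real \<Rightarrow> real \<Rightarrow> distr \<Rightarrow> ennreal" where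
  "besov_norm chi s p T = distr_Lp_norm p (lp_block chi (- 1) T) +
     (SUP q::nat. ennreal ((2 ^ q) powr s) * distr_Lp_norm p (lp_block chi (int q) T))"

definition besov :: "(R3 \<Rightarrow> real) \<Rightarrow> real \<Rightarrow> real \<Rightarrow> distr set" where
  "besov chi s p = {T. tempered T \<and> besov_norm chi s p T < \<infinity>}"

definition sobolev :: "real \<Rightarrow> distr set" where
  "sobolev s = {T. tempered T \<and> (\<exists>g. represents g (distr_FT T) \<and>
     integrable lborel (\<lambda>\<xi>. (1 + (norm \<xi>)\<^sup>2) powr s * (norm (g \<xi>))\<^sup>2))}"

subsection \<open>Products of a function and a distribution\<close>

text \<open>The duality pairing of \<open>T \<in> H\<^sup>-\<^sup>s\<close> and \<open>h \<in> H\<^sup>s\<close> (bilinear, without conjugation),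
  which extends \<open>\<integral> T h dx\<close> by Plancherel's formula.  The function representing the Fourier
  transform of \<open>T\<close> is unique up to null sets.  The transform of \<open>h\<close> is the classical one, so
  \<open>h\<close> has to be in \<open>L\<^sup>1\<close> as well.\<close>

definition sobolev_pairing :: "distr \<Rightarrow> (R3 \<Rightarrow> complex) \<Rightarrow> complex" where
  "sobolev_pairing T h =
     (LINT \<xi>|lborel. (SOME g. represents g (distr_FT T)) \<xi> * FT h (- \<xi>))
       / complex_of_real ((2 * pi) ^ 3)"

text \<open>For \<open>f \<in> H\<^sup>s\<close>, \<open>s \<ge> 0\<close>, and \<open>T \<in> H\<^sup>-\<^sup>s\<close> the product \<open>f T\<close> is the distribution
  \<open>\<phi> \<mapsto> \<langle>T, f \<phi>\<rangle>\<close>; here \<open>f \<phi> \<in> H\<^sup>s \<inter> L\<^sup>1\<close>.\<close>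

definition distr_prod :: "(R3 \<Rightarrow> complex) \<Rightarrow> distr \<Rightarrow> distr" where
  "distr_prod f T \<phi> = sobolev_pairing T (\<lambda>x. f x * \<phi> x)"

subsection \<open>Helicity flux\<close>

definition component :: "(R3 \<Rightarrow> R3) \<Rightarrow> 3 \<Rightarrow> R3 \<Rightarrow> complex" where
  "component u i x = complex_of_real (u x $ i)"

definition vec_distr :: "(R3 \<Rightarrow> R3) \<Rightarrow> 3 \<Rightarrow> distr" where
  "vec_distr u i = distr_of (component u i)"

definition vorticity :: "(R3 \<Rightarrow> R3) \<Rightarrow> 3 \<Rightarrow> distr" where
  "vorticity u = curl (vec_distr u)"

definition u_tensor_u :: "(R3 \<Rightarrow> R3) \<Rightarrow> 3 \<Rightarrow> 3 \<Rightarrow> distr" where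
  "u_tensor_u u i j = distr_of (\<lambda>x. component u i x * component u j x)"

definition u_wedge_vorticity :: "(R3 \<Rightarrow> R3) \<Rightarrow> 3 \<Rightarrow> 3 \<Rightarrow> distr" where
  "u_wedge_vorticity u i j =
     distr_diff (distr_prod (component u i) (vorticity u j))
                (distr_prod (component u j) (vorticity u i))"

definition helicity_flux :: "(R3 \<Rightarrow> real) \<Rightarrow> (R3 \<Rightarrow> R3) \<Rightarrow> int \<Rightarrow> complex" where
  "helicity_flux chi u Q = (LINT x|lborel. (\<Sum>i\<in>UNIV. \<Sum>j\<in>UNIV.
       LP_S chi Q (u_tensor_u u i j) x * partial i (LP_S chi Q (vorticity u j)) x
     + LP_S chi Q (u_wedge_vorticity u i j) x * partial i (LP_S chi Q (vec_distr u j)) x))"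

end

theory Submission imports Defs "HOL-Probability.Probability"
begin

text \<open>
  The field is a lacunary sum of wave packets. At scale \<open>4\<^sup>j\<close> its Fourier transform consists of bumps of
  fixed width at six points \<open>\<plusminus>k\<^sub>j\<^sub>,\<^sub>t\<close> of modulus comparable to \<open>4\<^sup>j\<close>, with amplitude \<open>4\<^sup>-\<^sup>2\<^sup>j\<^sup>/\<^sup>3\<close>, and the
  wave vectors of consecutive scales satisfy \<open>k\<^sub>j\<^sub>+\<^sub>1\<^sub>,\<^sub>2 + k\<^sub>j\<^sub>+\<^sub>1\<^sub>,\<^sub>3 = -k\<^sub>j\<^sub>,\<^sub>1\<close>. The packets avoid the frequencies
  where the symbol of \<open>S\<^sub>Q\<close> passes from 1 to 0, so \<open>S\<^sub>Q\<close> acts on \<open>u\<close> and \<open>\<omega>\<close> as a sharp truncation and the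
  flux becomes an integral over triads of frequencies. Triads of low frequencies cancel, because the
  truncated interaction conserves helicity, and the spectrum leaves room only for the triads formed by
  \<open>k\<^sub>l\<^sub>,\<^sub>1\<close>, the last scale kept, and \<open>k\<^sub>l\<^sub>+\<^sub>1\<^sub>,\<^sub>2\<close>, \<open>k\<^sub>l\<^sub>+\<^sub>1\<^sub>,\<^sub>3\<close>, the first scale removed. The flux has three factors
  of amplitude and two derivatives, so their contribution is independent of \<open>l\<close> up to
  the relative width \<open>4\<^sup>-\<^sup>l\<close> of the bumps, and it tends to a nonzero limit.
\<close>

section \<open>Lebesgue measure\<close>

text \<open>The cutoff \<open>chi\<close> is given, not chosen, and its intermediate values would
  enter the flux with no control. What every admissible \<open>chi\<close> has in common is a
  support inside a ball of some radius r < 1; hence all its dyadic dilates take only the values 0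
  and 1 on the shells r * 2^n < |\<xi>| < 2^n, and the packets live in every second such shell.
  Their fixed width has two effects: in physical space all packets sit in the same place, with L^3
  norm at most a constant times the amplitude, and the overlap of three bumps is the same for every
  resonant triad. The isosceles triangle with sides 1, 1, 1/4 supplies the coordinates 1/8 and sqrt
  63 / 8 of the wave vectors. These lie in a plane, and the polarisations must break the planar
  symmetry, since three polarisations normal to the plane give no interaction at the centres. The
  other obstacle is that the vorticity lies only in H^(-1/2): products are defined by duality and
  become convolutions, and S_Q of such a product, a continuous representative of a distribution, has
  to be identified before the flux can be computed; this is the purpose of the uniqueness
  results.\<close>

lemma lborel_distr_affine:
  fixes t :: "'a::euclidean_space"
  assumes "\<bar>s\<bar> = 1"
  shows "distr lborel borel (\<lambda>x. t + s *\<^sub>R x) = lborel"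
  using lborel_affine[of s t] assms by (auto simp: density_1)

lemma integrable_affine_iff:
  fixes t :: "'a::euclidean_space" and f :: "'a \<Rightarrow> 'b::{banach, second_countable_topology}"
  assumes "\<bar>s\<bar> = 1" and [measurable]: "f \<in> borel_measurable borel"
  shows "integrable lborel (\<lambda>x. f (t + s *\<^sub>R x)) \<longleftrightarrow> integrable lborel f"
  by (subst (2) lborel_distr_affine[OF assms(1), of t, symmetric]) (simp add: integrable_distr_eq)

lemma integral_affine:
  fixes t :: "'a::euclidean_space" and f :: "'a \<Rightarrow> 'b::{banach, second_countable_topology}"
  assumes "\<bar>s\<bar> = 1" and [measurable]: "f \<in> borel_measurable borel"
  shows "(LINT x|lborel. f (t + s *\<^sub>R x)) = (LINT x|lborel. f x)"
  by (subst (2) lborel_distr_affine[OF assms(1), of t, symmetric]) (simp add: integral_distr)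

lemma integral_lborel_prod:
  fixes f :: "'a::euclidean_space \<Rightarrow> real \<Rightarrow> complex"
  assumes f: "\<And>b. b \<in> Basis \<Longrightarrow> integrable lborel (f b)"
  shows "(LINT x|lborel. (\<Prod>b\<in>Basis. f b (x \<bullet> b))) = (\<Prod>b\<in>Basis. LINT x|lborel. f b x)"
    and "integrable lborel (\<lambda>x. \<Prod>b\<in>Basis. f b (x \<bullet> b))"
proof -
  interpret product_sigma_finite "\<lambda>b::'a. lborel :: real measure"
    by (simp add: product_sigma_finite_def sigma_finite_lborel)
  have m[measurable]: "\<And>b. b \<in> Basis \<Longrightarrow> f b \<in> borel_measurable borel"
    using f by (auto dest: borel_measurable_integrable)
  have eq: "(\<Prod>b\<in>Basis. f b ((\<Sum>c\<in>Basis. g c *\<^sub>R c) \<bullet> b)) = (\<Prod>b\<in>Basis. f b (g b))" for g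
    by (intro prod.cong) (auto simp: inner_sum_left inner_Basis if_distrib cong: if_cong)
  show "(LINT x|lborel. (\<Prod>b\<in>Basis. f b (x \<bullet> b))) = (\<Prod>b\<in>Basis. LINT x|lborel. f b x)"
    by (subst lborel_eq, subst integral_distr) (auto simp: eq product_integral_prod f)
  show "integrable lborel (\<lambda>x. \<Prod>b\<in>Basis. f b (x \<bullet> b))"
    by (subst lborel_eq, subst integrable_distr_eq) (auto simp: eq intro!: product_integrable_prod f)
qed

lemma integrable_inverse_1_plus_square_lborel:
  "integrable lborel (\<lambda>x::real. 1 / (1 + x\<^sup>2))"
  using integrable_inverse_1_plus_square
  by (simp add: set_integrable_def divide_inverse)

lemma prod_Basis_R3: "(\<Prod>b\<in>Basis. g b) = (\<Prod>i\<in>UNIV. g (axis i 1 :: real^'n))"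
  by (rule prod.reindex_bij_witness[of _ "\<lambda>i. axis i 1" "\<lambda>b. THE i. b = axis i 1"])
    (auto simp: Basis_vec_def axis_eq_axis)

lemma integral_R3_prod:
  fixes f :: "3 \<Rightarrow> real \<Rightarrow> complex"
  assumes f: "\<And>i. integrable lborel (f i)"
  shows "(LINT x|lborel. (\<Prod>i\<in>UNIV. f i (x $ i))) = (\<Prod>i\<in>UNIV. LINT x|lborel. f i x)"
    and "integrable lborel (\<lambda>x::R3. \<Prod>i\<in>UNIV. f i (x $ i))"
proof -
  define g where "g b = f (THE i. b = (axis i 1 :: R3))" for b
  have g: "g (axis i 1) = f i" for i
    by (simp add: g_def axis_eq_axis)
  have ib: "integrable lborel (g b)" if "b \<in> Basis" for b
    using that f by (simp add: g_def)
  show "(LINT x|lborel. (\<Prod>i\<in>UNIV. f i (x $ i))) = (\<Prod>i\<in>UNIV. LINT x|lborel. f i x)"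
    using integral_lborel_prod(1)[of g, OF ib]
    by (simp add: prod_Basis_R3 g inner_axis)
  show "integrable lborel (\<lambda>x::R3. \<Prod>i\<in>UNIV. f i (x $ i))"
    using integral_lborel_prod(2)[of g, OF ib]
    by (simp add: prod_Basis_R3 g inner_axis)
qed

text \<open>\<open>(1 + norm x)\<^sup>2\<close> bounds each \<open>1 + (x $ i)\<^sup>2\<close>, so
  the sixth power dominates the product of three one-dimensional weights. This is the origin of the
  exponent 6 wherever decay is turned into integrability.\<close>

lemma integrable_inverse_weight:
  "integrable lborel (\<lambda>x::R3. 1 / (1 + norm x) ^ 6)"
proof (rule Bochner_Integration.integrable_bound)
  show "integrable lborel (\<lambda>x::R3. \<Prod>i\<in>UNIV. complex_of_real (1 / (1 + (x $ i)\<^sup>2)))"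
    by (rule integral_R3_prod(2)[of "\<lambda>i x. complex_of_real (1 / (1 + x\<^sup>2))"])
      (rule integrable_of_real, rule integrable_inverse_1_plus_square_lborel)
  show "AE x in lborel. norm (1 / (1 + norm (x :: R3)) ^ 6) \<le> norm (\<Prod>i\<in>UNIV. complex_of_real (1 / (1 + (x $ i)\<^sup>2)))"
  proof (rule AE_I2)
    fix x :: R3
    have le: "1 + (x $ i)\<^sup>2 \<le> (1 + norm x)\<^sup>2" for i
    proof -
      have "(x $ i)\<^sup>2 \<le> (norm x)\<^sup>2"
        by (metis component_le_norm_cart abs_le_square_iff abs_norm_cancel)
      then show ?thesis
        using norm_ge_zero[of x] by (simp add: power2_sum del: norm_ge_zero)
    qed
    have pos: "0 < 1 + (x $ i)\<^sup>2" for i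
      by (simp add: add_pos_nonneg)
    have "(\<Prod>i\<in>(UNIV::3 set). 1 / (1 + norm x)\<^sup>2) \<le> (\<Prod>i\<in>UNIV. 1 / (1 + (x $ i)\<^sup>2))"
      by (intro prod_mono conjI) (auto intro!: frac_le le pos)
    moreover have "(\<Prod>i\<in>(UNIV::3 set). 1 / (1 + norm x)\<^sup>2) = 1 / (1 + norm x) ^ 6"
      by (simp add: power_divide flip: power_mult)
    moreover have "norm (\<Prod>i\<in>UNIV. complex_of_real (1 / (1 + (x $ i)\<^sup>2))) = (\<Prod>i\<in>UNIV. 1 / (1 + (x $ i)\<^sup>2))"
      using pos by (simp add: prod_norm[symmetric] norm_divide less_imp_le del: of_real_add of_real_power of_real_divide)
    ultimately show "norm (1 / (1 + norm x) ^ 6) \<le> norm (\<Prod>i\<in>UNIV. complex_of_real (1 / (1 + (x $ i)\<^sup>2)))"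
      by simp
  qed
qed measurable

lemma integrable_decay:
  fixes f :: "R3 \<Rightarrow> 'b::{banach, second_countable_topology}"
  assumes [measurable]: "f \<in> borel_measurable borel"
    and C: "\<And>x. (1 + norm x) ^ 6 * norm (f x) \<le> C"
  shows "integrable lborel f"
proof (rule Bochner_Integration.integrable_bound)
  show "integrable lborel (\<lambda>x::R3. C * (1 / (1 + norm x) ^ 6))"
    using integrable_inverse_weight by (rule integrable_mult_right)
  have "norm (f x) \<le> C * (1 / (1 + norm x) ^ 6)" for x
  proof -
    have "0 < (1 + norm x) ^ 6"
      by (intro zero_less_power) (smt (verit) norm_ge_zero)
    then show ?thesis
      using C[of x] by (simp add: pos_le_divide_eq mult.commute)
  qed
  then show "AE x in lborel. norm (f x) \<le> norm (C * (1 / (1 + norm x) ^ 6))"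
    by (intro always_eventually allI) (metis abs_ge_self order_trans real_norm_def)
qed measurable

lemma integrable_compact_support:
  fixes f :: "R3 \<Rightarrow> 'b::{banach, second_countable_topology}"
  assumes [measurable]: "f \<in> borel_measurable borel"
    and B: "\<And>x. norm (f x) \<le> B" and R: "\<And>x. R < norm x \<Longrightarrow> f x = 0"
  shows "integrable lborel f"
proof (rule integrable_decay)
  fix x
  have B0: "0 \<le> B"
    using B[of 0] norm_ge_zero order_trans by blast
  show "(1 + norm x) ^ 6 * norm (f x) \<le> (1 + \<bar>R\<bar>) ^ 6 * B"
  proof (cases "R < norm x")
    case True
    then show ?thesis using R B0 by simp
  next
    case False
    then show ?thesis
      by (intro mult_mono power_mono B) auto
  qed
qed measurable

section \<open>Smooth and rapidly decreasing functions\<close>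

lemma partial_eqI: "(f has_derivative f') (at x) \<Longrightarrow> partial i f x = f' (axis i 1)"
  unfolding partial_def using frechet_derivative_at by metis

lemma frechet_derivative_worksI:
  "f differentiable (at x) \<Longrightarrow> (f has_derivative frechet_derivative f (at x)) (at x)"
  by (simp add: frechet_derivative_works)

lemma partials_Nil [simp]: "partials [] f = f"
  and partials_Cons: "partials (i # is) f = partial i (partials is f)"
  by (auto simp: partials_def)

lemma smooth_differentiable: "smooth f \<Longrightarrow> f differentiable (at x)"
  unfolding smooth_def by (metis partials_Nil differentiable_on_def UNIV_I)

lemma partials_snoc: "partials (is @ [i]) f = partials is (partial i f)"
  by (simp add: partials_def)

lemma smooth_partial: "smooth f \<Longrightarrow> smooth (partial i f)"
  unfolding smooth_def by (metis partials_snoc)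

text \<open>Smoothness quantifies over all lists of partial derivatives. A class of differentiable
  functions closed under \<open>partial\<close> contains them all, so no formula for iterated
  derivatives is needed; \<open>schwartz_coinduct\<close> adds the decay of each member.\<close>

lemma smooth_coinduct:
  assumes "P f" and step: "\<And>f. P f \<Longrightarrow> (\<forall>x. f differentiable (at x)) \<and> (\<forall>i. P (partial i f))"
  shows "smooth f"
proof -
  have "P (partials is f)" for "is"
    using assms by (induction "is") (auto simp: partials_Cons)
  then show ?thesis
    using step by (simp add: smooth_def differentiable_on_def)
qed

lemma smooth_continuous: "smooth f \<Longrightarrow> continuous_on UNIV f"
  by (simp add: continuous_on_eq_continuous_within differentiable_imp_continuous_within smooth_differentiable)

lemma smooth_measurable [measurable_dest]:
  "smooth f \<Longrightarrow> f \<in> borel_measurable borel"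
  using smooth_continuous borel_measurable_continuous_onI by blast

lemma smooth_compose_linear:
  assumes "bounded_linear h" "smooth f"
  shows "smooth (\<lambda>x. h (f x))"
proof (rule smooth_coinduct[of "\<lambda>g. \<exists>f. smooth f \<and> g = (\<lambda>x. h (f x))"])
  fix g assume "\<exists>f. smooth f \<and> g = (\<lambda>x. h (f x))"
  then obtain f where f: "smooth f" "g = (\<lambda>x. h (f x))" by auto
  have d: "((\<lambda>x. h (f x)) has_derivative (\<lambda>y. h (frechet_derivative f (at x) y))) (at x)" for x
    using smooth_differentiable[OF f(1)]
    by (intro bounded_linear.has_derivative[OF assms(1)] frechet_derivative_worksI)
  have "partial i g = (\<lambda>x. h (partial i f x))" for i
    unfolding f(2) by (rule ext, subst partial_eqI[OF d]) (simp add: partial_def)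
  moreover have "g differentiable (at x)" for x
    unfolding f(2) by (rule differentiableI[OF d])
  ultimately show "(\<forall>x. g differentiable (at x)) \<and> (\<forall>i. \<exists>f. smooth f \<and> partial i g = (\<lambda>x. h (f x)))"
    using smooth_partial[OF f(1)] by blast
qed (use assms(2) in blast)

lemma smooth_affine:
  assumes "smooth f"
  shows "smooth (\<lambda>x. f (t + s *\<^sub>R x))"
\<comment> \<open>Each derivative brings out a factor \<open>s\<close>; the scalar \<open>c\<close>
  in the class absorbs it.\<close>
proof (rule smooth_coinduct[of "\<lambda>g. \<exists>f c. smooth f \<and> g = (\<lambda>x. c *\<^sub>R f (t + s *\<^sub>R x))"])
  fix g assume "\<exists>f c. smooth f \<and> g = (\<lambda>x. c *\<^sub>R f (t + s *\<^sub>R x))"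
  then obtain f c where f: "smooth f" "g = (\<lambda>x. c *\<^sub>R f (t + s *\<^sub>R x))" by auto
  have d: "((\<lambda>x. c *\<^sub>R f (t + s *\<^sub>R x)) has_derivative (\<lambda>y. c *\<^sub>R frechet_derivative f (at (t + s *\<^sub>R x)) (s *\<^sub>R y))) (at x)" for x
  proof (rule has_derivative_scaleR_right)
    have "((\<lambda>x. t + s *\<^sub>R x) has_derivative (\<lambda>x. s *\<^sub>R x)) (at x)"
      by (auto intro!: derivative_eq_intros)
    from has_derivative_compose[OF this frechet_derivative_worksI[OF smooth_differentiable[OF f(1)]]]
    show "((\<lambda>x. f (t + s *\<^sub>R x)) has_derivative (\<lambda>y. frechet_derivative f (at (t + s *\<^sub>R x)) (s *\<^sub>R y))) (at x)" .
  qed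
  have "partial i g = (\<lambda>x. (c * s) *\<^sub>R partial i f (t + s *\<^sub>R x))" for i
    unfolding f(2)
  proof (rule ext, subst partial_eqI[OF d])
    fix x
    interpret bounded_linear "frechet_derivative f (at (t + s *\<^sub>R x))"
      by (rule has_derivative_bounded_linear[OF frechet_derivative_worksI[OF smooth_differentiable[OF f(1)]]])
    show "c *\<^sub>R frechet_derivative f (at (t + s *\<^sub>R x)) (s *\<^sub>R axis i 1) = (c * s) *\<^sub>R partial i f (t + s *\<^sub>R x)"
      by (simp add: partial_def scaleR)
  qed
  moreover have "g differentiable (at x)" for x
    unfolding f(2) by (rule differentiableI[OF d])
  ultimately show "(\<forall>x. g differentiable (at x)) \<and> (\<forall>i. \<exists>f c. smooth f \<and> partial i g = (\<lambda>x. c *\<^sub>R f (t + s *\<^sub>R x)))"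
    using smooth_partial[OF f(1)] by blast
qed (use assms in \<open>auto intro!: exI[of _ f] exI[of _ 1]\<close>)

section \<open>Closure properties and integrability of Schwartz functions\<close>

lemma schwartz_smooth: "f \<in> schwartz \<Longrightarrow> smooth f"
  by (simp add: schwartz_def)

lemma schwartz_coinduct:
  assumes "P f" and step: "\<And>f. P f \<Longrightarrow> (\<forall>x. f differentiable (at x)) \<and>
    (\<forall>k. \<exists>C. \<forall>x. (1 + norm x) ^ k * norm (f x) \<le> C) \<and> (\<forall>i. P (partial i f))"
  shows "f \<in> schwartz"
proof -
  have "P (partials is f)" for "is"
    using assms by (induction "is") (auto simp: partials_Cons)
  then show ?thesis
    using step smooth_coinduct[of P f, OF assms(1)]
    unfolding schwartz_def bdd_above_def by simp
qed

lemma schwartz_bound: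
  assumes "f \<in> schwartz"
  obtains C where "\<And>x. (1 + norm x) ^ k * norm (f x) \<le> C"
proof -
  have "bdd_above (range (\<lambda>x. (1 + norm x) ^ k * norm (partials [] f x)))"
    using assms by (simp add: schwartz_def del: partials_Nil)
  then show ?thesis
    using that by (auto simp: bdd_above_def)
qed

lemma schwartz_partial: "f \<in> schwartz \<Longrightarrow> partial i f \<in> schwartz"
  using smooth_partial unfolding schwartz_def by (auto simp flip: partials_snoc)

lemma schwartz_differentiable: "f \<in> schwartz \<Longrightarrow> f differentiable (at x)"
  by (simp add: schwartz_smooth smooth_differentiable)

lemma schwartz_measurable [measurable_dest]: "f \<in> schwartz \<Longrightarrow> f \<in> borel_measurable borel"
  by (simp add: schwartz_smooth smooth_measurable)

lemma schwartz_lincomb: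
  assumes "f \<in> schwartz" "g \<in> schwartz"
  shows "(\<lambda>x. a * f x + b * g x) \<in> schwartz"
proof (rule schwartz_coinduct[of "\<lambda>h. \<exists>f g. f \<in> schwartz \<and> g \<in> schwartz \<and> h = (\<lambda>x. a * f x + b * g x)"])
  fix h :: "R3 \<Rightarrow> complex"
  assume "\<exists>f g. f \<in> schwartz \<and> g \<in> schwartz \<and> h = (\<lambda>x. a * f x + b * g x)"
  then obtain f g where fg: "f \<in> schwartz" "g \<in> schwartz" and h: "h = (\<lambda>x. a * f x + b * g x)" by auto
  note sd = fg[THEN schwartz_differentiable]
  have d: "(h has_derivative (\<lambda>y. a * frechet_derivative f (at x) y + b * frechet_derivative g (at x) y)) (at x)" for x
    unfolding h using sd
    by (intro has_derivative_add has_derivative_mult_right frechet_derivative_worksI)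
  have p: "partial i h = (\<lambda>x. a * partial i f x + b * partial i g x)" for i
    by (rule ext, subst partial_eqI[OF d]) (simp add: partial_def)
  have "\<exists>C. \<forall>x. (1 + norm x) ^ k * norm (h x) \<le> C" for k
  proof -
    obtain C D where C: "\<And>x. (1 + norm x) ^ k * norm (f x) \<le> C" and D: "\<And>x. (1 + norm x) ^ k * norm (g x) \<le> D"
      using fg schwartz_bound by metis
    have "(1 + norm x) ^ k * norm (h x) \<le> norm a * C + norm b * D" for x
    proof -
      have "(1 + norm x) ^ k * norm (h x) \<le> (1 + norm x) ^ k * (norm a * norm (f x) + norm b * norm (g x))"
        unfolding h by (intro mult_left_mono order_trans[OF norm_triangle_ineq]) (auto simp: norm_mult)
      also have "\<dots> = norm a * ((1 + norm x) ^ k * norm (f x)) + norm b * ((1 + norm x) ^ k * norm (g x))"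
        by (simp add: algebra_simps)
      also have "\<dots> \<le> norm a * C + norm b * D"
        by (intro add_mono mult_left_mono C D) auto
      finally show ?thesis .
    qed
    then show ?thesis by blast
  qed
  moreover have "h differentiable (at x)" for x
    by (rule differentiableI[OF d])
  ultimately show "(\<forall>x. h differentiable (at x)) \<and> (\<forall>k. \<exists>C. \<forall>x. (1 + norm x) ^ k * norm (h x) \<le> C) \<and>
    (\<forall>i. \<exists>f g. f \<in> schwartz \<and> g \<in> schwartz \<and> partial i h = (\<lambda>x. a * f x + b * g x))"
    using p fg schwartz_partial by blast
qed (use assms in blast)

lemma schwartz_zero: "(\<lambda>x. 0) \<in> schwartz"
proof (rule schwartz_coinduct[of "\<lambda>f. f = (\<lambda>x. 0)"])
  have "partial i (\<lambda>x. 0) = (\<lambda>x. 0::complex)" for i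
    by (rule ext, subst partial_eqI) (auto intro: has_derivative_const)
  then show "(\<forall>x. f differentiable (at x)) \<and>
    (\<forall>k. \<exists>C. \<forall>x. (1 + norm x) ^ k * norm (f x) \<le> C) \<and> (\<forall>i. partial i f = (\<lambda>x. 0))" if "f = (\<lambda>x. 0)" for f :: "R3 \<Rightarrow> complex"
    using that by auto
qed auto

lemma schwartz_cmult: "f \<in> schwartz \<Longrightarrow> (\<lambda>x. c * f x) \<in> schwartz"
  using schwartz_lincomb[of f f c 0] by simp

lemma schwartz_sum: "finite A \<Longrightarrow> (\<And>a. a \<in> A \<Longrightarrow> f a \<in> schwartz) \<Longrightarrow> (\<lambda>x. \<Sum>a\<in>A. f a x) \<in> schwartz"
proof (induction A rule: finite_induct)
  case (insert a A)
  then show ?case using schwartz_lincomb[of "f a" "\<lambda>x. \<Sum>a\<in>A. f a x" 1 1] by simp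
qed (auto simp: schwartz_zero)

lemma schwartz_compact_support:
  assumes "smooth f" and R: "\<And>x. R < norm x \<Longrightarrow> f x = 0"
  shows "f \<in> schwartz"
proof (rule schwartz_coinduct[of "\<lambda>f. smooth f \<and> (\<forall>x. R < norm x \<longrightarrow> f x = 0)"])
  fix f :: "R3 \<Rightarrow> complex"
  assume f: "smooth f \<and> (\<forall>x. R < norm x \<longrightarrow> f x = 0)"
  have "partial i f x = 0" if x: "R < norm x" for x i
  proof -
    have "(f has_derivative (\<lambda>h. 0)) (at x)"
    proof (rule has_derivative_transform_within_open[OF has_derivative_const[of 0]])
      show "open {x::R3. R < norm x}"
        by (intro open_Collect_less continuous_intros)
    qed (use f x in auto)
    then show ?thesis
      using partial_eqI by fastforce
  qed
  moreover have "\<exists>C. \<forall>x. (1 + norm x) ^ k * norm (f x) \<le> C" for k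
  proof -
    have "continuous_on (cball 0 R) (\<lambda>x. (1 + norm x) ^ k * norm (f x))"
      using smooth_continuous f by (intro continuous_intros) (auto intro: continuous_on_subset)
    then have "bdd_above ((\<lambda>x. (1 + norm x) ^ k * norm (f x)) ` cball 0 R)"
      by (intro bounded_imp_bdd_above compact_imp_bounded compact_continuous_image) auto
    then obtain C where "\<forall>y\<in>(\<lambda>x. (1 + norm x) ^ k * norm (f x)) ` cball 0 R. y \<le> C"
      unfolding bdd_above_def by blast
    then have C: "norm x \<le> R \<Longrightarrow> (1 + norm x) ^ k * norm (f x) \<le> C" for x
      by simp
    have "(1 + norm x) ^ k * norm (f x) \<le> max 0 C" for x
      using C[of x] f by (cases "norm x \<le> R") auto
    then show ?thesis by blast
  qed
  ultimately show "(\<forall>x. f differentiable (at x)) \<and> (\<forall>k. \<exists>C. \<forall>x. (1 + norm x) ^ k * norm (f x) \<le> C) \<and>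
    (\<forall>i. smooth (partial i f) \<and> (\<forall>x. R < norm x \<longrightarrow> partial i f x = 0))"
    using f smooth_partial smooth_differentiable by blast
qed (use assms in auto)

lemma integrable_weight_schwartz:
  assumes "f \<in> schwartz"
  shows "integrable lborel (\<lambda>x. norm x ^ k *\<^sub>R f x)"
proof -
  have [measurable]: "f \<in> borel_measurable borel"
    using assms by (rule schwartz_measurable)
  obtain C where C: "\<And>x. (1 + norm x) ^ (6 + k) * norm (f x) \<le> C"
    using schwartz_bound[OF assms] by blast
  show ?thesis
  proof (rule integrable_decay)
    fix x
    have "(1 + norm x) ^ 6 * norm (norm x ^ k *\<^sub>R f x) \<le> (1 + norm x) ^ 6 * ((1 + norm x) ^ k * norm (f x))"
      by (auto intro!: mult_left_mono mult_right_mono power_mono)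
    also have "\<dots> \<le> C"
      using C[of x] by (simp add: power_add mult.assoc)
    finally show "(1 + norm x) ^ 6 * norm (norm x ^ k *\<^sub>R f x) \<le> C" .
  qed measurable
qed

lemma integrable_schwartz: "f \<in> schwartz \<Longrightarrow> integrable lborel f"
  using integrable_weight_schwartz[of f 0] by simp

lemma schwartz_bounded:
  assumes "f \<in> schwartz" obtains C where "\<And>x. norm (f x) \<le> C"
  using schwartz_bound[OF assms, of 0] by auto

section \<open>Fourier transform\<close>

lemma measurable_cis [measurable]: "cis \<in> borel_measurable borel"
  by (intro borel_measurable_continuous_onI continuous_intros)

lemma measurable_vec_nth [measurable]: "(\<lambda>x::real^'n. x $ i) \<in> borel_measurable borel"
  by (intro borel_measurable_continuous_onI continuous_intros)

lemma integral_scale: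
  fixes t :: "'a::euclidean_space" and f :: "'a \<Rightarrow> complex"
  assumes "s \<noteq> 0" and [measurable]: "f \<in> borel_measurable borel"
  shows "(LINT x|lborel. f x) = \<bar>s\<bar> ^ DIM('a) *\<^sub>R (LINT x|lborel. f (t + s *\<^sub>R x))"
  by (subst lborel_affine[OF assms(1), of t], subst integral_density)
    (simp_all add: integral_distr del: scaleR_conv_of_real)

text \<open>The form in which Fubini's theorem is applied repeatedly: a tensor product of integrable
  functions times a bounded kernel, such as an exponential or a translate of
  \<open>chi\<close>.\<close>

lemma fubini_kernel:
  fixes f :: "'a::euclidean_space \<Rightarrow> complex" and g :: "'b::euclidean_space \<Rightarrow> complex"
  assumes f: "integrable lborel f" and g: "integrable lborel g"
    and K[measurable]: "(\<lambda>(x, y). K x y) \<in> borel_measurable (borel \<Otimes>\<^sub>M borel)"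
    and B: "\<And>x y. norm (K x y) \<le> B"
  shows "integrable (lborel \<Otimes>\<^sub>M lborel) (\<lambda>(x, y). f x * g y * K x y)"
    and "(LINT y|lborel. LINT x|lborel. f x * g y * K x y) = (LINT x|lborel. LINT y|lborel. f x * g y * K x y)"
proof -
  have [measurable]: "f \<in> borel_measurable borel" "g \<in> borel_measurable borel"
    using f g by (auto dest: borel_measurable_integrable)
  have "integrable (lborel \<Otimes>\<^sub>M lborel) (\<lambda>(x, y). f x * g y)"
  proof (rule lborel_pair.Fubini_integrable)
    show "integrable lborel (\<lambda>x. LINT y|lborel. norm (case (x, y) of (x, y) \<Rightarrow> f x * g y))"
      using f by (simp add: norm_mult)
    show "AE x in lborel. integrable lborel (\<lambda>y. case (x, y) of (x, y) \<Rightarrow> f x * g y)"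
      using g by simp
  qed simp
  then have "integrable (lborel \<Otimes>\<^sub>M lborel) (\<lambda>p. B *\<^sub>R (\<lambda>(x, y). f x * g y) p)"
    by (rule integrable_scaleR_right)
  then show i: "integrable (lborel \<Otimes>\<^sub>M lborel) (\<lambda>(x, y). f x * g y * K x y)"
  proof (rule Bochner_Integration.integrable_bound)
    show "AE p in lborel \<Otimes>\<^sub>M lborel. norm (case p of (x, y) \<Rightarrow> f x * g y * K x y)
        \<le> norm (B *\<^sub>R (\<lambda>(x, y). f x * g y) p)"
    proof (rule AE_I2, clarsimp simp: norm_mult)
      fix x y
      have "norm (K x y) \<le> \<bar>B\<bar>"
        using B[of x y] by linarith
      then show "norm (f x) * norm (g y) * norm (K x y) \<le> \<bar>B\<bar> * (norm (f x) * norm (g y))"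
        by (subst mult.commute[of "\<bar>B\<bar>"]) (intro mult_left_mono, auto)
    qed
  qed simp
  show "(LINT y|lborel. LINT x|lborel. f x * g y * K x y) = (LINT x|lborel. LINT y|lborel. f x * g y * K x y)"
    by (rule lborel_pair.Fubini_integral[OF i])
qed

lemma integrable_bounded_mult:
  fixes f :: "'a::euclidean_space \<Rightarrow> complex"
  assumes f: "integrable lborel f" and g[measurable]: "g \<in> borel_measurable borel"
    and B: "\<And>x. norm (g x) \<le> B"
  shows "integrable lborel (\<lambda>x. g x * f x)" "integrable lborel (\<lambda>x. f x * g x)"
proof -
  have [measurable]: "f \<in> borel_measurable borel"
    using f by (auto dest: borel_measurable_integrable)
  show "integrable lborel (\<lambda>x. f x * g x)"
  proof (rule Bochner_Integration.integrable_bound[OF integrable_scaleR_right[OF f, of B]])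
    show "AE x in lborel. norm (f x * g x) \<le> norm (B *\<^sub>R f x)"
    proof (rule AE_I2)
      fix x
      have "norm (g x) \<le> \<bar>B\<bar>" using B[of x] by linarith
      then show "norm (f x * g x) \<le> norm (B *\<^sub>R f x)"
        using mult_right_mono[of "norm (g x)" "\<bar>B\<bar>" "norm (f x)"] by (simp add: norm_mult mult_ac)
    qed
  qed simp
  then show "integrable lborel (\<lambda>x. g x * f x)"
    by (simp add: mult.commute)
qed

lemma integrable_cis: "integrable lborel f \<Longrightarrow> integrable lborel (\<lambda>x::R3. cis (x \<bullet> \<xi>) * f x)"
  by (rule integrable_bounded_mult(1)[where B=1]) auto

lemma integrable_cis_minus: "integrable lborel f \<Longrightarrow> integrable lborel (\<lambda>x::R3. cis (- (x \<bullet> \<xi>)) * f x)"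
  by (rule integrable_bounded_mult(1)[where B=1]) auto

lemma IFT_eq_FT: "IFT f x = FT f (- x) / complex_of_real ((2 * pi) ^ 3)"
  by (simp add: IFT_def FT_def inner_commute)

lemma FT_bound: "norm (FT f \<xi>) \<le> (LINT x|lborel. norm (f x))"
  unfolding FT_def by (rule order_trans[OF integral_norm_bound]) (simp add: norm_mult)

lemma FT_continuous:
  assumes f: "integrable lborel f"
  shows "continuous_on UNIV (FT f)"
proof (rule continuous_at_imp_continuous_on, safe)
  fix \<xi>
  have [measurable]: "f \<in> borel_measurable borel"
    using f by (auto dest: borel_measurable_integrable)
  show "isCont (FT f) \<xi>"
    unfolding continuous_at_sequentially o_def
  proof safe
    fix u assume u: "u \<longlonglongrightarrow> \<xi>"
    show "(\<lambda>n. FT f (u n)) \<longlonglongrightarrow> FT f \<xi>"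
      unfolding FT_def
    proof (rule integral_dominated_convergence[where w="\<lambda>x. norm (f x)"])
      show "AE x in lborel. (\<lambda>n. cis (- (x \<bullet> u n)) * f x) \<longlonglongrightarrow> cis (- (x \<bullet> \<xi>)) * f x"
        by (intro AE_I2 tendsto_intros u)
    qed (use f in \<open>auto simp: norm_mult\<close>)
  qed
qed

lemma FT_measurable: "integrable lborel f \<Longrightarrow> FT f \<in> borel_measurable borel"
  by (intro borel_measurable_continuous_onI FT_continuous)

lemma IFT_continuous: "integrable lborel f \<Longrightarrow> continuous_on UNIV (IFT f)"
  unfolding IFT_eq_FT
  by (intro continuous_intros continuous_on_compose2[OF FT_continuous]) auto

lemma IFT_measurable: "integrable lborel f \<Longrightarrow> IFT f \<in> borel_measurable borel"
  by (intro borel_measurable_continuous_onI IFT_continuous)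

lemma IFT_bound: "norm (IFT f \<xi>) \<le> (LINT x|lborel. norm (f x)) / (2 * pi) ^ 3"
  unfolding IFT_eq_FT by (simp add: norm_divide norm_power divide_right_mono FT_bound abs_of_pos)

lemma FT_multiplication:
  assumes f: "integrable lborel f" and g: "integrable lborel g"
  shows "(LINT \<xi>|lborel. FT f \<xi> * g \<xi>) = (LINT x|lborel. f x * FT g x)"
proof -
  have "(LINT \<xi>|lborel. FT f \<xi> * g \<xi>) = (LINT \<xi>|lborel. LINT x|lborel. f x * g \<xi> * cis (- (x \<bullet> \<xi>)))"
    unfolding FT_def by (subst integral_mult_left_zero[symmetric]) (simp add: mult_ac)
  also have "\<dots> = (LINT x|lborel. LINT \<xi>|lborel. f x * g \<xi> * cis (- (x \<bullet> \<xi>)))"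
    by (rule fubini_kernel(2)[OF f g, where B=1]) auto
  also have "\<dots> = (LINT x|lborel. f x * FT g x)"
    unfolding FT_def
    by (subst integral_mult_right_zero[symmetric]) (simp add: mult_ac inner_commute)
  finally show ?thesis .
qed

lemma IFT_multiplication:
  assumes f: "integrable lborel f" and g: "integrable lborel g"
  shows "(LINT \<xi>|lborel. IFT f \<xi> * g \<xi>) = (LINT x|lborel. f x * IFT g x)"
proof -
  have [measurable]: "f \<in> borel_measurable borel" "g \<in> borel_measurable borel"
    using f g by (auto dest: borel_measurable_integrable)
  have gm: "integrable lborel (\<lambda>x. g (- x))"
    using integrable_affine_iff[of "-1" g 0] g by simp
  have "(LINT \<xi>|lborel. FT f (- \<xi>) * g \<xi>) = (LINT \<xi>|lborel. FT f \<xi> * g (- \<xi>))"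
    using integral_affine[of "-1" "\<lambda>\<xi>. FT f \<xi> * g (- \<xi>)" 0] FT_measurable[OF f] by simp
  also have "\<dots> = (LINT x|lborel. f x * FT (\<lambda>x. g (- x)) x)"
    by (rule FT_multiplication[OF f gm])
  also have "FT (\<lambda>x. g (- x)) = (\<lambda>\<xi>. FT g (- \<xi>))"
    unfolding FT_def using integral_affine[of "-1" "\<lambda>x. cis (- (x \<bullet> - _)) * g x" 0] by simp
  finally show ?thesis
    unfolding IFT_eq_FT by simp
qed

text \<open>The second moment makes the Taylor remainder of the exponential quadratic in
  \<open>norm h\<close> after integration, so the derivative follows from a direct estimate. The
  first moment, which the derivative itself involves, is bounded through t \<le> 1 + t^2.\<close>

lemma FT_has_derivative:
  assumes f: "integrable lborel f" and f2: "integrable lborel (\<lambda>x. (norm x)\<^sup>2 *\<^sub>R f x)"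
  shows "(FT f has_derivative (\<lambda>h. LINT x|lborel. - \<i> * of_real (x \<bullet> h) * (cis (- (x \<bullet> \<xi>)) * f x))) (at \<xi>)"
    and "integrable lborel (\<lambda>x. - \<i> * of_real (x \<bullet> h) * (cis (- (x \<bullet> \<xi>)) * f x))"
proof -
  have [measurable]: "f \<in> borel_measurable borel"
    using f by (auto dest: borel_measurable_integrable)
  have f1: "integrable lborel (\<lambda>x. norm x *\<^sub>R f x)"
  proof (rule Bochner_Integration.integrable_bound[OF Bochner_Integration.integrable_add[OF integrable_norm[OF f] integrable_norm[OF f2]]])
    have "norm (norm x *\<^sub>R f x) \<le> norm (norm (f x) + norm ((norm x)\<^sup>2 *\<^sub>R f x))" for x
    proof -
      have "norm x \<le> 1 + (norm x)\<^sup>2"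
        using zero_le_power2[of "norm x - 1"] unfolding power2_diff by (smt (verit) norm_ge_zero one_power2 zero_le_power2)
      then have "norm x * norm (f x) \<le> (1 + (norm x)\<^sup>2) * norm (f x)"
        by (rule mult_right_mono) auto
      then show ?thesis by (simp add: algebra_simps)
    qed
    then show "AE x in lborel. norm (norm x *\<^sub>R f x) \<le> norm (norm (f x) + norm ((norm x)\<^sup>2 *\<^sub>R f x))"
      by (rule AE_I2)
  qed measurable
  show i: "integrable lborel (\<lambda>x. - \<i> * of_real (x \<bullet> h) * (cis (- (x \<bullet> \<xi>)) * f x))" for h
  proof (rule Bochner_Integration.integrable_bound[OF integrable_scaleR_right[OF f1, of "norm h"]])
    have "norm (- \<i> * of_real (x \<bullet> h) * (cis (- (x \<bullet> \<xi>)) * f x)) \<le> norm (norm h *\<^sub>R norm x *\<^sub>R f x)" for x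
      using mult_right_mono[OF Cauchy_Schwarz_ineq2[of x h], of "norm (f x)"] by (simp add: norm_mult mult_ac)
    then show "AE x in lborel. norm (- \<i> * of_real (x \<bullet> h) * (cis (- (x \<bullet> \<xi>)) * f x)) \<le> norm (norm h *\<^sub>R norm x *\<^sub>R f x)"
      by (rule AE_I2)
  qed measurable
  define K where "K = (LINT x|lborel. norm ((norm x)\<^sup>2 *\<^sub>R f x))"
  have K0: "0 \<le> K" unfolding K_def by simp
  have bl: "bounded_linear (\<lambda>h. LINT x|lborel. - \<i> * of_real (x \<bullet> h) * (cis (- (x \<bullet> \<xi>)) * f x))"
  proof (rule bounded_linear_intro[where K="LINT x|lborel. norm (norm x *\<^sub>R f x)"])
    fix h k :: R3 and r :: real
    show "(LINT x|lborel. - \<i> * of_real (x \<bullet> (h + k)) * (cis (- (x \<bullet> \<xi>)) * f x)) =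
      (LINT x|lborel. - \<i> * of_real (x \<bullet> h) * (cis (- (x \<bullet> \<xi>)) * f x)) +
      (LINT x|lborel. - \<i> * of_real (x \<bullet> k) * (cis (- (x \<bullet> \<xi>)) * f x))"
      by (subst Bochner_Integration.integral_add[OF i i, symmetric]) (simp add: inner_add_right algebra_simps)
    show "(LINT x|lborel. - \<i> * of_real (x \<bullet> (r *\<^sub>R h)) * (cis (- (x \<bullet> \<xi>)) * f x)) =
      r *\<^sub>R (LINT x|lborel. - \<i> * of_real (x \<bullet> h) * (cis (- (x \<bullet> \<xi>)) * f x))"
      by (subst integral_scaleR_right[symmetric]) (simp add: scaleR_conv_of_real[where 'a=complex] mult_ac)
    have "norm (LINT x|lborel. - \<i> * of_real (x \<bullet> h) * (cis (- (x \<bullet> \<xi>)) * f x))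
      \<le> (LINT x|lborel. norm h * norm (norm x *\<^sub>R f x))"
    proof (rule Bochner_Integration.integral_norm_bound_integral[OF i])
      show "integrable lborel (\<lambda>x. norm h * norm (norm x *\<^sub>R f x))"
        using f1 by (intro integrable_mult_right integrable_norm)
      fix x show "norm (- \<i> * of_real (x \<bullet> h) * (cis (- (x \<bullet> \<xi>)) * f x)) \<le> norm h * norm (norm x *\<^sub>R f x)"
        using mult_right_mono[OF Cauchy_Schwarz_ineq2[of x h], of "norm (f x)"] by (simp add: norm_mult mult_ac)
    qed
    then show "norm (LINT x|lborel. - \<i> * of_real (x \<bullet> h) * (cis (- (x \<bullet> \<xi>)) * f x))
      \<le> norm h * (LINT x|lborel. norm (norm x *\<^sub>R f x))"
      by simp
  qed
  have est: "norm (FT f (\<xi> + h) - FT f \<xi> - (LINT x|lborel. - \<i> * of_real (x \<bullet> h) * (cis (- (x \<bullet> \<xi>)) * f x))) \<le> K * (norm h)\<^sup>2" for h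
  proof -
    have "FT f (\<xi> + h) - FT f \<xi> - (LINT x|lborel. - \<i> * of_real (x \<bullet> h) * (cis (- (x \<bullet> \<xi>)) * f x)) =
      (LINT x|lborel. cis (- (x \<bullet> (\<xi> + h))) * f x - cis (- (x \<bullet> \<xi>)) * f x - - \<i> * of_real (x \<bullet> h) * (cis (- (x \<bullet> \<xi>)) * f x))"
      unfolding FT_def
      by (subst Bochner_Integration.integral_diff Bochner_Integration.integrable_diff integrable_cis_minus f i;
          (intro Bochner_Integration.integrable_diff integrable_cis_minus f i)?)+ simp
    also have "norm \<dots> \<le> (LINT x|lborel. (norm h)\<^sup>2 * norm ((norm x)\<^sup>2 *\<^sub>R f x))"
    proof (rule Bochner_Integration.integral_norm_bound_integral)
      fix x
      have "cis (- (x \<bullet> (\<xi> + h))) * f x - cis (- (x \<bullet> \<xi>)) * f x - - \<i> * of_real (x \<bullet> h) * (cis (- (x \<bullet> \<xi>)) * f x)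
        = (cis (- (x \<bullet> h)) - (1 + \<i> * of_real (- (x \<bullet> h)))) * (cis (- (x \<bullet> \<xi>)) * f x)"
      proof -
        have "cis (- (x \<bullet> (\<xi> + h))) = cis (- (x \<bullet> \<xi>)) * cis (- (x \<bullet> h))"
          by (simp add: cis_mult inner_add_right)
        then show ?thesis by (simp add: algebra_simps)
      qed
      moreover have "norm (cis (- (x \<bullet> h)) - (1 + \<i> * of_real (- (x \<bullet> h)))) \<le> (norm x)\<^sup>2 * (norm h)\<^sup>2"
      proof -
        have "norm (cis t - (1 + \<i> * of_real t)) \<le> \<bar>t\<bar>\<^sup>2 / 2" for t
          using iexp_approx1[of t 1] by (simp add: cis_conv_exp numeral_2_eq_2)
        from this[of "- (x \<bullet> h)"]
        have "norm (cis (- (x \<bullet> h)) - (1 + \<i> * of_real (- (x \<bullet> h)))) \<le> \<bar>x \<bullet> h\<bar>\<^sup>2 / 2"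
          by simp
        also have "\<dots> \<le> \<bar>x \<bullet> h\<bar>\<^sup>2" by simp
        also have "\<dots> \<le> (norm x * norm h)\<^sup>2"
          by (intro power_mono Cauchy_Schwarz_ineq2) auto
        finally show ?thesis by (simp add: power_mult_distrib)
      qed
      ultimately show "norm (cis (- (x \<bullet> (\<xi> + h))) * f x - cis (- (x \<bullet> \<xi>)) * f x - - \<i> * of_real (x \<bullet> h) * (cis (- (x \<bullet> \<xi>)) * f x))
        \<le> (norm h)\<^sup>2 * norm ((norm x)\<^sup>2 *\<^sub>R f x)"
        using mult_right_mono[of "norm (cis (- (x \<bullet> h)) - (1 + \<i> * of_real (- (x \<bullet> h))))" "(norm x)\<^sup>2 * (norm h)\<^sup>2" "norm (f x)"]
        by (simp only: norm_mult norm_cis mult_1_left norm_scaleR abs_power2 mult_ac norm_ge_zero real_norm_def)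
    next
      show "integrable lborel (\<lambda>x. cis (- (x \<bullet> (\<xi> + h))) * f x - cis (- (x \<bullet> \<xi>)) * f x - - \<i> * of_real (x \<bullet> h) * (cis (- (x \<bullet> \<xi>)) * f x))"
        by (intro Bochner_Integration.integrable_diff integrable_cis_minus f i)
      show "integrable lborel (\<lambda>x. (norm h)\<^sup>2 * norm ((norm x)\<^sup>2 *\<^sub>R f x))"
        by (intro integrable_mult_right integrable_norm f2)
    qed
    also have "\<dots> = K * (norm h)\<^sup>2"
      by (simp add: K_def)
    finally show ?thesis .
  qed
  show "(FT f has_derivative (\<lambda>h. LINT x|lborel. - \<i> * of_real (x \<bullet> h) * (cis (- (x \<bullet> \<xi>)) * f x))) (at \<xi>)"
    unfolding has_derivative_at_alt
  proof (intro conjI bl allI impI)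
    fix e :: real assume e: "0 < e"
    show "\<exists>d>0. \<forall>y. norm (y - \<xi>) < d \<longrightarrow> norm (FT f y - FT f \<xi> - (LINT x|lborel. - \<i> * of_real (x \<bullet> (y - \<xi>)) * (cis (- (x \<bullet> \<xi>)) * f x))) \<le> e * norm (y - \<xi>)"
    proof (intro exI[of _ "e / (K + 1)"] conjI allI impI)
      show "0 < e / (K + 1)" using e K0 by simp
      fix y assume y: "norm (y - \<xi>) < e / (K + 1)"
      have "K * norm (y - \<xi>) \<le> (K + 1) * norm (y - \<xi>)"
        by (intro mult_right_mono) auto
      also have "\<dots> \<le> e"
        using y K0 by (simp add: pos_less_divide_eq mult.commute less_imp_le)
      finally have "K * norm (y - \<xi>) * norm (y - \<xi>) \<le> e * norm (y - \<xi>)"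
        by (intro mult_right_mono) auto
      then show "norm (FT f y - FT f \<xi> - (LINT x|lborel. - \<i> * of_real (x \<bullet> (y - \<xi>)) * (cis (- (x \<bullet> \<xi>)) * f x))) \<le> e * norm (y - \<xi>)"
        using est[of "y - \<xi>"] by (simp add: power2_eq_square mult.assoc)
    qed
  qed
qed

lemma partial_FT:
  assumes f: "integrable lborel f" and f2: "integrable lborel (\<lambda>x. (norm x)\<^sup>2 *\<^sub>R f x)"
  shows "partial i (FT f) \<xi> = FT (\<lambda>x. - \<i> * of_real (x $ i) * f x) \<xi>"
    and "integrable lborel (\<lambda>x. - \<i> * of_real (x $ i) * f x)"
    and "FT f differentiable (at \<xi>)"
  using partial_eqI[OF FT_has_derivative(1)[OF assms], of i \<xi>] FT_has_derivative(2)[OF assms, of "axis i 1" 0]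
    FT_has_derivative(1)[OF assms]
  by (auto simp: inner_axis FT_def mult_ac intro: differentiableI)

lemma partial_IFT:
  assumes f: "integrable lborel f" and f2: "integrable lborel (\<lambda>x. (norm x)\<^sup>2 *\<^sub>R f x)"
  shows "partial i (IFT f) x = IFT (\<lambda>\<xi>. \<i> * of_real (\<xi> $ i) * f \<xi>) x"
    and "integrable lborel (\<lambda>x. \<i> * of_real (x $ i) * f x)"
    and "IFT f differentiable (at x)"
proof -
  have "(uminus has_derivative (\<lambda>h. - h)) (at x)"
    by (rule has_derivative_minus[OF has_derivative_ident])
  from has_derivative_compose[OF this FT_has_derivative(1)[OF assms]]
  have "((\<lambda>x. FT f (- x)) has_derivative
    (\<lambda>h. LINT xa|lborel. - \<i> * of_real (xa \<bullet> - h) * (cis (- (xa \<bullet> - x)) * f xa))) (at x)" .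
  then have d: "(IFT f has_derivative
    (\<lambda>h. (LINT xa|lborel. - \<i> * of_real (xa \<bullet> - h) * (cis (- (xa \<bullet> - x)) * f xa)) * inverse (complex_of_real ((2 * pi) ^ 3)))) (at x)"
    unfolding IFT_eq_FT[abs_def] divide_inverse by (rule has_derivative_mult_left)
  show "partial i (IFT f) x = IFT (\<lambda>\<xi>. \<i> * of_real (\<xi> $ i) * f \<xi>) x"
  proof -
    have eq: "- \<i> * of_real (y \<bullet> - axis i 1) * (cis (- (y \<bullet> - x)) * f y) = cis (x \<bullet> y) * (\<i> * of_real (y $ i) * f y)" for y
      by (simp add: inner_axis inner_commute[of y x])
    show ?thesis
      unfolding partial_eqI[OF d] IFT_def divide_inverse by (simp only: eq)
  qed
  show "IFT f differentiable (at x)"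
    by (rule differentiableI[OF d])
  show "integrable lborel (\<lambda>x. \<i> * of_real (x $ i) * f x)"
    using Bochner_Integration.integrable_minus[OF partial_FT(2)[OF assms, of i]] by simp
qed

section \<open>Integration by parts and decay\<close>

text \<open>The difference quotients of \<open>f\<close> have integral 0 by translation invariance,
  and dominated convergence passes this on to the derivative. This takes the place of integration
  along coordinate lines.\<close>

lemma integral_partial_eq_0:
  fixes f :: "R3 \<Rightarrow> complex"
  assumes diff: "\<And>x. f differentiable (at x)" and f: "integrable lborel f"
    and [measurable]: "partial i f \<in> borel_measurable borel"
    and C: "\<And>x. (1 + norm x) ^ 6 * norm (partial i f x) \<le> C"
  shows "(LINT x|lborel. partial i f x) = 0"
proof -
  have [measurable]: "f \<in> borel_measurable borel"
    using f by (auto dest: borel_measurable_integrable)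
  define h where "h n = 1 / real (Suc n)" for n
  have h: "0 < h n" "h n \<le> 1" for n
    by (auto simp: h_def)
  have h0: "h \<longlonglongrightarrow> 0"
    unfolding h_def by (rule LIMSEQ_Suc[OF lim_1_over_n])
  define D where "D n x = (f (x + h n *\<^sub>R axis i 1) - f x) / of_real (h n)" for n x
  have "(\<lambda>n. LINT x|lborel. D n x) \<longlonglongrightarrow> (LINT x|lborel. partial i f x)"
  proof (rule integral_dominated_convergence[where w="\<lambda>x. C * 2 ^ 6 * (1 / (1 + norm x) ^ 6)"])
    show "integrable lborel (\<lambda>x::R3. C * 2 ^ 6 * (1 / (1 + norm x) ^ 6))"
      using integrable_inverse_weight by (rule integrable_mult_right)
    have "(\<lambda>n. D n x) \<longlonglongrightarrow> partial i f x" for x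
    proof -
      let ?f' = "frechet_derivative f (at x)"
      note d = frechet_derivative_worksI[OF diff[of x]]
      have "((\<lambda>y. norm (f (x + y) - f x - ?f' y) / norm y) \<longlongrightarrow> 0) (at 0)"
        using d unfolding has_derivative_at by blast
      moreover have "filterlim (\<lambda>n. h n *\<^sub>R (axis i 1 :: R3)) (at 0) sequentially"
        unfolding filterlim_at
      proof
        show "\<forall>\<^sub>F n in sequentially. h n *\<^sub>R (axis i 1 :: R3) \<in> UNIV \<and> h n *\<^sub>R (axis i 1 :: R3) \<noteq> 0"
          using h(1) by (intro always_eventually allI) (simp add: less_imp_neq[THEN not_sym] axis_eq_0_iff)
        show "(\<lambda>n. h n *\<^sub>R (axis i 1 :: R3)) \<longlonglongrightarrow> 0"
          using tendsto_scaleR[OF h0 tendsto_const[of "axis i 1 :: R3"]] by simp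
      qed
      ultimately have "(\<lambda>n. norm (f (x + h n *\<^sub>R axis i 1) - f x - ?f' (h n *\<^sub>R axis i 1)) / norm (h n *\<^sub>R (axis i 1 :: R3))) \<longlonglongrightarrow> 0"
        by (rule filterlim_compose)
      moreover have "norm (f (x + h n *\<^sub>R axis i 1) - f x - ?f' (h n *\<^sub>R axis i 1)) / norm (h n *\<^sub>R (axis i 1 :: R3)) = norm (D n x - partial i f x)" for n
      proof -
        have "?f' (h n *\<^sub>R axis i 1) = h n *\<^sub>R partial i f x"
          unfolding partial_def by (rule linear_scale[OF has_derivative_linear[OF d]])
        moreover have "D n x - partial i f x = (f (x + h n *\<^sub>R axis i 1) - f x - h n *\<^sub>R partial i f x) / of_real (h n)"
          using h(1)[of n] by (simp add: D_def field_simps scaleR_conv_of_real)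
        ultimately show ?thesis
          using h(1)[of n] by (simp add: norm_divide)
      qed
      ultimately have "(\<lambda>n. norm (D n x - partial i f x)) \<longlonglongrightarrow> 0"
        by simp
      then show ?thesis
        by (simp add: tendsto_norm_zero_iff LIM_zero_iff)
    qed
    then show "AE x in lborel. (\<lambda>n. D n x) \<longlonglongrightarrow> partial i f x"
      by (rule AE_I2)
    have "norm (D n x) \<le> C * 2 ^ 6 * (1 / (1 + norm x) ^ 6)" for n x
    proof -
      \<comment> \<open>Mean value inequality on the segment. A shift of length at most 1 changes
        \<open>1 + norm x\<close> by a factor of at most 2, hence the constant 2^6.\<close>
      have "norm (f (x + h n *\<^sub>R axis i 1) - f (x + 0 *\<^sub>R axis i 1)) \<le> (C * 2 ^ 6 * (1 / (1 + norm x) ^ 6)) * norm (h n - 0)"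
      proof (rule differentiable_bound[of "{0..1}" "\<lambda>t. f (x + t *\<^sub>R axis i 1)" "\<lambda>t s. s *\<^sub>R partial i f (x + t *\<^sub>R axis i 1)"])
        fix t :: real assume t: "t \<in> {0..1}"
        have "((\<lambda>t::real. x + t *\<^sub>R axis i 1) has_derivative (\<lambda>t. t *\<^sub>R axis i 1)) (at t within {0..1})"
          by (auto intro!: derivative_eq_intros)
        from has_derivative_compose[OF this, of f "frechet_derivative f (at (x + t *\<^sub>R axis i 1))"]
        have "((\<lambda>t::real. f (x + t *\<^sub>R axis i 1)) has_derivative (\<lambda>s. frechet_derivative f (at (x + t *\<^sub>R axis i 1)) (s *\<^sub>R axis i 1))) (at t within {0..1})"
          using frechet_derivative_worksI[OF diff] by simp
        moreover have "frechet_derivative f (at y) (s *\<^sub>R axis i 1) = s *\<^sub>R partial i f y" for s y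
          unfolding partial_def
          by (rule linear_scale[OF has_derivative_linear[OF frechet_derivative_worksI[OF diff]]])
        ultimately show "((\<lambda>t. f (x + t *\<^sub>R axis i 1)) has_derivative (\<lambda>s. s *\<^sub>R partial i f (x + t *\<^sub>R axis i 1))) (at t within {0..1})"
          by simp
        let ?y = "x + t *\<^sub>R axis i 1"
        have "norm (partial i f ?y) \<le> C * 2 ^ 6 * (1 / (1 + norm x) ^ 6)"
        proof -
          have "norm x \<le> norm ?y + norm (t *\<^sub>R (axis i 1 :: R3))"
            using norm_triangle_ineq4[of ?y "t *\<^sub>R axis i 1"] by simp
          also have "\<dots> \<le> norm ?y + 1" using t by simp
          finally have "norm x \<le> norm ?y + 1" .
          then have "1 + norm x \<le> 1 + (norm ?y + 1)" by (rule add_left_mono)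
          also have "\<dots> \<le> 2 * (1 + norm ?y)" by simp
          finally have "1 + norm x \<le> 2 * (1 + norm ?y)" .
          then have "(1 + norm x) ^ 6 \<le> (2 * (1 + norm ?y)) ^ 6"
            by (intro power_mono) auto
          then have "(1 + norm x) ^ 6 * norm (partial i f ?y) \<le> (2 * (1 + norm ?y)) ^ 6 * norm (partial i f ?y)"
            by (rule mult_right_mono) auto
          also have "\<dots> = 2 ^ 6 * ((1 + norm ?y) ^ 6 * norm (partial i f ?y))"
            unfolding power_mult_distrib by (simp add: mult.assoc)
          also have "\<dots> \<le> 2 ^ 6 * C"
            by (intro mult_left_mono C) auto
          finally have "(1 + norm x) ^ 6 * norm (partial i f ?y) \<le> C * 2 ^ 6" by (simp add: mult.commute)
          moreover have "0 < (1 + norm x) ^ 6"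
            by (intro zero_less_power) (smt (verit) norm_ge_zero)
          ultimately show ?thesis
            by (simp add: pos_le_divide_eq mult.commute)
        qed
        then show "onorm (\<lambda>s. s *\<^sub>R partial i f ?y) \<le> C * 2 ^ 6 * (1 / (1 + norm x) ^ 6)"
          using onorm_scaleR_left[of "\<lambda>s::real. s" "partial i f ?y"] by (simp add: onorm_id bounded_linear_ident)
      qed (use h[of n] in auto)
      then show ?thesis
        using h[of n] unfolding D_def by (simp add: norm_divide pos_divide_le_eq)
    qed
    then show "\<And>n. AE x in lborel. norm (D n x) \<le> C * 2 ^ 6 * (1 / (1 + norm x) ^ 6)"
      by (intro AE_I2)
    show "D n \<in> borel_measurable lborel" for n
      unfolding D_def by measurable
  qed measurable
  moreover have "(LINT x|lborel. D n x) = 0" for n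
  proof -
    have "integrable lborel (\<lambda>x. f (h n *\<^sub>R axis i 1 + 1 *\<^sub>R x))"
      using f by (subst integrable_affine_iff) auto
    moreover have "(LINT x|lborel. f (h n *\<^sub>R axis i 1 + 1 *\<^sub>R x)) = (LINT x|lborel. f x)"
      by (rule integral_affine) auto
    ultimately show ?thesis
      using f unfolding D_def by (simp add: add.commute)
  qed
  ultimately show ?thesis
    by (simp add: LIMSEQ_const_iff)
qed

text \<open>Integration by parts: the derivative of \<open>cis (- (x \<bullet> \<xi>)) * f x\<close>
  integrates to 0, and the product rule splits it into the two sides.\<close>

lemma FT_partial:
  assumes f: "f \<in> schwartz"
  shows "FT (partial i f) \<xi> = \<i> * of_real (\<xi> $ i) * FT f \<xi>"
proof -
  define g where "g x = cis (- (x \<bullet> \<xi>)) * f x" for x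
  have d: "(g has_derivative (\<lambda>h. cis (- (x \<bullet> \<xi>)) * frechet_derivative f (at x) h
     + (- (h \<bullet> \<xi>)) *\<^sub>R (\<i> * cis (- (x \<bullet> \<xi>))) * f x)) (at x)" for x
  proof -
    have "((\<lambda>x. - (x \<bullet> \<xi>)) has_derivative (\<lambda>h. - (h \<bullet> \<xi>))) (at x)"
      by (auto intro!: derivative_eq_intros)
    from has_derivative_mult[OF has_derivative_cis[OF this] frechet_derivative_worksI[OF schwartz_differentiable[OF f]]]
    show ?thesis by (simp add: g_def[abs_def])
  qed
  have p: "partial i g x = cis (- (x \<bullet> \<xi>)) * partial i f x + (- \<i> * of_real (\<xi> $ i)) * (cis (- (x \<bullet> \<xi>)) * f x)" for x
    by (subst partial_eqI[OF d]) (simp add: partial_def inner_axis' scaleR_conv_of_real)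
  obtain C D where C: "\<And>x. (1 + norm x) ^ 6 * norm (f x) \<le> C" and D: "\<And>x. (1 + norm x) ^ 6 * norm (partial i f x) \<le> D"
    using schwartz_bound[OF f, of 6] schwartz_bound[OF schwartz_partial[OF f, of i], of 6] by metis
  have [measurable]: "f \<in> borel_measurable borel" "partial i f \<in> borel_measurable borel"
    using f schwartz_partial by (auto intro: schwartz_measurable)
  have "(LINT x|lborel. partial i g x) = 0"
  proof (rule integral_partial_eq_0)
    show "g differentiable (at x)" for x using d differentiableI by blast
    show "integrable lborel g" unfolding g_def by (rule integrable_cis_minus[OF integrable_schwartz[OF f]])
    show "partial i g \<in> borel_measurable borel" unfolding p[abs_def] by measurable
    show "(1 + norm x) ^ 6 * norm (partial i g x) \<le> D + \<bar>\<xi> $ i\<bar> * C" for x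
    proof -
      have "norm (partial i g x) \<le> norm (partial i f x) + \<bar>\<xi> $ i\<bar> * norm (f x)"
        unfolding p by (rule order_trans[OF norm_triangle_ineq]) (simp add: norm_mult)
      then have "(1 + norm x) ^ 6 * norm (partial i g x) \<le> (1 + norm x) ^ 6 * (norm (partial i f x) + \<bar>\<xi> $ i\<bar> * norm (f x))"
        by (rule mult_left_mono) auto
      also have "\<dots> = (1 + norm x) ^ 6 * norm (partial i f x) + \<bar>\<xi> $ i\<bar> * ((1 + norm x) ^ 6 * norm (f x))"
        by (simp add: algebra_simps)
      also have "\<dots> \<le> D + \<bar>\<xi> $ i\<bar> * C"
        by (intro add_mono mult_left_mono C D) auto
      finally show ?thesis .
    qed
  qed
  then have "(LINT x|lborel. cis (- (x \<bullet> \<xi>)) * partial i f x) + (LINT x|lborel. (- \<i> * of_real (\<xi> $ i)) * (cis (- (x \<bullet> \<xi>)) * f x)) = 0"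
    unfolding p
    by (subst Bochner_Integration.integral_add[symmetric])
      (simp_all only: integrable_cis_minus integrable_schwartz f schwartz_partial integrable_mult_right)
  then show ?thesis
    unfolding FT_def by (simp add: add_eq_0_iff2)
qed

lemma FT_lincomb:
  assumes "integrable lborel f" "integrable lborel g"
  shows "FT (\<lambda>x. a * f x + b * g x) \<xi> = a * FT f \<xi> + b * FT g \<xi>"
proof -
  have "FT (\<lambda>x. a * f x + b * g x) \<xi> = (LINT x|lborel. a * (cis (- (x \<bullet> \<xi>)) * f x) + b * (cis (- (x \<bullet> \<xi>)) * g x))"
    unfolding FT_def by (simp add: algebra_simps)
  also have "\<dots> = a * FT f \<xi> + b * FT g \<xi>"
    unfolding FT_def using assms by (subst Bochner_Integration.integral_add) (auto intro!: integrable_cis_minus)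
  finally show ?thesis .
qed

lemma FT_sum:
  assumes "\<And>i. i \<in> A \<Longrightarrow> integrable lborel (f i)"
  shows "FT (\<lambda>x. \<Sum>i\<in>A. f i x) \<xi> = (\<Sum>i\<in>A. FT (f i) \<xi>)"
  unfolding FT_def sum_distrib_left
  by (rule Bochner_Integration.integral_sum) (rule integrable_cis_minus[OF assms])

text \<open>The Fourier multiplier \<open>1 + |\<xi>|\<^sup>2\<close>, which turns smoothness into decay of the transform.\<close>

definition one_minus_laplacian :: "(R3 \<Rightarrow> complex) \<Rightarrow> R3 \<Rightarrow> complex" where
  "one_minus_laplacian f x = f x - (\<Sum>i\<in>UNIV. partial i (partial i f) x)"

lemma one_minus_laplacian:
  assumes f: "f \<in> schwartz"
  shows "one_minus_laplacian f \<in> schwartz"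
    and "FT (one_minus_laplacian f) \<xi> = of_real (1 + (norm \<xi>)\<^sup>2) * FT f \<xi>"
proof -
  have s: "(\<lambda>x. \<Sum>i\<in>UNIV. partial i (partial i f) x) \<in> schwartz"
    by (intro schwartz_sum schwartz_partial f) auto
  have eq: "one_minus_laplacian f = (\<lambda>x. 1 * f x + (- 1) * (\<Sum>i\<in>UNIV. partial i (partial i f) x))"
    by (simp add: one_minus_laplacian_def fun_eq_iff)
  show "one_minus_laplacian f \<in> schwartz"
    unfolding eq by (rule schwartz_lincomb[OF f s])
  have "FT (one_minus_laplacian f) \<xi> = 1 * FT f \<xi> + (- 1) * (\<Sum>i\<in>UNIV. FT (partial i (partial i f)) \<xi>)"
    unfolding eq by (subst FT_lincomb[OF integrable_schwartz[OF f] integrable_schwartz[OF s]])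
      (simp add: FT_sum integrable_schwartz schwartz_partial f)
  also have "(\<Sum>i\<in>UNIV. FT (partial i (partial i f)) \<xi>) = (\<Sum>i\<in>UNIV. - of_real ((\<xi> $ i)\<^sup>2)) * FT f \<xi>"
    by (simp add: FT_partial f schwartz_partial sum_distrib_right sum_distrib_left power2_eq_square mult_ac)
  also have "(\<Sum>i\<in>UNIV. - of_real ((\<xi> $ i)\<^sup>2)) = - complex_of_real ((norm \<xi>)\<^sup>2)"
    by (simp add: norm_vec_def L2_set_def sum_nonneg sum_negf)
  finally show "FT (one_minus_laplacian f) \<xi> = of_real (1 + (norm \<xi>)\<^sup>2) * FT f \<xi>"
    by (simp add: algebra_simps)
qed

text \<open>Three applications of \<open>one_minus_laplacian\<close> produce the factor
  \<open>(1 + (norm \<xi>)\<^sup>2) ^ 3\<close>, which is at least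
  \<open>(1 + norm \<xi>) ^ 6 / 8\<close>; the resulting transform is bounded by an L^1
  norm.\<close>

lemma FT_decay:
  assumes f: "f \<in> schwartz"
  obtains C where "\<And>\<xi>. (1 + norm \<xi>) ^ 6 * norm (FT f \<xi>) \<le> C"
proof -
  let ?L = one_minus_laplacian
  define g where "g = ?L (?L (?L f))"
  have eq: "FT g \<xi> = of_real ((1 + (norm \<xi>)\<^sup>2) ^ 3) * FT f \<xi>" for \<xi>
    using f by (simp add: g_def one_minus_laplacian power3_eq_cube del: of_real_add of_real_power)
  have "(1 + norm \<xi>) ^ 6 * norm (FT f \<xi>) \<le> 8 * (LINT x|lborel. norm (g x))" for \<xi> :: R3
  proof -
    have "(1 + norm \<xi>)\<^sup>2 \<le> 2 * (1 + (norm \<xi>)\<^sup>2)"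
      using zero_le_power2[of "norm \<xi> - 1"] unfolding power2_diff power2_sum by simp
    then have "((1 + norm \<xi>)\<^sup>2) ^ 3 \<le> (2 * (1 + (norm \<xi>)\<^sup>2)) ^ 3"
      by (intro power_mono) auto
    then have "(1 + norm \<xi>) ^ 6 \<le> 8 * (1 + (norm \<xi>)\<^sup>2) ^ 3"
      unfolding power_mult_distrib power_mult[symmetric] by simp
    then have "(1 + norm \<xi>) ^ 6 * norm (FT f \<xi>) \<le> 8 * (1 + (norm \<xi>)\<^sup>2) ^ 3 * norm (FT f \<xi>)"
      by (rule mult_right_mono) auto
    also have "\<dots> = 8 * norm (FT g \<xi>)"
      unfolding eq norm_mult norm_of_real by (simp add: abs_of_nonneg)
    also have "\<dots> \<le> 8 * (LINT x|lborel. norm (g x))"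
      by (intro mult_left_mono FT_bound) auto
    finally show ?thesis .
  qed
  then show ?thesis using that by blast
qed

lemma integrable_FT_schwartz: "f \<in> schwartz \<Longrightarrow> integrable lborel (FT f)"
  by (metis FT_decay integrable_decay FT_measurable integrable_schwartz)

lemma integrable_IFT_schwartz:
  assumes "f \<in> schwartz"
  shows "integrable lborel (IFT f)"
proof -
  have "integrable lborel (\<lambda>x. FT f (0 + (- 1) *\<^sub>R x))"
    using assms by (subst integrable_affine_iff) (auto intro: FT_measurable integrable_schwartz integrable_FT_schwartz)
  then show ?thesis unfolding IFT_eq_FT[abs_def] by simp
qed

section \<open>Fourier inversion\<close>

definition gaussian :: "R3 \<Rightarrow> complex" where
  "gaussian x = complex_of_real (exp (- (norm x)\<^sup>2 / 2))"

lemma cis_sum: "finite A \<Longrightarrow> cis (\<Sum>i\<in>A. f i) = (\<Prod>i\<in>A. cis (f i))"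
  by (induction A rule: finite_induct) (auto simp flip: cis_mult)

lemma gaussian_prod: "gaussian x = (\<Prod>i\<in>UNIV. complex_of_real (exp (- (x $ i)\<^sup>2 / 2)))"
proof -
  have "- (norm x)\<^sup>2 / 2 = (\<Sum>i\<in>UNIV. - (x $ i)\<^sup>2 / 2)"
    by (simp add: norm_vec_def L2_set_def sum_nonneg sum_negf flip: sum_divide_distrib)
  then show ?thesis
    unfolding gaussian_def by (simp add: exp_sum)
qed

lemma exp_std_normal: "exp (- x\<^sup>2 / 2) = sqrt (2 * pi) * std_normal_density x"
  by (simp add: std_normal_density_def)

text \<open>Read off from the characteristic function of the standard normal distribution, whose
  density carries the factor \<open>1 / sqrt (2 * pi)\<close>.\<close>

lemma gaussian_1d:
  "integrable lborel (\<lambda>x. cis (- (x * t)) * complex_of_real (exp (- x\<^sup>2 / 2)))"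
  "(LINT x|lborel. cis (- (x * t)) * complex_of_real (exp (- x\<^sup>2 / 2))) = complex_of_real (sqrt (2 * pi) * exp (- t\<^sup>2 / 2))"
proof -
  have i: "integrable lborel (\<lambda>x. complex_of_real (exp (- x\<^sup>2 / 2)))"
    unfolding exp_std_normal by (intro integrable_of_real integrable_mult_right integrable_normal_density) auto
  show "integrable lborel (\<lambda>x. cis (- (x * t)) * complex_of_real (exp (- x\<^sup>2 / 2)))"
    by (rule integrable_bounded_mult(1)[OF i, where B=1]) auto
  have "complex_of_real (exp (- t\<^sup>2 / 2)) = char std_normal_distribution (- t)"
    by (simp add: char_std_normal_distribution)
  also have "\<dots> = (LINT x|lborel. std_normal_density x *\<^sub>R iexp (- t * x))"
    unfolding char_def by (subst integral_density) auto
  also have "of_real (sqrt (2 * pi)) * \<dots> = (LINT x|lborel. cis (- (x * t)) * complex_of_real (exp (- x\<^sup>2 / 2)))"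
    unfolding exp_std_normal
    by (subst integral_mult_right_zero[symmetric]) (simp add: scaleR_conv_of_real cis_conv_exp mult_ac)
  finally show "(LINT x|lborel. cis (- (x * t)) * complex_of_real (exp (- x\<^sup>2 / 2))) = complex_of_real (sqrt (2 * pi) * exp (- t\<^sup>2 / 2))"
    by simp
qed

lemma FT_gaussian: "FT gaussian \<xi> = complex_of_real (sqrt (2 * pi) ^ 3) * gaussian \<xi>"
  and integrable_gaussian: "integrable lborel gaussian"
proof -
  have eq: "cis (- (x \<bullet> \<xi>)) * gaussian x = (\<Prod>i\<in>UNIV. cis (- (x $ i * \<xi> $ i)) * complex_of_real (exp (- (x $ i)\<^sup>2 / 2)))" for x \<xi>
    unfolding gaussian_prod inner_vec_def
    by (simp add: prod.distrib cis_sum flip: sum_negf)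
  show "FT gaussian \<xi> = complex_of_real (sqrt (2 * pi) ^ 3) * gaussian \<xi>"
    unfolding FT_def eq
    by (subst integral_R3_prod(1)[of "\<lambda>i x. cis (- (x * \<xi> $ i)) * complex_of_real (exp (- x\<^sup>2 / 2))", OF gaussian_1d(1)])
      (simp only: gaussian_1d(2) gaussian_prod of_real_mult prod.distrib, simp)
  show "integrable lborel gaussian"
    using integral_R3_prod(2)[of "\<lambda>i x. cis (- (x * (0 :: R3) $ i)) * complex_of_real (exp (- x\<^sup>2 / 2))", OF gaussian_1d(1)]
    unfolding eq[symmetric] by simp
qed

lemma measurable_gaussian [measurable]: "gaussian \<in> borel_measurable borel"
  using integrable_gaussian by (auto dest: borel_measurable_integrable)

lemma integral_gaussian: "(LINT x|lborel. gaussian x) = complex_of_real (sqrt (2 * pi) ^ 3)"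
  using FT_gaussian[of 0] by (simp add: FT_def gaussian_def)

lemma norm_gaussian_le: "norm (gaussian x) \<le> 1"
  by (simp add: gaussian_def)

text \<open>Regularizing the outer integral by \<open>gaussian (x /\<^sub>R n)\<close> turns it into the convolution of \<open>f\<close>
  with a Gaussian approximate identity.\<close>

lemma FT_IFT:
  assumes f: "integrable lborel f" "continuous_on UNIV f" "\<And>x. norm (f x) \<le> B"
    and F: "integrable lborel (IFT f)"
  shows "FT (IFT f) \<xi> = f \<xi>"
proof -
  define c where "c = complex_of_real (sqrt (2 * pi) ^ 3)"
  have cc: "c * c = complex_of_real ((2 * pi) ^ 3)"
    unfolding c_def of_real_mult[symmetric] power_mult_distrib[symmetric] by simp
  have cnz: "c \<noteq> 0" unfolding c_def by simp
  have [measurable]: "f \<in> borel_measurable borel" "IFT f \<in> borel_measurable borel"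
    using f F by (auto dest: borel_measurable_integrable)
  define s where "s n = 1 / real (Suc n)" for n
  have s: "0 < s n" for n by (simp add: s_def)
  have s0: "s \<longlonglongrightarrow> 0"
    unfolding s_def by (rule LIMSEQ_Suc[OF lim_1_over_n])
  have gc: "gaussian (s n *\<^sub>R x) = complex_of_real (exp (- ((s n)\<^sup>2 * (norm x)\<^sup>2) / 2))" for n x
    using s[of n] by (simp add: gaussian_def power_mult_distrib)
  define E where "E n x = cis (- (x \<bullet> \<xi>)) * gaussian (s n *\<^sub>R x)" for n and x :: R3
  have Ei: "integrable lborel (E n)" for n
  proof -
    have "integrable lborel (\<lambda>x. gaussian (s n *\<^sub>R x))"
    proof (rule integrableI_bounded)
      have "(\<integral>\<^sup>+ x. ennreal (norm (gaussian x)) \<partial>lborel) < \<infinity>"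
        using integrable_gaussian by (simp add: integrable_iff_bounded)
      moreover have "(\<integral>\<^sup>+ x. ennreal (norm (gaussian x)) \<partial>lborel) = (\<integral>\<^sup>+ x. ennreal (s n ^ 3) * ennreal (norm (gaussian (s n *\<^sub>R x))) \<partial>lborel)"
        using s[of n] by (subst lborel_affine[of "s n" 0]) (auto simp: nn_integral_density nn_integral_distr)
      ultimately have "ennreal (s n ^ 3) * (\<integral>\<^sup>+ x. ennreal (norm (gaussian (s n *\<^sub>R x))) \<partial>lborel) < \<infinity>"
        by (simp add: nn_integral_cmult)
      then show "(\<integral>\<^sup>+ x. ennreal (norm (gaussian (s n *\<^sub>R x))) \<partial>lborel) < \<infinity>"
        using s[of n] by (auto simp: ennreal_mult_less_top)
    qed measurable
    then show ?thesis
      unfolding E_def by (rule integrable_cis_minus)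
  qed
  have lhs: "(\<lambda>n. LINT x|lborel. IFT f x * E n x) \<longlonglongrightarrow> (LINT x|lborel. cis (- (x \<bullet> \<xi>)) * IFT f x)"
  proof (rule integral_dominated_convergence[where w="\<lambda>x. norm (IFT f x)"])
    have "(\<lambda>n. IFT f x * E n x) \<longlonglongrightarrow> IFT f x * (cis (- (x \<bullet> \<xi>)) * of_real (exp (- ((0::real)\<^sup>2 * (norm x)\<^sup>2) / 2)))" for x
      unfolding E_def gc by (intro tendsto_intros s0) auto
    then show "AE x in lborel. (\<lambda>n. IFT f x * E n x) \<longlonglongrightarrow> cis (- (x \<bullet> \<xi>)) * IFT f x"
      by (simp add: mult.commute)
    show "AE x in lborel. norm (IFT f x * E n x) \<le> norm (IFT f x)" for n
      using norm_gaussian_le by (intro AE_I2) (simp add: E_def norm_mult mult_left_le)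
    show "(\<lambda>x. IFT f x * E n x) \<in> borel_measurable lborel" for n
      unfolding E_def by measurable
  qed (use F in \<open>auto simp: integrable_norm\<close>)
  have IE: "IFT (E n) \<zeta> * of_real (s n ^ 3) = gaussian ((\<xi> - \<zeta>) /\<^sub>R s n) / c" for n \<zeta>
  proof -
    have "IFT (E n) \<zeta> = (LINT x|lborel. cis (- (x \<bullet> (\<xi> - \<zeta>))) * gaussian (s n *\<^sub>R x)) / (c * c)"
      unfolding IFT_def E_def cc
      by (simp add: inner_commute[of \<zeta>] inner_diff_right mult.assoc[symmetric] cis_mult)
    also have "(LINT x|lborel. cis (- (x \<bullet> (\<xi> - \<zeta>))) * gaussian (s n *\<^sub>R x)) * of_real (s n ^ 3) = FT gaussian ((\<xi> - \<zeta>) /\<^sub>R s n)"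
    proof -
      have "(s n *\<^sub>R x) \<bullet> ((\<xi> - \<zeta>) /\<^sub>R s n) = x \<bullet> (\<xi> - \<zeta>)" for x
        unfolding inner_scaleR_left inner_scaleR_right using s[of n] by (simp add: mult.assoc[symmetric])
      then show ?thesis
        unfolding FT_def using s[of n]
        by (subst integral_scale[of "s n" "\<lambda>x. cis (- (x \<bullet> ((\<xi> - \<zeta>) /\<^sub>R s n))) * gaussian x" 0])
         (simp_all add: scaleR_conv_of_real[where 'a=complex] mult.commute del: inner_scaleR_left inner_scaleR_right)
    qed
    then have "(LINT x|lborel. cis (- (x \<bullet> (\<xi> - \<zeta>))) * gaussian (s n *\<^sub>R x)) / (c * c) * of_real (s n ^ 3) = FT gaussian ((\<xi> - \<zeta>) /\<^sub>R s n) / (c * c)"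
      by (simp add: divide_simps)
    also have "\<dots> = gaussian ((\<xi> - \<zeta>) /\<^sub>R s n) / c"
      unfolding FT_gaussian c_def[symmetric] using cnz by simp
    finally show ?thesis .
  qed
  have rhs_eq: "(LINT x|lborel. IFT f x * E n x) = (LINT z|lborel. f (\<xi> + (- s n) *\<^sub>R z) * (gaussian z / c))" for n
  proof -
    have [measurable]: "IFT (E n) \<in> borel_measurable borel"
      by (rule IFT_measurable[OF Ei])
    have "(LINT x|lborel. IFT f x * E n x) = (LINT x|lborel. f x * IFT (E n) x)"
      by (rule IFT_multiplication[OF f(1) Ei])
    also have "\<dots> = \<bar>- s n\<bar> ^ 3 *\<^sub>R (LINT z|lborel. f (\<xi> + (- s n) *\<^sub>R z) * IFT (E n) (\<xi> + (- s n) *\<^sub>R z))"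
      using integral_scale[of "- s n" "\<lambda>x. f x * IFT (E n) x" \<xi>] s[of n] by simp
    also have "\<dots> = (LINT z|lborel. f (\<xi> + (- s n) *\<^sub>R z) * (IFT (E n) (\<xi> + (- s n) *\<^sub>R z) * of_real (s n ^ 3)))"
      using s[of n] by (subst integral_scaleR_right[symmetric]) (simp add: scaleR_conv_of_real[where 'a=complex] mult_ac)
    also have "\<dots> = (LINT z|lborel. f (\<xi> + (- s n) *\<^sub>R z) * (gaussian z / c))"
      using s[of n] unfolding IE by (simp add: less_imp_neq[THEN not_sym])
    finally show ?thesis .
  qed
  have "(\<lambda>n. LINT z|lborel. f (\<xi> + (- s n) *\<^sub>R z) * (gaussian z / c)) \<longlonglongrightarrow> (LINT z|lborel. f \<xi> * (gaussian z / c))"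
  proof (rule integral_dominated_convergence[where w="\<lambda>z. B * norm (gaussian z / c)"])
    have "(\<lambda>n. f (\<xi> + (- s n) *\<^sub>R z)) \<longlonglongrightarrow> f \<xi>" for z
    proof -
      have "(\<lambda>n. \<xi> + (- s n) *\<^sub>R z) \<longlonglongrightarrow> \<xi> + (- 0) *\<^sub>R z"
        by (intro tendsto_intros s0)
      moreover have "isCont f \<xi>"
        using f(2) by (simp add: continuous_on_eq_continuous_at)
      ultimately show ?thesis
        by (intro isCont_tendsto_compose[of \<xi> f]) auto
    qed
    then show "AE z in lborel. (\<lambda>n. f (\<xi> + (- s n) *\<^sub>R z) * (gaussian z / c)) \<longlonglongrightarrow> f \<xi> * (gaussian z / c)"
      by (intro AE_I2 tendsto_mult tendsto_const)
    show "AE z in lborel. norm (f (\<xi> + (- s n) *\<^sub>R z) * (gaussian z / c)) \<le> B * norm (gaussian z / c)" for n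
      unfolding norm_mult by (intro AE_I2 mult_right_mono f norm_ge_zero)
    show "integrable lborel (\<lambda>z. B * norm (gaussian z / c))"
      by (intro integrable_mult_right integrable_norm integrable_divide_zero integrable_gaussian)
  qed measurable
  also have "(LINT z|lborel. f \<xi> * (gaussian z / c)) = f \<xi>"
    using integral_gaussian cnz by (simp add: c_def)
  finally have "(\<lambda>n. LINT x|lborel. IFT f x * E n x) \<longlonglongrightarrow> f \<xi>"
    by (simp only: rhs_eq)
  with lhs show ?thesis
    unfolding FT_def by (rule LIMSEQ_unique)
qed

lemma FT_IFT_schwartz:
  assumes f: "f \<in> schwartz"
  shows "FT (IFT f) = f"
proof
  obtain B where "\<And>x. norm (f x) \<le> B"
    using schwartz_bounded[OF f] by blast
  then show "FT (IFT f) \<xi> = f \<xi>" for \<xi>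
    by (intro FT_IFT[of f B] integrable_schwartz f smooth_continuous schwartz_smooth integrable_IFT_schwartz)
qed

section \<open>Uniqueness of the function that represents a distribution\<close>

lemma lp_cutoff_support:
  assumes "lp_cutoff chi" "chi \<xi> \<noteq> 0"
  shows "norm \<xi> < 1"
proof -
  have "\<xi> \<in> closure {\<xi>. chi \<xi> \<noteq> 0}"
    by (rule subsetD[OF closure_subset]) (simp add: assms(2))
  then have "\<xi> \<in> ball 0 1"
    using assms(1) unfolding lp_cutoff_def by (meson subsetD)
  then show ?thesis by simp
qed

text \<open>Dilates and translates of \<open>chi\<close> itself serve as the test functions of the
  uniqueness proof and as the bumps of the field, so no other smooth bump has to be
  constructed.\<close>

lemma lp_cutoff_bump:
  assumes chi: "lp_cutoff chi" and n: "n \<noteq> 0"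
  shows "(\<lambda>x::R3. complex_of_real (chi (n *\<^sub>R x + t))) \<in> schwartz"
proof (rule schwartz_compact_support)
  have "smooth chi" using chi by (simp add: lp_cutoff_def)
  then have "smooth (\<lambda>x. chi (t + n *\<^sub>R x))"
    by (rule smooth_affine)
  then show "smooth (\<lambda>x::R3. complex_of_real (chi (n *\<^sub>R x + t)))"
    by (intro smooth_compose_linear[OF bounded_linear_of_real]) (simp add: add.commute)
  fix x :: R3 assume x: "(1 + norm t) / \<bar>n\<bar> < norm x"
  have "1 + norm t < \<bar>n\<bar> * norm x"
    using x n by (simp add: divide_less_eq mult.commute)
  moreover have "norm (n *\<^sub>R x) - norm t \<le> norm (n *\<^sub>R x + t)"
    using norm_triangle_ineq4[of "n *\<^sub>R x + t" t] by simp
  ultimately have "1 < norm (n *\<^sub>R x + t)"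
    by simp
  then have "chi (n *\<^sub>R x + t) = 0"
    using lp_cutoff_support[OF chi] by (meson less_asym)
  then show "complex_of_real (chi (n *\<^sub>R x + t)) = 0"
    by simp
qed

lemma lp_cutoff_facts:
  assumes chi: "lp_cutoff chi"
  shows "0 \<le> chi \<xi>" "norm \<xi> \<le> 1 / 2 \<Longrightarrow> chi \<xi> = 1" "chi (- \<xi>) = chi \<xi>" "chi \<in> borel_measurable borel"
    "continuous_on UNIV chi" "1 \<le> norm \<xi> \<Longrightarrow> chi \<xi> = 0"
proof -
  show "0 \<le> chi \<xi>" "norm \<xi> \<le> 1 / 2 \<Longrightarrow> chi \<xi> = 1" "chi (- \<xi>) = chi \<xi>"
    using chi unfolding lp_cutoff_def by (blast, blast, metis norm_minus_cancel)
  show "chi \<in> borel_measurable borel" "continuous_on UNIV chi"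
    using chi unfolding lp_cutoff_def by (blast intro: smooth_measurable smooth_continuous)+
  show "1 \<le> norm \<xi> \<Longrightarrow> chi \<xi> = 0"
    using lp_cutoff_support[OF chi] by (meson not_less)
qed

lemma lp_cutoff_bounded:
  assumes chi: "lp_cutoff chi"
  obtains B where "\<And>\<xi>. chi \<xi> \<le> B" "0 < B"
proof -
  obtain C where "\<And>\<xi>. norm (complex_of_real (chi (1 *\<^sub>R \<xi> + 0))) \<le> C"
    using schwartz_bounded[OF lp_cutoff_bump[OF chi, of 1 0]] by auto
  then have C: "\<bar>chi \<xi>\<bar> \<le> C" for \<xi>
    by (simp add: norm_of_real)
  have "chi \<xi> \<le> \<bar>C\<bar> + 1" for \<xi>
    using C[of \<xi>] by linarith
  then show ?thesis using that[of "\<bar>C\<bar> + 1"] by auto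
qed

text \<open>The indicator of a box is the limit of its convolutions \<open>F n\<close> with dilates
  of \<open>chi\<close>. Each convolution is an average of test functions, so \<open>h\<close>
  integrates to 0 against it by Fubini; the boundary of the box, where the limit may fail, is a null
  set.\<close>

lemma box_integral_eq_0:
  fixes h :: "R3 \<Rightarrow> complex"
  assumes chi: "lp_cutoff chi"
    and [measurable]: "h \<in> borel_measurable borel"
    and hi: "\<And>\<phi>. \<phi> \<in> schwartz \<Longrightarrow> integrable lborel (\<lambda>x. h x * \<phi> x)"
    and h0: "\<And>\<phi>. \<phi> \<in> schwartz \<Longrightarrow> (LINT x|lborel. h x * \<phi> x) = 0"
  shows "integrable lborel (\<lambda>x. indicator (cball 0 R) x *\<^sub>R h x)"
    and "(LINT x|lborel. indicator (box a b) x *\<^sub>R h x) = 0"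
proof -
  note chi_facts = lp_cutoff_facts[OF chi]
  note [measurable] = chi_facts(4)
  have [measurable]: "cball (0::R3) R \<in> sets borel" for R
    by simp
  show li: "integrable lborel (\<lambda>x. indicator (cball 0 R) x *\<^sub>R h x)" for R
  proof -
    \<comment> \<open>For this \<open>n\<close> the dilate of \<open>chi\<close> equals 1 on
      \<open>cball 0 R\<close>, so integrability against one test function yields local
      integrability of \<open>h\<close>.\<close>
    define n where "n = 1 / (2 * (\<bar>R\<bar> + 1))"
    have n: "0 < n" by (simp add: n_def)
    have "integrable lborel (\<lambda>x. h x * complex_of_real (chi (n *\<^sub>R x + 0)))"
      using n by (intro hi lp_cutoff_bump chi) auto
    then show ?thesis
    proof (rule Bochner_Integration.integrable_bound)
      have "norm (indicator (cball 0 R) x *\<^sub>R h x) \<le> norm (h x * complex_of_real (chi (n *\<^sub>R x + 0)))" for x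
      proof (cases "norm x \<le> R")
        case True
        then have "n * norm x \<le> n * (\<bar>R\<bar> + 1)"
          using n by (intro mult_left_mono) auto
        also have "\<dots> = 1 / 2"
        proof -
          have "\<bar>R\<bar> + 1 \<noteq> 0" by linarith
          then show ?thesis by (simp add: n_def)
        qed
        finally have "n * norm x \<le> 1 / 2" .
        then have "chi (n *\<^sub>R x + 0) = 1"
          using n by (intro chi_facts(2)) simp
        then show ?thesis by (simp add: indicator_def)
      qed (simp add: indicator_def)
      then show "AE x in lborel. norm (indicator (cball 0 R) x *\<^sub>R h x) \<le> norm (h x * complex_of_real (chi (n *\<^sub>R x + 0)))"
        by (rule AE_I2)
    qed measurable
  qed
  obtain B where B: "\<And>\<xi>. chi \<xi> \<le> B" "0 < B"
    using lp_cutoff_bounded[OF chi] by blast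
  define I where "I = complex_of_real (LINT z|lborel. chi z)"
  have chi_int: "integrable lborel (\<lambda>z. complex_of_real (chi z))"
    using integrable_schwartz[OF lp_cutoff_bump[OF chi, of 1 0]] by simp
  have chi_int_real: "integrable lborel chi"
    using integrable_Re[OF chi_int] by simp
  \<comment> \<open>The convolutions converge to \<open>I\<close> times the indicator, so
    \<open>I\<close> has to be nonzero: \<open>chi\<close> is nonnegative and equals 1 on a
    ball.\<close>
  have I0: "I \<noteq> 0"
  proof
    assume "I = 0"
    then have "AE z in lborel. chi z = 0"
      using integral_nonneg_eq_0_iff_AE[OF chi_int_real] chi_facts(1) by (simp add: I_def)
    then have "AE z in lborel. z \<notin> ball (0::R3) (1/2)"
      by eventually_elim (use chi_facts(2) in fastforce)
    then have "emeasure lborel (ball (0::R3) (1/2)) = 0"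
      by (subst (asm) AE_iff_measurable[of "ball 0 (1/2)"]) auto
    then show False
      using content_ball_pos[of "1/2" "0 :: R3"] by (simp add: measure_def)
  qed
  obtain R0 where R0: "box a b \<subseteq> cball 0 R0"
    using bounded_box[of a b] unfolding bounded_iff by (metis mem_cball_0 subsetI)
  define F where "F n x = (LINT z|lborel. indicator (box a b) (x + (- (1 / real (Suc n))) *\<^sub>R z) *\<^sub>R complex_of_real (chi z))" for n and x :: R3
  have [measurable]: "F n \<in> borel_measurable borel" for n
    unfolding F_def by measurable
  have F_alt: "F n x = of_real (real (Suc n) ^ 3) * (LINT y|lborel. indicator (box a b) y *\<^sub>R complex_of_real (chi (real (Suc n) *\<^sub>R (x - y))))" for n x
  proof -
    let ?n = "real (Suc n)"
    have "(LINT y|lborel. indicator (box a b) y *\<^sub>R complex_of_real (chi (?n *\<^sub>R (x - y)))) =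
      \<bar>- 1 / ?n\<bar> ^ 3 *\<^sub>R (LINT z|lborel. indicator (box a b) (x + (- 1 / ?n) *\<^sub>R z) *\<^sub>R complex_of_real (chi (?n *\<^sub>R (x - (x + (- 1 / ?n) *\<^sub>R z)))))"
      using integral_scale[of "- 1 / ?n" "\<lambda>y. indicator (box a b) y *\<^sub>R complex_of_real (chi (?n *\<^sub>R (x - y)))" x] by simp
    also have "\<dots> = (1 / ?n ^ 3) *\<^sub>R F n x"
      unfolding F_def by (simp add: power_divide del: of_nat_Suc)
    finally show ?thesis
      by (simp add: scaleR_conv_of_real del: of_nat_Suc)
  qed
  have Fz: "(LINT x|lborel. h x * F n x) = 0" for n
  proof -
    let ?n = "real (Suc n)"
    \<comment> \<open>Fubini needs an integrable factor. Cutting \<open>h\<close> off outside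
      \<open>cball 0 (R0 + 1)\<close> changes nothing, because the box lies in
      \<open>cball 0 R0\<close> and the dilated \<open>chi\<close> is supported in a ball of radius
      at most 1.\<close>
    let ?h = "\<lambda>x. indicator (cball 0 (R0 + 1)) x *\<^sub>R h x"
    have supp: "chi (?n *\<^sub>R (x - y)) = 0" if "y \<in> box a b" "x \<notin> cball 0 (R0 + 1)" for x y
    proof (rule chi_facts(6))
      have "norm y \<le> R0" "R0 + 1 < norm x" using that R0 by auto
      then have "1 \<le> norm (x - y)"
        using norm_triangle_ineq2[of x y] by linarith
      then have "1 * 1 \<le> ?n * norm (x - y)"
        by (intro mult_mono) auto
      then show "1 \<le> norm (?n *\<^sub>R (x - y))" by simp
    qed
    have ib: "integrable lborel (\<lambda>y. complex_of_real (indicator (box a b) y))"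
      by (intro integrable_of_real integrable_real_indicator emeasure_lborel_box_finite) auto
    have eq: "?h x * complex_of_real (indicator (box a b) y) * complex_of_real (chi (?n *\<^sub>R (x - y))) =
       complex_of_real (indicator (box a b) y) * (h x * complex_of_real (chi (?n *\<^sub>R (x - y))))" for x y
      using supp[of y x] by (auto simp: indicator_def)
    have "(LINT y|lborel. LINT x|lborel. ?h x * complex_of_real (indicator (box a b) y) * complex_of_real (chi (?n *\<^sub>R (x - y))))
      = (LINT x|lborel. LINT y|lborel. ?h x * complex_of_real (indicator (box a b) y) * complex_of_real (chi (?n *\<^sub>R (x - y))))"
      using chi_facts(1) B by (intro fubini_kernel(2)[OF li ib, where B=B]) (auto simp: abs_of_nonneg)
    moreover have "(LINT x|lborel. ?h x * complex_of_real (indicator (box a b) y) * complex_of_real (chi (?n *\<^sub>R (x - y)))) = 0" for y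
    proof -
      have "(\<lambda>x. complex_of_real (chi (?n *\<^sub>R x + - (?n *\<^sub>R y)))) \<in> schwartz"
        by (rule lp_cutoff_bump[OF chi]) auto
      from h0[OF this] show ?thesis
        unfolding eq by (simp add: scaleR_diff_right del: of_nat_Suc)
    qed
    ultimately have "(LINT x|lborel. LINT y|lborel. ?h x * complex_of_real (indicator (box a b) y) * complex_of_real (chi (?n *\<^sub>R (x - y)))) = 0"
      by simp
    moreover have "(LINT y|lborel. ?h x * complex_of_real (indicator (box a b) y) * complex_of_real (chi (?n *\<^sub>R (x - y))))
      = h x * F n x / of_real (?n ^ 3)" for x
    proof -
      have "?h x * complex_of_real (indicator (box a b) y) * complex_of_real (chi (?n *\<^sub>R (x - y))) =
        h x * (indicator (box a b) y *\<^sub>R complex_of_real (chi (?n *\<^sub>R (x - y))))" for y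
        unfolding eq by (simp add: scaleR_conv_of_real mult_ac)
      then show ?thesis
        unfolding F_alt by (simp only: integral_mult_right_zero) (simp del: of_nat_Suc)
    qed
    ultimately show ?thesis
      by (simp del: of_nat_Suc)
  qed
  have "(\<lambda>n. LINT x|lborel. h x * F n x) \<longlonglongrightarrow> (LINT x|lborel. h x * (indicator (box a b) x *\<^sub>R I))"
  proof (rule integral_dominated_convergence[where w="\<lambda>x. norm (indicator (cball 0 (R0 + 1)) x *\<^sub>R h x) * norm I"])
    have lim: "(\<lambda>n. F n x) \<longlonglongrightarrow> indicator (box a b) x *\<^sub>R I" if x: "x \<notin> cbox a b - box a b" for x
    proof -
      have "(\<lambda>n. F n x) \<longlonglongrightarrow> (LINT z|lborel. indicator (box a b) x *\<^sub>R complex_of_real (chi z))"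
        unfolding F_def
      proof (rule integral_dominated_convergence[where w="\<lambda>z. norm (complex_of_real (chi z))"])
        have "(\<lambda>n. indicator (box a b) (x + (- (1 / real (Suc n))) *\<^sub>R z) :: real) \<longlonglongrightarrow> indicator (box a b) x" for z
        proof -
          have "(\<lambda>n. x + (- (1 / real (Suc n))) *\<^sub>R z) \<longlonglongrightarrow> x + (- 0) *\<^sub>R z"
            by (intro tendsto_intros LIMSEQ_Suc[OF lim_1_over_n])
          then have xn: "(\<lambda>n. x + (- (1 / real (Suc n))) *\<^sub>R z) \<longlonglongrightarrow> x" by simp
          show ?thesis
          proof (cases "x \<in> box a b")
            case True
            then have "\<forall>\<^sub>F n in sequentially. x + (- (1 / real (Suc n))) *\<^sub>R z \<in> box a b"
              using topological_tendstoD[OF xn open_box] by blast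
            then have "\<forall>\<^sub>F n in sequentially. indicator (box a b) (x + (- (1 / real (Suc n))) *\<^sub>R z) = (1::real)"
              by eventually_elim simp
            then show ?thesis
              using True by (intro tendsto_eventually) simp
          next
            case False
            then have "x \<in> - cbox a b" using x by auto
            then have "\<forall>\<^sub>F n in sequentially. x + (- (1 / real (Suc n))) *\<^sub>R z \<in> - cbox a b"
              using topological_tendstoD[OF xn, of "- cbox a b"] by (simp add: closed_cbox open_Compl)
            then have "\<forall>\<^sub>F n in sequentially. indicator (box a b) (x + (- (1 / real (Suc n))) *\<^sub>R z) = (0::real)"
              by eventually_elim (use box_subset_cbox[of a b] in \<open>auto simp: indicator_def\<close>)
            then show ?thesis
              using False by (intro tendsto_eventually) simp
          qed
        qed
        then show "AE z in lborel. (\<lambda>n. indicator (box a b) (x + (- (1 / real (Suc n))) *\<^sub>R z) *\<^sub>R complex_of_real (chi z)) \<longlonglongrightarrow> indicator (box a b) x *\<^sub>R complex_of_real (chi z)"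
          by (intro AE_I2 tendsto_scaleR tendsto_const)
        show "integrable lborel (\<lambda>z. norm (complex_of_real (chi z)))"
          by (rule integrable_norm[OF chi_int])
        show "AE z in lborel. norm (indicator (box a b) (x + (- (1 / real (Suc n))) *\<^sub>R z) *\<^sub>R complex_of_real (chi z)) \<le> norm (complex_of_real (chi z))" for n
          by (intro AE_I2) (auto simp: indicator_def)
      qed measurable
      then show ?thesis by (simp add: I_def)
    qed
    have "AE x in lborel. x \<notin> cbox a b - box a b"
      using AE_not_in[OF null_sets_cbox_Diff_box] .
    then show "AE x in lborel. (\<lambda>n. h x * F n x) \<longlonglongrightarrow> h x * (indicator (box a b) x *\<^sub>R I)"
      by eventually_elim (intro tendsto_mult tendsto_const lim)
    show "integrable lborel (\<lambda>x. norm (indicator (cball 0 (R0 + 1)) x *\<^sub>R h x) * norm I)"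
      by (intro integrable_mult_left integrable_norm li)
    have "norm (h x * F n x) \<le> norm (indicator (cball 0 (R0 + 1)) x *\<^sub>R h x) * norm I" for n x
    proof (cases "x \<in> cball 0 (R0 + 1)")
      case True
      have "norm (F n x) \<le> (LINT z|lborel. chi z)"
        unfolding F_def
      proof (rule Bochner_Integration.integral_norm_bound_integral)
        show "integrable lborel (\<lambda>z. indicator (box a b) (x + (- (1 / real (Suc n))) *\<^sub>R z) *\<^sub>R complex_of_real (chi z))"
          by (rule Bochner_Integration.integrable_bound[OF chi_int]) (auto simp: indicator_def)
      qed (use chi_int_real chi_facts(1) in \<open>auto simp: indicator_def\<close>)
      also have "\<dots> = norm I"
        using chi_facts(1) by (simp add: I_def abs_of_nonneg)
      finally show ?thesis
        using True by (simp add: norm_mult mult_left_mono)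
    next
      case False
      have zz: "indicator (box a b) (x + (- (1 / real (Suc n))) *\<^sub>R z) *\<^sub>R complex_of_real (chi z) = 0" for z
      proof (cases "norm z < 1")
        case True
        define w where "w = (- (1 / real (Suc n))) *\<^sub>R z"
        have "norm w \<le> 1 * norm z"
          unfolding w_def norm_scaleR by (intro mult_right_mono) auto
        moreover have "R0 + 1 < norm x" using False by simp
        ultimately have "R0 < norm (x + w)"
          using norm_triangle_ineq4[of "x + w" w] True by simp
        then have "R0 < norm (x + (- (1 / real (Suc n))) *\<^sub>R z)"
          by (simp only: w_def)
        then have "x + (- (1 / real (Suc n))) *\<^sub>R z \<notin> box a b"
          using R0 by (metis mem_cball_0 not_le subsetD)
        then show ?thesis by simp
      qed (use chi_facts(6)[of z] in simp)
      have "F n x = 0" unfolding F_def zz by simp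
      then show ?thesis by simp
    qed
    then show "AE x in lborel. norm (h x * F n x) \<le> norm (indicator (cball 0 (R0 + 1)) x *\<^sub>R h x) * norm I" for n
      by (rule AE_I2)
  qed measurable
  then have "(LINT x|lborel. h x * (indicator (box a b) x *\<^sub>R I)) = 0"
    unfolding Fz by (simp add: LIMSEQ_const_iff)
  moreover have "h x * (indicator (box a b) x *\<^sub>R I) = (indicator (box a b) x *\<^sub>R h x) * I" for x
    by simp
  ultimately have "(LINT x|lborel. indicator (box a b) x *\<^sub>R h x) * I = 0"
    by (simp only: integral_mult_left_zero)
  then show "(LINT x|lborel. indicator (box a b) x *\<^sub>R h x) = 0"
    using I0 by simp
qed

text \<open>Boxes are an intersection-stable generator of the Borel sets, so a Dynkin argument
  extends the vanishing integrals from boxes to all Borel sets. The truncations \<open>H n\<close>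
  to growing boxes are integrable, as the argument requires, and exhaust the space.\<close>

lemma AE_eq_0_of_schwartz:
  fixes h :: "R3 \<Rightarrow> complex"
  assumes chi: "lp_cutoff chi"
    and [measurable]: "h \<in> borel_measurable borel"
    and hi: "\<And>\<phi>. \<phi> \<in> schwartz \<Longrightarrow> integrable lborel (\<lambda>x. h x * \<phi> x)"
    and h0: "\<And>\<phi>. \<phi> \<in> schwartz \<Longrightarrow> (LINT x|lborel. h x * \<phi> x) = 0"
  shows "AE x in lborel. h x = 0"
proof -
  note box0 = box_integral_eq_0[OF assms]
  define b where "b n = ((\<chi> i. real n) :: R3)" for n :: nat
  define H where "H n x = indicator (box (- b n) (b n)) x *\<^sub>R h x" for n x
  have Hi: "integrable lborel (H n)" for n
  proof -
    obtain R where R: "box (- b n) (b n) \<subseteq> cball 0 R"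
      using bounded_box[of "- b n" "b n"] unfolding bounded_iff by (metis mem_cball_0 subsetI)
    show ?thesis unfolding H_def
      by (rule Bochner_Integration.integrable_bound[OF box0(1)[of R]]) (use R in \<open>auto simp: indicator_def intro!: AE_I2\<close>)
  qed
  have H0: "(LINT x|lborel. indicator (box c d) x *\<^sub>R H n x) = 0" for c d n
  proof -
    obtain e f where ef: "box c d \<inter> box (- b n) (b n) = box e f"
      by (rule that[OF box_Int_box])
    have "indicator (box c d) x *\<^sub>R H n x = indicator (box e f) x *\<^sub>R h x" for x
      unfolding H_def ef[symmetric] by (auto simp: indicator_def)
    then show ?thesis using box0(2) by simp
  qed
  have "AE x in lborel. H n x = 0" for n
  proof (rule sigma_finite_measure.density_zero[OF sigma_finite_lborel Hi])
    fix A :: "R3 set" assume "A \<in> sets lborel"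
    then have A: "A \<in> sigma_sets UNIV (range (\<lambda>(a, b). box a b))"
      by (simp add: borel_eq_box)
    have st: "Int_stable (range (\<lambda>(a, b). box a b :: R3 set))"
    proof (rule Int_stableI)
      fix c d :: "R3 set"
      assume "c \<in> range (\<lambda>(a, b). box a b)" "d \<in> range (\<lambda>(a, b). box a b)"
      then obtain e f g k where "c = box e f" "d = box g k" by auto
      then show "c \<inter> d \<in> range (\<lambda>(a, b). box a b)"
        by (intro range_eqI[where x="(\<Sum>i\<in>Basis. max (e \<bullet> i) (g \<bullet> i) *\<^sub>R i, \<Sum>i\<in>Basis. min (f \<bullet> i) (k \<bullet> i) *\<^sub>R i)"])
          (simp add: box_Int_box)
    qed
    have sub: "range (\<lambda>(a, b). box a b :: R3 set) \<subseteq> Pow UNIV" by simp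
    from st sub A show "set_lebesgue_integral lborel A (H n) = 0"
    proof (induction A rule: sigma_sets_induct_disjoint)
      case (basic A)
      then show ?case using H0 by (auto simp: set_lebesgue_integral_def)
    next
      case empty
      then show ?case by (simp add: set_lebesgue_integral_def)
    next
      case (compl A)
      then have [measurable]: "A \<in> sets borel"
        by (simp add: borel_eq_box)
      have "(LINT x|lborel. H n x) = 0"
      proof -
        have "indicator (box (- b n) (b n)) x *\<^sub>R H n x = H n x" for x
          by (simp add: H_def indicator_def)
        then show ?thesis
          using H0[of "- b n" "b n" n] by (simp only:)
      qed
      moreover have "set_lebesgue_integral lborel (UNIV - A) (H n) = (LINT x|lborel. H n x) - set_lebesgue_integral lborel A (H n)"
      proof -
        have "set_lebesgue_integral lborel (UNIV - A) (H n) = (LINT x|lborel. H n x - indicator A x *\<^sub>R H n x)"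
          unfolding set_lebesgue_integral_def by (intro Bochner_Integration.integral_cong) (auto simp: indicator_def)
        also have "\<dots> = (LINT x|lborel. H n x) - set_lebesgue_integral lborel A (H n)"
          unfolding set_lebesgue_integral_def
          by (intro Bochner_Integration.integral_diff Hi integrable_mult_indicator) auto
        finally show ?thesis .
      qed
      ultimately show ?case using compl by simp
    next
      case (union A)
      then have [measurable]: "A i \<in> sets borel" for i
        by (auto simp: borel_eq_box)
      have "set_integrable lborel (\<Union>i. A i) (H n)"
        unfolding set_integrable_def
        by (intro integrable_mult_indicator Hi) auto
      then show ?case
        using union by (subst lebesgue_integral_countable_add) (auto simp: disjoint_family_on_def)
    qed
  qed
  then have "AE x in lborel. \<forall>n. H n x = 0"
    by (simp add: AE_all_countable)
  then show ?thesis
  proof eventually_elim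
    case (elim x)
    obtain n where n: "norm x < real n" using reals_Archimedean2 by blast
    have "\<bar>x $ i\<bar> < real n" for i
      using component_le_norm_cart[of x i] n by linarith
    then have "x \<in> box (- b n) (b n)"
      unfolding mem_box_cart b_def by (simp add: abs_less_iff minus_less_iff)
    with elim[rule_format, of n] show ?case by (simp add: H_def)
  qed
qed

lemma represents_unique:
  assumes chi: "lp_cutoff chi" and "represents f T" "represents g T"
  shows "AE x in lborel. f x = g x"
proof -
  have [measurable]: "f \<in> borel_measurable borel" "g \<in> borel_measurable borel"
    using assms by (auto simp: represents_def)
  have "AE x in lborel. f x - g x = 0"
  proof (rule AE_eq_0_of_schwartz[OF chi])
    fix \<phi> assume p: "\<phi> \<in> schwartz"
    then have i: "integrable lborel (\<lambda>x. f x * \<phi> x)" "integrable lborel (\<lambda>x. g x * \<phi> x)"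
      and e: "(LINT x|lborel. f x * \<phi> x) = (LINT x|lborel. g x * \<phi> x)"
      using assms(2,3) unfolding represents_def distr_of_def by auto
    show "integrable lborel (\<lambda>x. (f x - g x) * \<phi> x)" "(LINT x|lborel. (f x - g x) * \<phi> x) = 0"
      using i e by (simp_all add: left_diff_distrib)
  qed measurable
  then show ?thesis by simp
qed

lemma continuous_AE_eq:
  fixes f g :: "R3 \<Rightarrow> complex"
  assumes "continuous_on UNIV f" "continuous_on UNIV g" "AE x in lborel. f x = g x"
  shows "f = g"
proof (rule ccontr)
  assume "f \<noteq> g"
  then have ne: "{x. f x \<noteq> g x} \<noteq> {}" by auto
  have op: "open {x. f x \<noteq> g x}"
    using assms by (intro open_Collect_neq) auto
  have "{x. f x \<noteq> g x} \<in> null_sets lborel"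
    using assms(3) op by (subst (asm) AE_iff_null) auto
  then have "negligible {x. f x \<noteq> g x}"
    unfolding negligible_iff_null_sets by (rule null_sets_completionI)
  then show False
    using open_not_negligible[OF op ne] by blast
qed

text \<open>Discharges the definite description in \<open>continuous_rep\<close>: two continuous
  representatives agree almost everywhere, hence everywhere.\<close>

lemma continuous_rep_eq:
  assumes chi: "lp_cutoff chi" and g: "continuous_on UNIV g" "represents g T"
  shows "continuous_rep T = g"
  unfolding continuous_rep_def
proof (rule the_equality)
  show "f = g" if "continuous_on UNIV f \<and> represents f T" for f
    using that by (intro continuous_AE_eq[OF _ g(1) represents_unique[OF chi _ g(2)]]) auto
qed (use g in simp)

section \<open>Littlewood-Paley blocks of distributions with a Fourier transform\<close>

text \<open>The test functions \<open>\<psi>\<close> need not be smooth: the blocks only ever produce bounded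
  functions of compact support.\<close>

definition has_FT :: "distr \<Rightarrow> (R3 \<Rightarrow> complex) \<Rightarrow> bool" where
  "has_FT T g \<longleftrightarrow> g \<in> borel_measurable borel \<and>
     (\<forall>R. integrable lborel (\<lambda>\<xi>. indicator (cball 0 R) \<xi> *\<^sub>R g \<xi>)) \<and>
     (\<forall>\<psi> R B. \<psi> \<in> borel_measurable borel \<longrightarrow> (\<forall>\<xi>. norm (\<psi> \<xi>) \<le> B) \<longrightarrow> (\<forall>\<xi>. R < norm \<xi> \<longrightarrow> \<psi> \<xi> = 0) \<longrightarrow>
        T (FT \<psi>) = (LINT \<xi>|lborel. g \<xi> * \<psi> \<xi>))"

lemma has_FT_D:
  assumes "has_FT T g"
  shows "g \<in> borel_measurable borel" "integrable lborel (\<lambda>\<xi>. indicator (cball 0 R) \<xi> *\<^sub>R g \<xi>)"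
    "\<psi> \<in> borel_measurable borel \<Longrightarrow> (\<And>\<xi>. norm (\<psi> \<xi>) \<le> B) \<Longrightarrow> (\<And>\<xi>. R < norm \<xi> \<Longrightarrow> \<psi> \<xi> = 0) \<Longrightarrow>
      T (FT \<psi>) = (LINT \<xi>|lborel. g \<xi> * \<psi> \<xi>)"
  using assms unfolding has_FT_def by blast+

lemma has_FT_integrable:
  assumes T: "has_FT T g" and [measurable]: "m \<in> borel_measurable borel"
    and B: "\<And>\<xi>. norm (m \<xi>) \<le> B" and R: "\<And>\<xi>. R < norm \<xi> \<Longrightarrow> m \<xi> = 0"
  shows "integrable lborel (\<lambda>\<xi>. g \<xi> * m \<xi>)"
proof -
  have "integrable lborel (\<lambda>\<xi>. (indicator (cball 0 R) \<xi> *\<^sub>R g \<xi>) * m \<xi>)"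
    by (rule integrable_bounded_mult(2)[OF has_FT_D(2)[OF T] _ B]) measurable
  moreover have "(indicator (cball 0 R) \<xi> *\<^sub>R g \<xi>) * m \<xi> = g \<xi> * m \<xi>" for \<xi>
    using R[of \<xi>] by (auto simp: indicator_def)
  ultimately show ?thesis by simp
qed

lemma has_FT_multiplier:
  assumes T: "has_FT T g" and m[measurable]: "m \<in> borel_measurable borel"
    and B: "\<And>\<xi>. norm (m \<xi>) \<le> B" and R: "\<And>\<xi>. R < norm \<xi> \<Longrightarrow> m \<xi> = 0"
    and \<phi>: "integrable lborel \<phi>"
  shows "T (FT (\<lambda>\<xi>. m \<xi> * IFT \<phi> \<xi>)) = (LINT x|lborel. IFT (\<lambda>\<xi>. g \<xi> * m \<xi>) x * \<phi> x)"
proof -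
  have [measurable]: "IFT \<phi> \<in> borel_measurable borel"
    by (rule IFT_measurable[OF \<phi>])
  let ?C = "(LINT x|lborel. norm (\<phi> x)) / (2 * pi) ^ 3"
  have "T (FT (\<lambda>\<xi>. m \<xi> * IFT \<phi> \<xi>)) = (LINT \<xi>|lborel. g \<xi> * (m \<xi> * IFT \<phi> \<xi>))"
  proof (rule has_FT_D(3)[OF T])
    have "0 \<le> B" using B[of 0] norm_ge_zero order_trans by blast
    then show "norm (m \<xi> * IFT \<phi> \<xi>) \<le> B * ?C" for \<xi>
      unfolding norm_mult by (intro mult_mono B IFT_bound) auto
    show "R < norm \<xi> \<Longrightarrow> m \<xi> * IFT \<phi> \<xi> = 0" for \<xi>
      using R by simp
  qed measurable
  also have "\<dots> = (LINT x|lborel. IFT (\<lambda>\<xi>. g \<xi> * m \<xi>) x * \<phi> x)"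
    by (subst IFT_multiplication[OF has_FT_integrable[OF T m B R] \<phi>]) (simp_all add: mult.assoc)
  finally show ?thesis .
qed

section \<open>Symbols of the blocks and of their partial sums\<close>

lemma lp_symbol_facts:
  assumes chi: "lp_cutoff chi"
  shows "lp_symbol chi q \<in> borel_measurable borel"
    and "\<exists>B. \<forall>\<xi>. norm (complex_of_real (lp_symbol chi q \<xi>)) \<le> B"
    and "max 1 (2 * 2 powi q) < norm \<xi> \<Longrightarrow> lp_symbol chi q \<xi> = 0"
proof -
  note c = lp_cutoff_facts[OF chi]
  note [measurable] = c(4)
  show "lp_symbol chi q \<in> borel_measurable borel"
    unfolding lp_symbol_def[abs_def] lp_phi_def by measurable
  obtain B where B: "\<And>\<xi>. chi \<xi> \<le> B" "0 < B"
    using lp_cutoff_bounded[OF chi] by blast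
  have "\<bar>lp_symbol chi q \<xi>\<bar> \<le> B" for \<xi>
    unfolding lp_symbol_def lp_phi_def using c(1) B(1) by (simp add: abs_le_iff) (smt (verit) c(1) B(1))
  then show "\<exists>B. \<forall>\<xi>. norm (complex_of_real (lp_symbol chi q \<xi>)) \<le> B"
    by auto
  have p: "(0::real) < 2 powi q" by simp
  assume "max 1 (2 * 2 powi q) < norm \<xi>"
  then have n: "1 \<le> norm \<xi>" "2 * 2 powi q \<le> norm \<xi>" by auto
  then have "1 \<le> norm ((\<xi> /\<^sub>R 2 powi q) /\<^sub>R 2)" "1 \<le> norm (\<xi> /\<^sub>R 2 powi q)"
    using p by (simp_all add: divide_simps del: power_int_mult_distrib)
  then show "lp_symbol chi q \<xi> = 0"
    unfolding lp_symbol_def lp_phi_def using c(6) n by (simp del: norm_scaleR)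
qed

lemma lp_block_eq:
  "lp_block chi q T \<phi> = T (FT (\<lambda>\<xi>. complex_of_real (lp_symbol chi q \<xi>) * IFT \<phi> \<xi>))"
  by (simp add: lp_block_def distr_IFT_def distr_mult_def distr_FT_def)

lemma has_FT_block:
  assumes chi: "lp_cutoff chi" and T: "has_FT T g"
  shows "integrable lborel (\<lambda>\<xi>. g \<xi> * complex_of_real (lp_symbol chi q \<xi>))"
    and "integrable lborel \<phi> \<Longrightarrow> lp_block chi q T \<phi> = (LINT x|lborel. IFT (\<lambda>\<xi>. g \<xi> * complex_of_real (lp_symbol chi q \<xi>)) x * \<phi> x)"
    and "represents (IFT (\<lambda>\<xi>. g \<xi> * complex_of_real (lp_symbol chi q \<xi>))) (lp_block chi q T)"
proof -
  note s = lp_symbol_facts[OF chi, where q=q]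
  note [measurable] = s(1)
  obtain B where B: "\<And>\<xi>. norm (complex_of_real (lp_symbol chi q \<xi>)) \<le> B"
    using s(2) by blast
  have m: "(\<lambda>\<xi>. complex_of_real (lp_symbol chi q \<xi>)) \<in> borel_measurable borel" by measurable
  have z: "max 1 (2 * 2 powi q) < norm \<xi> \<Longrightarrow> complex_of_real (lp_symbol chi q \<xi>) = 0" for \<xi>
    using s(3) by simp
  show i: "integrable lborel (\<lambda>\<xi>. g \<xi> * complex_of_real (lp_symbol chi q \<xi>))"
    by (rule has_FT_integrable[OF T m B z])
  show bl: "lp_block chi q T \<phi> = (LINT x|lborel. IFT (\<lambda>\<xi>. g \<xi> * complex_of_real (lp_symbol chi q \<xi>)) x * \<phi> x)"
    if "integrable lborel \<phi>" for \<phi>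
    unfolding lp_block_eq by (rule has_FT_multiplier[OF T m B z that])
  show "represents (IFT (\<lambda>\<xi>. g \<xi> * complex_of_real (lp_symbol chi q \<xi>))) (lp_block chi q T)"
    unfolding represents_def distr_of_def
    using IFT_measurable[OF i] bl integrable_schwartz integrable_bounded_mult(1)[OF integrable_schwartz _ IFT_bound]
    by auto
qed

text \<open>The sum telescopes. The symbol of block \<open>n\<close> is the difference of
  \<open>chi\<close> at \<open>\<xi> /\<^sub>R 2 ^ Suc n\<close> and at
  \<open>\<xi> /\<^sub>R 2 ^ n\<close>, hence the exponent \<open>Suc n\<close>.\<close>

lemma lp_symbol_sum:
  "(\<Sum>q\<in>{- 1..int n}. lp_symbol chi q \<xi>) = chi (\<xi> /\<^sub>R 2 ^ Suc n)"
proof (induction n)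
  case 0
  have "{- 1..int 0} = {- 1, 0}" by auto
  then show ?case by (simp add: lp_symbol_def lp_phi_def)
next
  case (Suc n)
  have "{- 1..int (Suc n)} = insert (int (Suc n)) {- 1..int n}" by auto
  moreover have "int (Suc n) \<notin> {- 1..int n}" by auto
  ultimately have "(\<Sum>q\<in>{- 1..int (Suc n)}. lp_symbol chi q \<xi>) = lp_symbol chi (int (Suc n)) \<xi> + chi (\<xi> /\<^sub>R 2 ^ Suc n)"
    using Suc by simp
  also have "lp_symbol chi (int (Suc n)) \<xi> = chi (\<xi> /\<^sub>R 2 ^ Suc (Suc n)) - chi (\<xi> /\<^sub>R 2 ^ Suc n)"
    by (simp add: lp_symbol_def lp_phi_def power_int_of_nat del: of_nat_Suc)
  finally show ?case by simp
qed

text \<open>The symbol of \<open>S\<^sub>Q\<close>.\<close>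

definition lp_low :: "(R3 \<Rightarrow> real) \<Rightarrow> nat \<Rightarrow> R3 \<Rightarrow> real" where
  "lp_low chi n \<xi> = chi (\<xi> /\<^sub>R 2 ^ Suc n)"

lemma lp_low_facts:
  assumes chi: "lp_cutoff chi"
  shows "lp_low chi n \<in> borel_measurable borel"
    and "\<exists>B. \<forall>\<xi>. norm (complex_of_real (lp_low chi n \<xi>)) \<le> B"
    and "2 ^ Suc n \<le> norm \<xi> \<Longrightarrow> lp_low chi n \<xi> = 0"
    and "lp_low chi n (- \<xi>) = lp_low chi n \<xi>"
proof -
  note c = lp_cutoff_facts[OF chi]
  note [measurable] = c(4)
  show "lp_low chi n \<in> borel_measurable borel"
    unfolding lp_low_def[abs_def] by measurable
  obtain B where B: "\<And>\<xi>. chi \<xi> \<le> B" "0 < B"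
    using lp_cutoff_bounded[OF chi] by blast
  then show "\<exists>B. \<forall>\<xi>. norm (complex_of_real (lp_low chi n \<xi>)) \<le> B"
    unfolding lp_low_def using c(1) by (auto simp: abs_of_nonneg)
  show "2 ^ Suc n \<le> norm \<xi> \<Longrightarrow> lp_low chi n \<xi> = 0"
    unfolding lp_low_def by (rule c(6)) (simp add: divide_simps)
  show "lp_low chi n (- \<xi>) = lp_low chi n \<xi>"
    unfolding lp_low_def using c(3) by simp
qed

text \<open>The blocks are represented by inverse transforms of integrable functions of bounded
  support. Their sum is therefore represented by a continuous function, and uniqueness identifies it
  with \<open>LP_S\<close>.\<close>

lemma has_FT_LP_S:
  assumes chi: "lp_cutoff chi" and T: "has_FT T g"
  shows "integrable lborel (\<lambda>\<xi>. g \<xi> * complex_of_real (lp_low chi n \<xi>))"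
    and "LP_S chi (int n) T = IFT (\<lambda>\<xi>. g \<xi> * complex_of_real (lp_low chi n \<xi>))"
proof -
  let ?s = "\<lambda>q \<xi>. g \<xi> * complex_of_real (lp_symbol chi q \<xi>)"
  note i = has_FT_block(1)[OF chi T]
  have eq: "g \<xi> * complex_of_real (lp_low chi n \<xi>) = (\<Sum>q\<in>{- 1..int n}. ?s q \<xi>)" for \<xi>
    unfolding lp_low_def lp_symbol_sum[symmetric] by (simp add: sum_distrib_left)
  show int: "integrable lborel (\<lambda>\<xi>. g \<xi> * complex_of_real (lp_low chi n \<xi>))"
    unfolding eq by (intro Bochner_Integration.integrable_sum i)
  have IFTeq: "IFT (\<lambda>\<xi>. g \<xi> * complex_of_real (lp_low chi n \<xi>)) x = (\<Sum>q\<in>{- 1..int n}. IFT (?s q) x)" for x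
    unfolding eq IFT_eq_FT by (simp add: FT_sum i sum_divide_distrib)
  have "represents (IFT (\<lambda>\<xi>. g \<xi> * complex_of_real (lp_low chi n \<xi>))) (lp_sum chi (int n) T)"
    unfolding represents_def
  proof (intro conjI ballI)
    show "IFT (\<lambda>\<xi>. g \<xi> * complex_of_real (lp_low chi n \<xi>)) \<in> borel_measurable lborel"
      using IFT_measurable[OF int] by simp
    fix \<phi> assume p: "\<phi> \<in> schwartz"
    show "integrable lborel (\<lambda>x. IFT (\<lambda>\<xi>. g \<xi> * complex_of_real (lp_low chi n \<xi>)) x * \<phi> x)"
      by (rule integrable_bounded_mult(1)[OF integrable_schwartz[OF p] IFT_measurable[OF int] IFT_bound])
    have j: "integrable lborel (\<lambda>x. IFT (?s q) x * \<phi> x)" for q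
      by (rule integrable_bounded_mult(1)[OF integrable_schwartz[OF p] IFT_measurable[OF i] IFT_bound])
    show "lp_sum chi (int n) T \<phi> = distr_of (IFT (\<lambda>\<xi>. g \<xi> * complex_of_real (lp_low chi n \<xi>))) \<phi>"
      unfolding lp_sum_def distr_of_def IFTeq sum_distrib_right
      by (subst Bochner_Integration.integral_sum) (auto simp: j has_FT_block(2)[OF chi T integrable_schwartz[OF p]])
  qed
  then show "LP_S chi (int n) T = IFT (\<lambda>\<xi>. g \<xi> * complex_of_real (lp_low chi n \<xi>))"
    unfolding LP_S_def by (intro continuous_rep_eq[OF chi] IFT_continuous int)
qed

subsection \<open>Functions, derivatives and products\<close>

lemma integrable_bounded_support:
  fixes \<psi> :: "R3 \<Rightarrow> complex"
  assumes [measurable]: "\<psi> \<in> borel_measurable borel" and B: "\<And>\<xi>. norm (\<psi> \<xi>) \<le> B" and R: "\<And>\<xi>. R < norm \<xi> \<Longrightarrow> \<psi> \<xi> = 0"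
  shows "integrable lborel \<psi>" "integrable lborel (\<lambda>\<xi>. (norm \<xi>)\<^sup>2 *\<^sub>R \<psi> \<xi>)"
proof -
  show "integrable lborel \<psi>"
    by (rule integrable_compact_support[of _ B R]) (use B R in auto)
  have B0: "0 \<le> B" using B[of 0] norm_ge_zero order_trans by blast
  show "integrable lborel (\<lambda>\<xi>. (norm \<xi>)\<^sup>2 *\<^sub>R \<psi> \<xi>)"
  proof (rule integrable_compact_support[of _ "R\<^sup>2 * B" R])
    fix \<xi>
    show "norm ((norm \<xi>)\<^sup>2 *\<^sub>R \<psi> \<xi>) \<le> R\<^sup>2 * B"
    proof (cases "R < norm \<xi>")
      case False
      then show ?thesis
        using B0 by (auto intro!: mult_mono power_mono B)
    qed (use R B0 in auto)
  qed (use R in auto)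
qed

lemma has_FT_distr_of:
  assumes u: "integrable lborel u"
  shows "has_FT (distr_of u) (FT u)"
  unfolding has_FT_def
proof (intro conjI allI impI)
  show [measurable]: "FT u \<in> borel_measurable borel" by (rule FT_measurable[OF u])
  show "integrable lborel (\<lambda>\<xi>. indicator (cball 0 R) \<xi> *\<^sub>R FT u \<xi>)" for R
    by (rule integrable_compact_support[of _ "LINT x|lborel. norm (u x)" R])
      (auto simp: indicator_def FT_bound)
  fix \<psi> :: "R3 \<Rightarrow> complex" and R B :: real
  assume "\<psi> \<in> borel_measurable borel" "\<forall>\<xi>. norm (\<psi> \<xi>) \<le> B" "\<forall>\<xi>. R < norm \<xi> \<longrightarrow> \<psi> \<xi> = 0"
  then have "integrable lborel \<psi>"
    using integrable_bounded_support(1)[of \<psi> B R] by blast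
  from FT_multiplication[OF u this] show "distr_of u (FT \<psi>) = (LINT \<xi>|lborel. FT u \<xi> * \<psi> \<xi>)"
    by (simp add: distr_of_def)
qed

lemma distr_partial_FT:
  assumes u: "integrable lborel u" and \<psi>: "integrable lborel \<psi>" "integrable lborel (\<lambda>\<xi>. (norm \<xi>)\<^sup>2 *\<^sub>R \<psi> \<xi>)"
  shows "distr_partial i (distr_of u) (FT \<psi>) = (LINT \<xi>|lborel. (\<i> * of_real (\<xi> $ i) * FT u \<xi>) * \<psi> \<xi>)"
    and "integrable lborel (\<lambda>\<xi>. (\<i> * of_real (\<xi> $ i) * FT u \<xi>) * \<psi> \<xi>)"
proof -
  note p = partial_FT(1,2)[OF \<psi>, where i=i]
  have "integrable lborel (\<lambda>\<xi>. FT u \<xi> * (- \<i> * of_real (\<xi> $ i) * \<psi> \<xi>))"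
    by (rule integrable_bounded_mult(1)[OF p(2) FT_measurable[OF u] FT_bound])
  then have "integrable lborel (\<lambda>\<xi>. - (FT u \<xi> * (- \<i> * of_real (\<xi> $ i) * \<psi> \<xi>)))"
    by (rule Bochner_Integration.integrable_minus)
  then show "integrable lborel (\<lambda>\<xi>. (\<i> * of_real (\<xi> $ i) * FT u \<xi>) * \<psi> \<xi>)"
    by (simp add: mult_ac)
  have "partial i (FT \<psi>) = FT (\<lambda>\<xi>. - \<i> * of_real (\<xi> $ i) * \<psi> \<xi>)"
    by (rule ext) (rule p(1))
  then have "distr_partial i (distr_of u) (FT \<psi>) = - (LINT x|lborel. u x * FT (\<lambda>\<xi>. - \<i> * of_real (\<xi> $ i) * \<psi> \<xi>) x)"
    by (simp add: distr_partial_def distr_of_def)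
  also have "\<dots> = - (LINT \<xi>|lborel. FT u \<xi> * (- \<i> * of_real (\<xi> $ i) * \<psi> \<xi>))"
    by (subst FT_multiplication[OF u p(2)]) (rule refl)
  also have "\<dots> = (LINT \<xi>|lborel. - (FT u \<xi> * (- \<i> * of_real (\<xi> $ i) * \<psi> \<xi>)))"
    by (rule Bochner_Integration.integral_minus[symmetric])
  finally show "distr_partial i (distr_of u) (FT \<psi>) = (LINT \<xi>|lborel. (\<i> * of_real (\<xi> $ i) * FT u \<xi>) * \<psi> \<xi>)"
    by (simp add: mult_ac)
qed

lemma has_FT_distr_partial:
  assumes u: "integrable lborel u"
  shows "has_FT (distr_partial i (distr_of u)) (\<lambda>\<xi>. \<i> * of_real (\<xi> $ i) * FT u \<xi>)"
  unfolding has_FT_def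
proof (intro conjI allI impI)
  have [measurable]: "FT u \<in> borel_measurable borel" by (rule FT_measurable[OF u])
  show "(\<lambda>\<xi>. \<i> * of_real (\<xi> $ i) * FT u \<xi>) \<in> borel_measurable borel" by measurable
  show "integrable lborel (\<lambda>\<xi>. indicator (cball 0 R) \<xi> *\<^sub>R (\<i> * of_real (\<xi> $ i) * FT u \<xi>))" for R
  proof (rule integrable_compact_support[of _ "\<bar>R\<bar> * (LINT x|lborel. norm (u x))" R])
    fix \<xi> :: R3
    have "norm \<xi> \<le> R \<Longrightarrow> \<bar>\<xi> $ i\<bar> \<le> \<bar>R\<bar>"
      using component_le_norm_cart[of \<xi> i] by linarith
    then show "norm (indicator (cball 0 R) \<xi> *\<^sub>R (\<i> * of_real (\<xi> $ i) * FT u \<xi>)) \<le> \<bar>R\<bar> * (LINT x|lborel. norm (u x))"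
      by (auto simp: indicator_def norm_mult intro!: mult_mono FT_bound)
  qed (auto simp: indicator_def)
  fix \<psi> :: "R3 \<Rightarrow> complex" and R B :: real
  assume "\<psi> \<in> borel_measurable borel" "\<forall>\<xi>. norm (\<psi> \<xi>) \<le> B" "\<forall>\<xi>. R < norm \<xi> \<longrightarrow> \<psi> \<xi> = 0"
  then have "integrable lborel \<psi>" "integrable lborel (\<lambda>\<xi>. (norm \<xi>)\<^sup>2 *\<^sub>R \<psi> \<xi>)"
    using integrable_bounded_support[of \<psi> B R] by blast+
  from distr_partial_FT(1)[OF u this]
  show "distr_partial i (distr_of u) (FT \<psi>) = (LINT \<xi>|lborel. (\<i> * of_real (\<xi> $ i) * FT u \<xi>) * \<psi> \<xi>)" .
qed

lemma has_FT_distr_diff: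
  assumes S: "has_FT S f" and T: "has_FT T g"
  shows "has_FT (distr_diff S T) (\<lambda>\<xi>. f \<xi> - g \<xi>)"
  unfolding has_FT_def
proof (intro conjI allI impI)
  show "(\<lambda>\<xi>. f \<xi> - g \<xi>) \<in> borel_measurable borel"
    using has_FT_D(1)[OF S] has_FT_D(1)[OF T] by measurable
  show "integrable lborel (\<lambda>\<xi>. indicator (cball 0 R) \<xi> *\<^sub>R (f \<xi> - g \<xi>))" for R
    unfolding scaleR_diff_right by (intro Bochner_Integration.integrable_diff has_FT_D(2)[OF S] has_FT_D(2)[OF T])
  fix \<psi> :: "R3 \<Rightarrow> complex" and R B :: real
  assume *: "\<psi> \<in> borel_measurable borel" "\<forall>\<xi>. norm (\<psi> \<xi>) \<le> B" "\<forall>\<xi>. R < norm \<xi> \<longrightarrow> \<psi> \<xi> = 0"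
  then have "integrable lborel (\<lambda>\<xi>. f \<xi> * \<psi> \<xi>)" "integrable lborel (\<lambda>\<xi>. g \<xi> * \<psi> \<xi>)"
    using has_FT_integrable[OF S, of \<psi> B R] has_FT_integrable[OF T, of \<psi> B R] by auto
  then show "distr_diff S T (FT \<psi>) = (LINT \<xi>|lborel. (f \<xi> - g \<xi>) * \<psi> \<xi>)"
    using * has_FT_D(3)[OF S, of \<psi> B R] has_FT_D(3)[OF T, of \<psi> B R]
    by (simp add: distr_diff_def left_diff_distrib)
qed

text \<open>A product becomes a convolution, stated for a second factor that is known as a
  transform. This fits both the functions \<open>FT \<psi>\<close> that occur in
  \<open>has_FT\<close> and the components of \<open>u\<close>; the reflected argument is the one
  that \<open>sobolev_pairing\<close> uses.\<close>

lemma FT_mult_FT: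
  assumes f: "integrable lborel f" and \<psi>: "integrable lborel \<psi>"
  shows "FT (\<lambda>x. f x * FT \<psi> x) (- \<xi>) = (LINT \<eta>|lborel. \<psi> \<eta> * FT f (\<eta> - \<xi>))"
proof -
  have "FT (\<lambda>x. f x * FT \<psi> x) (- \<xi>) = (LINT x|lborel. LINT \<eta>|lborel. f x * \<psi> \<eta> * cis (- (x \<bullet> (\<eta> - \<xi>))))"
  proof -
    have e: "cis (- (x \<bullet> - \<xi>)) * cis (- (\<eta> \<bullet> x)) = cis (- (x \<bullet> (\<eta> - \<xi>)))" for x \<eta>
      by (simp add: cis_mult inner_diff_right inner_commute)
    have "cis (- (x \<bullet> - \<xi>)) * (f x * FT \<psi> x) = (LINT \<eta>|lborel. f x * \<psi> \<eta> * cis (- (x \<bullet> (\<eta> - \<xi>))))" for x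
      unfolding FT_def e[symmetric]
      by (simp only: integral_mult_right_zero[symmetric] mult_ac)
    then show ?thesis
      unfolding FT_def[of "\<lambda>x. f x * FT \<psi> x"] by simp
  qed
  also have "\<dots> = (LINT \<eta>|lborel. LINT x|lborel. f x * \<psi> \<eta> * cis (- (x \<bullet> (\<eta> - \<xi>))))"
    by (rule fubini_kernel(2)[OF f \<psi>, where B=1, symmetric]) auto
  also have "\<dots> = (LINT \<eta>|lborel. \<psi> \<eta> * FT f (\<eta> - \<xi>))"
    unfolding FT_def by (simp only: integral_mult_right_zero[symmetric] mult_ac)
  finally show ?thesis .
qed

text \<open>The pairing tests \<open>G\<close> against the transform of \<open>f\<close> times
  \<open>FT \<psi>\<close>, which is itself a convolution, and Fubini moves \<open>\<psi>\<close>
  outside. The hypothesis \<open>conv\<close> is the absolute convergence needed for this, asked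
  only for bounded output frequencies \<open>\<eta>\<close>.\<close>

lemma has_FT_distr_prod:
  assumes chi: "lp_cutoff chi" and f: "integrable lborel f" and G: "represents G (distr_FT T)"
    and conv: "\<And>R. integrable (lborel \<Otimes>\<^sub>M lborel) (\<lambda>(\<xi>, \<eta>). indicator (cball 0 R) \<eta> *\<^sub>R (G \<xi> * FT f (\<eta> - \<xi>)))"
  shows "has_FT (distr_prod f T) (\<lambda>\<eta>. (LINT \<xi>|lborel. G \<xi> * FT f (\<eta> - \<xi>)) / complex_of_real ((2 * pi) ^ 3))"
  unfolding has_FT_def
proof (intro conjI allI impI)
  let ?c = "complex_of_real ((2 * pi) ^ 3)"
  have [measurable]: "G \<in> borel_measurable borel"
    using G by (simp add: represents_def)
  have [measurable]: "FT f \<in> borel_measurable borel"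
    by (rule FT_measurable[OF f])
  show "(\<lambda>\<eta>. (LINT \<xi>|lborel. G \<xi> * FT f (\<eta> - \<xi>)) / ?c) \<in> borel_measurable borel"
    by measurable
  show "integrable lborel (\<lambda>\<eta>. indicator (cball 0 R) \<eta> *\<^sub>R ((LINT \<xi>|lborel. G \<xi> * FT f (\<eta> - \<xi>)) / ?c))" for R
  proof -
    have "integrable lborel (\<lambda>\<eta>. (LINT \<xi>|lborel. indicator (cball 0 R) \<eta> *\<^sub>R (G \<xi> * FT f (\<eta> - \<xi>))) / ?c)"
      using lborel_pair.integrable_snd[OF conv[of R]] by (intro integrable_divide_zero) simp
    then show ?thesis by (simp add: scaleR_conv_of_real)
  qed
  fix \<psi> :: "R3 \<Rightarrow> complex" and R B :: real
  assume [measurable]: "\<psi> \<in> borel_measurable borel" and B: "\<forall>\<xi>. norm (\<psi> \<xi>) \<le> B" and R: "\<forall>\<xi>. R < norm \<xi> \<longrightarrow> \<psi> \<xi> = 0"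
  have \<psi>: "integrable lborel \<psi>"
    using integrable_bounded_support(1)[of \<psi> B R] B R by auto
  define h where "h = (\<lambda>x. f x * FT \<psi> x)"
  have h: "integrable lborel h"
    unfolding h_def by (rule integrable_bounded_mult(2)[OF f FT_measurable[OF \<psi>] FT_bound])
  have [measurable]: "FT h \<in> borel_measurable borel"
    by (rule FT_measurable[OF h])
  \<comment> \<open>The pairing contains a representative picked by choice. It agrees with
    \<open>G\<close> almost everywhere, so the integral cannot distinguish them.\<close>
  define g where "g = (SOME g. represents g (distr_FT T))"
  have g: "represents g (distr_FT T)"
    unfolding g_def by (rule someI[of "\<lambda>g. represents g (distr_FT T)", OF G])
  then have [measurable]: "g \<in> borel_measurable borel"
    by (simp add: represents_def)
  have "distr_prod f T (FT \<psi>) = (LINT \<xi>|lborel. g \<xi> * FT h (- \<xi>)) / ?c"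
    by (simp add: distr_prod_def sobolev_pairing_def g_def h_def)
  also have "(LINT \<xi>|lborel. g \<xi> * FT h (- \<xi>)) = (LINT \<xi>|lborel. G \<xi> * FT h (- \<xi>))"
  proof (rule integral_cong_AE)
    show "AE \<xi> in lborel. g \<xi> * FT h (- \<xi>) = G \<xi> * FT h (- \<xi>)"
      using represents_unique[OF chi g G] by eventually_elim simp
  qed measurable
  also have "\<dots> = (LINT \<xi>|lborel. LINT \<eta>|lborel. \<psi> \<eta> * (G \<xi> * FT f (\<eta> - \<xi>)))"
    unfolding h_def FT_mult_FT[OF f \<psi>] integral_mult_right_zero[symmetric] by (simp only: mult_ac)
  also have "\<dots> = (LINT \<eta>|lborel. LINT \<xi>|lborel. \<psi> \<eta> * (G \<xi> * FT f (\<eta> - \<xi>)))"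
  proof (rule lborel_pair.Fubini_integral[symmetric])
    have "integrable (lborel \<Otimes>\<^sub>M lborel) (\<lambda>p. B *\<^sub>R (\<lambda>(\<xi>, \<eta>). indicator (cball 0 R) \<eta> *\<^sub>R (G \<xi> * FT f (\<eta> - \<xi>))) p)"
      by (rule integrable_scaleR_right[OF conv])
    then show "integrable (lborel \<Otimes>\<^sub>M lborel) (\<lambda>(\<xi>, \<eta>). \<psi> \<eta> * (G \<xi> * FT f (\<eta> - \<xi>)))"
    proof (rule Bochner_Integration.integrable_bound)
      have "norm (\<psi> \<eta> * (G \<xi> * FT f (\<eta> - \<xi>))) \<le> norm (B *\<^sub>R indicator (cball 0 R) \<eta> *\<^sub>R (G \<xi> * FT f (\<eta> - \<xi>)))" for \<xi> \<eta>
      proof (cases "R < norm \<eta>")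
        case False
        have "norm (\<psi> \<eta>) \<le> \<bar>B\<bar>" using B by (meson abs_ge_self order_trans)
        then show ?thesis using False by (simp add: norm_mult mult_right_mono)
      qed (use R in simp)
      then show "AE p in lborel \<Otimes>\<^sub>M lborel. norm (case p of (\<xi>, \<eta>) \<Rightarrow> \<psi> \<eta> * (G \<xi> * FT f (\<eta> - \<xi>)))
          \<le> norm (B *\<^sub>R (case p of (\<xi>, \<eta>) \<Rightarrow> indicator (cball 0 R) \<eta> *\<^sub>R (G \<xi> * FT f (\<eta> - \<xi>))))"
        by (intro AE_I2) (auto simp: abs_mult mult.assoc)
    qed measurable
  qed
  also have "\<dots> / ?c = (LINT \<eta>|lborel. \<psi> \<eta> * (LINT \<xi>|lborel. G \<xi> * FT f (\<eta> - \<xi>)) / ?c)"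
    unfolding integral_mult_right_zero by (rule integral_divide_zero[symmetric])
  also have "\<dots> = (LINT \<eta>|lborel. (LINT \<xi>|lborel. G \<xi> * FT f (\<eta> - \<xi>)) / ?c * \<psi> \<eta>)"
    by (simp only: mult.commute times_divide_eq_right)
  finally show "distr_prod f T (FT \<psi>) = (LINT \<eta>|lborel. (LINT \<xi>|lborel. G \<xi> * FT f (\<eta> - \<xi>)) / ?c * \<psi> \<eta>)" .
qed

section \<open>Vector fields\<close>

text \<open>The product rule leaves an extra Schwartz term at each differentiation, so the class
  closed under \<open>partial\<close> consists of the functions
  \<open>x $ i * f x + g x\<close>.\<close>

lemma schwartz_mult_coord:
  assumes "f \<in> schwartz"
  shows "(\<lambda>x. complex_of_real (x $ i) * f x) \<in> schwartz"
proof (rule schwartz_coinduct[of "\<lambda>h. \<exists>f g. f \<in> schwartz \<and> g \<in> schwartz \<and> h = (\<lambda>x. complex_of_real (x $ i) * f x + g x)"])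
  fix h :: "R3 \<Rightarrow> complex"
  assume "\<exists>f g. f \<in> schwartz \<and> g \<in> schwartz \<and> h = (\<lambda>x. complex_of_real (x $ i) * f x + g x)"
  then obtain f g where fg: "f \<in> schwartz" "g \<in> schwartz" and h: "h = (\<lambda>x. complex_of_real (x $ i) * f x + g x)" by blast
  note sd = fg[THEN schwartz_differentiable]
  have c: "((\<lambda>x::R3. complex_of_real (x $ i)) has_derivative (\<lambda>y. complex_of_real (y $ i))) (at x)" for x
    by (rule bounded_linear_imp_has_derivative)
      (rule bounded_linear_compose[OF bounded_linear_of_real bounded_linear_vec_nth])
  have d: "(h has_derivative (\<lambda>y. (complex_of_real (x $ i) * frechet_derivative f (at x) y + complex_of_real (y $ i) * f x) + frechet_derivative g (at x) y)) (at x)" for x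
    unfolding h by (intro has_derivative_add has_derivative_mult c frechet_derivative_worksI sd)
  have p: "partial m h = (\<lambda>x. complex_of_real (x $ i) * partial m f x + (complex_of_real (axis m 1 $ i) * f x + 1 * partial m g x))" for m
    by (rule ext, subst partial_eqI[OF d]) (simp add: partial_def)
  have ps: "(\<lambda>x. complex_of_real (axis m 1 $ i) * f x + 1 * partial m g x) \<in> schwartz" for m
    by (intro schwartz_lincomb schwartz_partial fg)
  have "\<exists>C. \<forall>x. (1 + norm x) ^ k * norm (h x) \<le> C" for k
  proof -
    obtain C D where C: "\<And>x. (1 + norm x) ^ Suc k * norm (f x) \<le> C" and D: "\<And>x. (1 + norm x) ^ k * norm (g x) \<le> D"
      using schwartz_bound[OF fg(1), of "Suc k"] schwartz_bound[OF fg(2), of k] by metis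
    have "(1 + norm x) ^ k * norm (h x) \<le> C + D" for x
    proof -
      have "norm (h x) \<le> (1 + norm x) * norm (f x) + norm (g x)"
      proof -
        have "\<bar>x $ i\<bar> \<le> 1 + norm x" using component_le_norm_cart[of x i] by linarith
        then have "norm (complex_of_real (x $ i) * f x) \<le> (1 + norm x) * norm (f x)"
          unfolding norm_mult norm_of_real by (rule mult_right_mono) auto
        then show ?thesis
          unfolding h using norm_triangle_ineq[of "complex_of_real (x $ i) * f x" "g x"] by linarith
      qed
      then have "(1 + norm x) ^ k * norm (h x) \<le> (1 + norm x) ^ k * ((1 + norm x) * norm (f x) + norm (g x))"
        by (rule mult_left_mono) auto
      also have "\<dots> = (1 + norm x) ^ Suc k * norm (f x) + (1 + norm x) ^ k * norm (g x)"
        by (simp add: algebra_simps)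
      also have "\<dots> \<le> C + D"
        by (intro add_mono C D)
      finally show ?thesis .
    qed
    then show ?thesis by blast
  qed
  moreover have "h differentiable (at x)" for x
    by (rule differentiableI[OF d])
  moreover have "\<exists>f g. f \<in> schwartz \<and> g \<in> schwartz \<and> partial m h = (\<lambda>x. complex_of_real (x $ i) * f x + g x)" for m
    using p[of m] schwartz_partial[OF fg(1), of m] ps[of m] by blast
  ultimately show "(\<forall>x. h differentiable (at x)) \<and> (\<forall>k. \<exists>C. \<forall>x. (1 + norm x) ^ k * norm (h x) \<le> C) \<and>
    (\<forall>m. \<exists>f g. f \<in> schwartz \<and> g \<in> schwartz \<and> partial m h = (\<lambda>x. complex_of_real (x $ i) * f x + g x))"
    by blast
next
  show "\<exists>fa g. fa \<in> schwartz \<and> g \<in> schwartz \<and> (\<lambda>x. complex_of_real (x $ i) * f x) = (\<lambda>x. complex_of_real (x $ i) * fa x + g x)"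
    using assms schwartz_zero by (intro exI[of _ f] exI[of _ "\<lambda>x. 0"]) simp
qed

definition schwartz_field :: "(R3 \<Rightarrow> R3) \<Rightarrow> bool" where
  "schwartz_field f \<longleftrightarrow> (\<forall>i. component f i \<in> schwartz)"

text \<open>The indices are cyclic modulo 3 as in \<open>curl\<close>, so the transform of the
  vorticity is recognised as a cross product without a case distinction.\<close>

lemma cross3_component: "cross3 x y $ i = x $ (i + 1) * y $ (i + 2) - x $ (i + 2) * y $ (i + 1)"
proof -
  have s: "(1::3) + 1 = 2" "(1::3) + 2 = 3" "(2::3) + 1 = 3" "(2::3) + 2 = 1" "(3::3) + 1 = 1" "(3::3) + 2 = 2"
    by simp_all
  have "i = 1 \<or> i = 2 \<or> i = 3" by (rule exhaust_3)
  then show ?thesis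
    by (elim disjE) (simp_all only: s cross_components mult.commute)
qed

lemma schwartz_field_scaleR:
  assumes "(\<lambda>\<xi>. complex_of_real (g \<xi>)) \<in> schwartz"
  shows "schwartz_field (\<lambda>\<xi>. g \<xi> *\<^sub>R w)"
  unfolding schwartz_field_def component_def
  using schwartz_cmult[OF assms, of "complex_of_real (w $ _)"] by (simp add: mult.commute)

lemma schwartz_field_cross:
  assumes "schwartz_field f"
  shows "schwartz_field (\<lambda>\<xi>. cross3 \<xi> (f \<xi>))"
  unfolding schwartz_field_def
proof
  fix i
  have "(\<lambda>\<xi>. 1 * (complex_of_real (\<xi> $ (i + 1)) * component f (i + 2) \<xi>) + (- 1) * (complex_of_real (\<xi> $ (i + 2)) * component f (i + 1) \<xi>)) \<in> schwartz"
    using assms by (intro schwartz_lincomb schwartz_mult_coord) (auto simp: schwartz_field_def)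
  then show "component (\<lambda>\<xi>. cross3 \<xi> (f \<xi>)) i \<in> schwartz"
    by (simp add: component_def[abs_def] cross3_component)
qed

lemma schwartz_field_cmult:
  assumes "schwartz_field f"
  shows "schwartz_field (\<lambda>\<xi>. c *\<^sub>R f \<xi>)"
  using assms schwartz_cmult[of "component f _" "complex_of_real c"]
  by (simp add: schwartz_field_def component_def[abs_def])

lemma schwartz_field_sum:
  assumes "finite A" "\<And>a. a \<in> A \<Longrightarrow> schwartz_field (f a)"
  shows "schwartz_field (\<lambda>\<xi>. \<Sum>a\<in>A. f a \<xi>)"
  using assms schwartz_sum[OF assms(1), of "\<lambda>a. component (f a) _"]
  by (simp add: schwartz_field_def component_def[abs_def])

lemma norm_cross3_le: "norm (cross3 x y) \<le> norm x * norm y"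
proof (rule power2_le_imp_le)
  show "(norm (cross3 x y))\<^sup>2 \<le> (norm x * norm y)\<^sup>2"
    using norm_cross_dot[of x y] zero_le_power2[of "x \<bullet> y"] by linarith
qed auto

lemma norm_component_le: "norm (component f i x) \<le> norm (f x)"
  unfolding component_def norm_of_real by (rule component_le_norm_cart)

section \<open>The vector field\<close>

text \<open>\<open>r\<close> is a radius below 1 beyond which \<open>chi\<close> vanishes. The
  starting scale \<open>4 ^ n0\<close> is so large that a bump of radius 1 fits with a wide margin
  into the shell between \<open>r * L j\<close> and \<open>L j\<close>; the constant 100 also makes
  all scales large compared with the errors in the comparison of frequencies.\<close>

locale flux_example =
  fixes chi :: "R3 \<Rightarrow> real" and r :: real and n0 :: nat
  assumes chi: "lp_cutoff chi"
    and r: "1 / 2 \<le> r" "r < 1"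
    and chi_eq_0: "\<And>\<xi>. r < norm \<xi> \<Longrightarrow> chi \<xi> = 0"
    and n0: "100 \<le> 4 ^ n0 * (1 - r)"
begin

definition L :: "nat \<Rightarrow> real" where "L j = 4 ^ (j + n0)"
definition rho :: real where "rho = (1 + r) / 2"
definition h :: real where "h = sqrt 63 / 8"

text \<open>The wave vectors close the resonant triangle \<open>khat 2 + khat 3 = - khat 1 / 4\<close> between
  consecutive scales; \<open>h\<close> makes them unit vectors. The radius \<open>rho\<close> places the packet of scale \<open>L j\<close>
  inside the shell from \<open>r * L j\<close> to \<open>L j\<close>, on which the symbol of every \<open>S\<^sub>Q\<close> is constant.\<close>

definition khat :: "3 \<Rightarrow> R3" where
  "khat t = (if t = 1 then vector [1, 0, 0] else if t = 2 then vector [- (1 / 8), h, 0] else vector [- (1 / 8), - h, 0])"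

text \<open>The wave vectors are horizontal. If all polarisations were vertical, the velocities at
  the centres would be horizontal and the vorticities vertical; velocity times vorticity would then
  be horizontal and orthogonal to the low vorticity. The horizontal \<open>pol 2\<close> turns the
  velocity at \<open>khat 2\<close> vertical and breaks this symmetry.\<close>

definition pol :: "3 \<Rightarrow> R3" where
  "pol t = (if t = 2 then vector [1, 0, 0] else vector [0, 0, 1])"

definition k :: "nat \<Rightarrow> 3 \<Rightarrow> R3" where "k j t = (rho * L j) *\<^sub>R khat t"

definition c :: "nat \<Rightarrow> real" where "c j = L j powr (- 2 / 3)"

text \<open>A vector potential: the cross product with \<open>\<xi>\<close> in \<open>hat\<close>
  makes the field divergence free. The opposite signs at \<open>k j t\<close> and
  \<open>- k j t\<close> make it odd, so \<open>hat\<close> is real and even and its inverse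
  transform is real.\<close>

definition pot :: "nat \<Rightarrow> R3 \<Rightarrow> R3" where
  "pot j \<xi> = (\<Sum>t\<in>UNIV. (chi (\<xi> - k j t) - chi (\<xi> + k j t)) *\<^sub>R pol t)"

definition hat :: "nat \<Rightarrow> R3 \<Rightarrow> R3" where
  "hat j \<xi> = (c j / L j) *\<^sub>R cross3 \<xi> (pot j \<xi>)"

text \<open>A nonnegative majorant of \<open>pot\<close>. Its integral does not depend on
  \<open>j\<close>, and its support locates the packet.\<close>

definition bumps :: "nat \<Rightarrow> R3 \<Rightarrow> real" where
  "bumps j \<xi> = (\<Sum>t\<in>UNIV. chi (\<xi> - k j t) + chi (\<xi> + k j t))"

definition U :: "R3 \<Rightarrow> R3" where "U \<xi> = (\<Sum>j. hat j \<xi>)"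

definition u :: "R3 \<Rightarrow> R3" where "u x = (\<chi> i. Re (IFT (component U i) x))"

section \<open>Shells, supports and summability of the packets\<close>

lemmas chi_facts = lp_cutoff_facts[OF chi]

lemma L_ge: "100 \<le> L j * (1 - r)" "1 \<le> L j" "0 < L j" "100 \<le> L j"
proof -
  have "1 * (4 ^ n0 * (1 - r)) \<le> 4 ^ j * (4 ^ n0 * (1 - r))"
    using n0 by (intro mult_right_mono) auto
  then show 1: "100 \<le> L j * (1 - r)"
    using n0 unfolding L_def power_add mult.assoc by linarith
  show 2: "1 \<le> L j" by (simp add: L_def)
  then show "0 < L j" by simp
  have "L j * (1 - r) \<le> L j * 1" using r 2 by (intro mult_left_mono) auto
  then show "100 \<le> L j" using 1 by simp
qed

lemma L_Suc: "L (Suc j) = 4 * L j"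
  by (simp add: L_def)

lemma L_eq: "L j = 2 ^ (2 * (j + n0))"
  unfolding L_def power_mult by simp

lemma L_mono: "i \<le> j \<Longrightarrow> L i \<le> L j"
  by (simp add: L_def power_increasing)

lemma L_less: "i < j \<Longrightarrow> 4 * L i \<le> L j"
  using L_mono[of "Suc i" j] by (simp add: L_Suc)

text \<open>\<open>rho\<close> is the midpoint of \<open>r\<close> and 1, so the sphere of radius
  \<open>rho * L j\<close> keeps a distance of \<open>L j * (1 - r) / 2\<close>, at least 50, from
  both edges of the shell. A ball of radius 1 around a wave vector thus stays inside.\<close>

lemma rho: "3 / 4 \<le> rho" "rho < 1" "rho * L j + 1 \<le> L j" "r * L j \<le> rho * L j - 1"
  using r L_ge(1)[of j] by (auto simp: rho_def field_simps)

lemma h_sq: "h * h = 63 / 64" "h\<^sup>2 = 63 / 64" and h_pos: "0 < h"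
  by (auto simp: h_def power_divide power2_eq_square[symmetric])

lemma khat_simps: "khat 1 = vector [1, 0, 0]" "khat 2 = vector [- (1 / 8), h, 0]" "khat 3 = vector [- (1 / 8), - h, 0]"
  "pol 1 = vector [0, 0, 1]" "pol 2 = vector [1, 0, 0]" "pol 3 = vector [0, 0, 1]"
  by (simp_all add: khat_def pol_def)

lemma norm_khat: "norm (khat t) = 1" and norm_pol: "norm (pol t) = 1"
proof -
  have "(norm (khat t))\<^sup>2 = 1"
    unfolding power2_norm_eq_inner
    using exhaust_3[of t] h_sq by (auto simp: khat_simps inner_vec_def sum_3 vector_3)
  then show "norm (khat t) = 1"
    using power2_eq_1_iff[of "norm (khat t)"] norm_ge_zero[of "khat t"] by linarith
  have "(norm (pol t))\<^sup>2 = 1"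
    unfolding power2_norm_eq_inner
    using exhaust_3[of t] by (auto simp: khat_simps inner_vec_def sum_3 vector_3)
  then show "norm (pol t) = 1"
    using power2_eq_1_iff[of "norm (pol t)"] norm_ge_zero[of "pol t"] by linarith
qed

lemma norm_k: "norm (k j t) = rho * L j"
  using rho(1) L_ge(3)[of j] by (simp add: k_def norm_khat abs_mult)

lemma near_k_shell:
  assumes "norm (\<xi> - s *\<^sub>R k j t) < 1" "\<bar>s\<bar> = 1"
  shows "r * L j < norm \<xi>" "norm \<xi> < L j"
proof -
  have n: "norm (s *\<^sub>R k j t) = rho * L j"
    using assms(2) by (simp add: norm_k)
  show "norm \<xi> < L j"
    using norm_triangle_ineq[of "\<xi> - s *\<^sub>R k j t" "s *\<^sub>R k j t"] assms n rho(3)[of j] by simp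
  show "r * L j < norm \<xi>"
    using norm_triangle_ineq4[of \<xi> "\<xi> - s *\<^sub>R k j t"] assms n rho(4)[of j] by simp
qed

lemma bumps_nonneg: "0 \<le> bumps j \<xi>"
  unfolding bumps_def using chi_facts(1) by (intro sum_nonneg add_nonneg_nonneg) auto

lemma bumps_support:
  assumes "bumps j \<xi> \<noteq> 0"
  shows "\<exists>t s. \<bar>s\<bar> = 1 \<and> norm (\<xi> - s *\<^sub>R k j t) < 1"
proof -
  obtain t where "chi (\<xi> - k j t) \<noteq> 0 \<or> chi (\<xi> + k j t) \<noteq> 0"
    using assms unfolding bumps_def by (metis (no_types, lifting) add.right_neutral sum.neutral)
  then show ?thesis
  proof
    assume "chi (\<xi> - k j t) \<noteq> 0"
    then show ?thesis
      using lp_cutoff_support[OF chi] by (intro exI[of _ t] exI[of _ 1]) simp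
  next
    assume "chi (\<xi> + k j t) \<noteq> 0"
    then show ?thesis
      using lp_cutoff_support[OF chi] by (intro exI[of _ t] exI[of _ "-1"]) simp
  qed
qed

lemma bumps_shell:
  assumes "bumps j \<xi> \<noteq> 0"
  shows "r * L j < norm \<xi>" "norm \<xi> < L j"
  using bumps_support[OF assms] near_k_shell by metis+

lemma norm_pot_le: "norm (pot j \<xi>) \<le> bumps j \<xi>"
  unfolding pot_def bumps_def
proof (rule sum_norm_le)
  fix t
  show "norm ((chi (\<xi> - k j t) - chi (\<xi> + k j t)) *\<^sub>R pol t) \<le> chi (\<xi> - k j t) + chi (\<xi> + k j t)"
    using chi_facts(1)[of "\<xi> - k j t"] chi_facts(1)[of "\<xi> + k j t"] by (simp add: norm_pol)
qed

lemma c_pos: "0 < c j"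
  using L_ge(3)[of j] by (simp add: c_def)

lemma norm_hat_le: "norm (hat j \<xi>) \<le> c j * bumps j \<xi>"
proof (cases "bumps j \<xi> = 0")
  case True
  then show ?thesis using norm_pot_le[of j \<xi>] by (simp add: hat_def)
next
  case False
  have "norm (hat j \<xi>) \<le> (c j / L j) * (norm \<xi> * norm (pot j \<xi>))"
    using c_pos[of j] L_ge(3)[of j] unfolding hat_def norm_scaleR by (intro mult_mono norm_cross3_le) auto
  also have "\<dots> \<le> (c j / L j) * (L j * bumps j \<xi>)"
    using c_pos[of j] L_ge(3)[of j] bumps_shell[OF False] by (intro mult_left_mono mult_mono norm_pot_le) auto
  also have "\<dots> = c j * bumps j \<xi>"
    using L_ge(3)[of j] by simp
  finally show ?thesis .
qed

lemma hat_shell: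
  assumes "hat j \<xi> \<noteq> 0"
  shows "bumps j \<xi> \<noteq> 0" "r * L j < norm \<xi>" "norm \<xi> < L j"
proof -
  show "bumps j \<xi> \<noteq> 0"
    using assms norm_hat_le[of j \<xi>] by auto
  then show "r * L j < norm \<xi>" "norm \<xi> < L j"
    by (rule bumps_shell)+
qed

text \<open>Since \<open>1 / 2 \<le> r\<close> and consecutive scales differ by the factor 4, the
  lower edge of a shell is at least twice the upper edge of the one before.\<close>

lemma shells_disjoint:
  assumes "r * L i < x" "x < L i" "r * L j < x" "x < L j"
  shows "i = j"
proof (rule ccontr)
  assume "i \<noteq> j"
  then consider "i < j" | "j < i" by linarith
  then show False
  proof cases
    case 1
    have "1 / 2 * L j \<le> r * L j" using r L_ge(3)[of j] by (intro mult_right_mono) auto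
    then show ?thesis using L_less[OF 1] assms L_ge(3)[of i] by linarith
  next
    case 2
    have "1 / 2 * L i \<le> r * L i" using r L_ge(3)[of i] by (intro mult_right_mono) auto
    then show ?thesis using L_less[OF 2] assms L_ge(3)[of j] by linarith
  qed
qed

lemma hat_unique: "hat i \<xi> \<noteq> 0 \<Longrightarrow> hat j \<xi> \<noteq> 0 \<Longrightarrow> i = j"
  using hat_shell shells_disjoint by metis

lemma U_eq_hat: "hat j \<xi> \<noteq> 0 \<Longrightarrow> U \<xi> = hat j \<xi>"
  unfolding U_def using hat_unique by (subst suminf_finite[of "{j}"]) auto

lemma U_eq_0: "(\<And>j. hat j \<xi> = 0) \<Longrightarrow> U \<xi> = 0"
  unfolding U_def by simp

lemma U_cases:
  obtains j where "U \<xi> = hat j \<xi>" "hat j \<xi> \<noteq> 0" | "U \<xi> = 0" "\<And>j. hat j \<xi> = 0"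
  using U_eq_hat U_eq_0 by metis

lemma hat_sums_U: "(\<lambda>j. hat j \<xi>) sums U \<xi>"
proof (cases "\<exists>j. hat j \<xi> \<noteq> 0")
  case True
  then obtain j where "hat j \<xi> \<noteq> 0" by blast
  then show ?thesis
    using hat_unique U_eq_hat sums_finite[of "{j}" "\<lambda>j. hat j \<xi>"] by auto
next
  case False
  then show ?thesis using U_eq_0 by simp
qed

lemma pot_odd: "pot j (- \<xi>) = - pot j \<xi>"
proof -
  have "chi (- \<xi> - k j t) = chi (\<xi> + k j t)" "chi (- \<xi> + k j t) = chi (\<xi> - k j t)" for t
    using chi_facts(3)[of "\<xi> + k j t"] chi_facts(3)[of "\<xi> - k j t"] by (simp_all add: algebra_simps)
  then have "pot j (- \<xi>) = (\<Sum>t\<in>UNIV. - ((chi (\<xi> - k j t) - chi (\<xi> + k j t)) *\<^sub>R pol t))"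
    unfolding pot_def by (intro sum.cong refl) (simp add: algebra_simps)
  then show ?thesis by (simp add: pot_def sum_negf)
qed

lemma hat_even: "hat j (- \<xi>) = hat j \<xi>"
  by (simp add: hat_def pot_odd)

lemma U_even: "U (- \<xi>) = U \<xi>"
  by (simp add: U_def hat_even)

lemma schwartz_field_hat: "schwartz_field (hat j)"
proof -
  have "(\<lambda>\<xi>. complex_of_real (chi (\<xi> - k j t) - chi (\<xi> + k j t))) \<in> schwartz" for t
    using schwartz_lincomb[OF lp_cutoff_bump[OF chi, of 1 "- k j t"] lp_cutoff_bump[OF chi, of 1 "k j t"], of 1 "- 1"] by simp
  then show ?thesis
    unfolding hat_def[abs_def] pot_def
    by (intro schwartz_field_cmult schwartz_field_cross schwartz_field_sum schwartz_field_scaleR) auto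
qed

lemma measurable_hat [measurable]: "hat j \<in> borel_measurable borel"
proof -
  note [measurable] = chi_facts(4)
  have "continuous_on UNIV chi" by (rule chi_facts(5))
  then have "continuous_on UNIV (hat j)"
    unfolding hat_def[abs_def] pot_def
    by (intro continuous_intros continuous_on_cross continuous_on_compose2[OF \<open>continuous_on UNIV chi\<close>]) auto
  then show ?thesis by (rule borel_measurable_continuous_onI)
qed

lemma measurable_U [measurable]: "U \<in> borel_measurable borel"
  unfolding U_def by measurable

lemma measurable_component [measurable]: "f \<in> borel_measurable borel \<Longrightarrow> component f i \<in> borel_measurable borel"
  unfolding component_def[abs_def] by measurable

lemma measurable_chi [measurable]: "chi \<in> borel_measurable borel"
  by (rule chi_facts(4))

lemma integrable_chi: "integrable lborel chi"
  using integrable_Re[OF integrable_schwartz[OF lp_cutoff_bump[OF chi, of 1 0]]] by simp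

lemma integrable_bumps: "integrable lborel (bumps j)" "(LINT \<xi>|lborel. bumps j \<xi>) = 6 * (LINT \<xi>|lborel. chi \<xi>)"
proof -
  have i: "integrable lborel (\<lambda>\<xi>. chi (\<xi> - k j t))" "(LINT \<xi>|lborel. chi (\<xi> - k j t)) = (LINT \<xi>|lborel. chi \<xi>)"
     "integrable lborel (\<lambda>\<xi>. chi (\<xi> + k j t))" "(LINT \<xi>|lborel. chi (\<xi> + k j t)) = (LINT \<xi>|lborel. chi \<xi>)" for t
    using integrable_affine_iff[of 1 chi "- k j t"] integral_affine[of 1 chi "- k j t"]
      integrable_affine_iff[of 1 chi "k j t"] integral_affine[of 1 chi "k j t"] integrable_chi
    by (simp_all add: add.commute)
  show "integrable lborel (bumps j)" "(LINT \<xi>|lborel. bumps j \<xi>) = 6 * (LINT \<xi>|lborel. chi \<xi>)"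
    unfolding bumps_def by (simp_all add: i)
qed

text \<open>Geometric series with ratios 4^(-2/3) and 4^(-1/3). The first gives integrability of
  \<open>U\<close> and absolute convergence of the series of packets, the second the H^(1/2)
  bound.\<close>

lemma summable_c: "summable c" and summable_Lcc: "summable (\<lambda>j. L j * c j * c j)"
proof -
  have c: "c j = c 0 * (4 powr (- 2 / 3)) ^ j" for j
  proof -
    have "((4::real) ^ j) powr (- 2 / 3) = (4 powr (- 2 / 3)) ^ j"
      by (simp add: powr_powr mult.commute flip: powr_realpow)
    then show ?thesis
      unfolding c_def L_def by (simp add: power_add powr_mult)
  qed
  have "summable (\<lambda>j. c 0 * (4 powr (- 2 / 3)) ^ j)"
    by (intro summable_mult summable_geometric) (simp add: powr_less_one)
  then show "summable c"
    unfolding c[symmetric] .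
  have l: "L j * c j * c j = L 0 * c 0 * c 0 * (4 powr (- 1 / 3)) ^ j" for j
  proof -
    have "(4 * (4 powr (- 2 / 3)) * (4 powr (- 2 / 3))) = (4::real) powr (- 1 / 3)"
    proof -
      have "(4::real) powr (- 1 / 3) = 4 powr (1 + (- 2 / 3) + (- 2 / 3))" by simp
      then show ?thesis unfolding powr_add by simp
    qed
    then have "(4 powr (- 1 / 3)) ^ j = 4 ^ j * (4 powr (- 2 / 3)) ^ j * ((4::real) powr (- 2 / 3)) ^ j"
      unfolding power_mult_distrib[symmetric] by simp
    moreover have "L j = L 0 * 4 ^ j" by (simp add: L_def power_add)
    ultimately show ?thesis by (subst c, subst c) simp
  qed
  have "summable (\<lambda>j. L 0 * c 0 * c 0 * (4 powr (- 1 / 3)) ^ j)"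
    by (intro summable_mult summable_geometric) (simp add: powr_less_one)
  then show "summable (\<lambda>j. L j * c j * c j)"
    unfolding l[symmetric] .
qed

end

section \<open>Auxiliary facts on transforms, L^3 norms and tempered distributions\<close>

lemma FT_translate:
  assumes [measurable]: "f \<in> borel_measurable borel"
  shows "FT (\<lambda>\<xi>. f (\<xi> - a)) x = cis (- (a \<bullet> x)) * FT f x"
proof -
  have "FT (\<lambda>\<xi>. f (\<xi> - a)) x = (LINT \<xi>|lborel. cis (- ((a + 1 *\<^sub>R \<xi>) \<bullet> x)) * f (a + 1 *\<^sub>R \<xi> - a))"
    unfolding FT_def by (subst integral_affine[of 1 "\<lambda>\<xi>. cis (- (\<xi> \<bullet> x)) * f (\<xi> - a)" a]) auto
  also have "\<dots> = (LINT \<xi>|lborel. cis (- (a \<bullet> x)) * (cis (- (\<xi> \<bullet> x)) * f \<xi>))"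
    by (simp add: inner_add_left mult.assoc[symmetric] cis_mult)
  finally show ?thesis
    by (simp add: FT_def)
qed

text \<open>Meant for packets that are dominated by an amplitude \<open>a\<close> times one fixed
  profile \<open>D\<close>: the amplitude leaves the norm linearly.\<close>

lemma Lp_norm_le:
  assumes [measurable]: "g \<in> borel_measurable borel" and a: "0 \<le> a" and D: "integrable lborel (\<lambda>x. D x ^ 3)" "\<And>x. 0 \<le> D x"
    and le: "\<And>x. norm (g x) \<le> a * D x"
  shows "Lp_norm 3 g \<le> ennreal (a * (LINT x|lborel. D x ^ 3) powr (1 / 3))"
proof -
  have p: "y powr 3 = y ^ 3" if "0 \<le> y" for y :: real
    using that powr_numeral[of y "num.Bit1 num.One"] by simp
  have I: "(\<integral>\<^sup>+ x. ennreal (norm (g x) powr 3) \<partial>lborel) \<le> ennreal (a ^ 3 * (LINT x|lborel. D x ^ 3))"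
  proof -
    have "(\<integral>\<^sup>+ x. ennreal (norm (g x) powr 3) \<partial>lborel) \<le> (\<integral>\<^sup>+ x. ennreal (a ^ 3 * D x ^ 3) \<partial>lborel)"
    proof (intro nn_integral_mono ennreal_leI)
      fix x
      have "norm (g x) powr 3 = norm (g x) ^ 3" by (rule p) simp
      also have "\<dots> \<le> (a * D x) ^ 3" by (intro power_mono le) simp
      finally show "norm (g x) powr 3 \<le> a ^ 3 * D x ^ 3" by (simp only: power_mult_distrib)
    qed
    also have "\<dots> = ennreal (LINT x|lborel. a ^ 3 * D x ^ 3)"
      using D a by (intro nn_integral_eq_integral) auto
    finally show ?thesis by simp
  qed
  have nn: "0 \<le> (LINT x|lborel. D x ^ 3)"
    using D(2) by simp
  let ?I = "\<integral>\<^sup>+ x. ennreal (norm (g x) powr 3) \<partial>lborel"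
  have "?I \<noteq> \<infinity>"
    using le_less_trans[OF I ennreal_less_top] by auto
  moreover have "enn2real ?I powr (1 / 3) \<le> (a ^ 3 * (LINT x|lborel. D x ^ 3)) powr (1 / 3)"
    using I a nn by (intro powr_mono2 enn2real_leI) auto
  moreover have "(a ^ 3 * (LINT x|lborel. D x ^ 3)) powr (1 / 3) = a * (LINT x|lborel. D x ^ 3) powr (1 / 3)"
  proof -
    have "(a ^ 3) powr (1 / 3) = a"
    proof -
      have "(a powr 3) powr (1 / 3) = a powr 1" unfolding powr_powr by simp
      then show ?thesis using a by (simp only: p[OF a] powr_one)
    qed
    then show ?thesis using a nn by (simp add: powr_mult)
  qed
  ultimately have "ennreal (enn2real ?I powr (1 / 3)) \<le> ennreal (a * (LINT x|lborel. D x ^ 3) powr (1 / 3))"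
    by (intro ennreal_leI) (simp only:)
  then show ?thesis
    unfolding Lp_norm_def Let_def using \<open>?I \<noteq> \<infinity>\<close> by (simp only: if_False)
qed

lemma cnj_IFT_real:
  assumes f: "integrable lborel f" and real: "\<And>\<xi>. cnj (f \<xi>) = f \<xi>" and even: "\<And>\<xi>. f (- \<xi>) = f \<xi>"
  shows "of_real (Re (IFT f x)) = IFT f x"
proof -
  have [measurable]: "f \<in> borel_measurable borel"
    using f by (auto dest: borel_measurable_integrable)
  have "cnj (LINT \<xi>|lborel. cis (x \<bullet> \<xi>) * f \<xi>) = (LINT \<xi>|lborel. cnj (cis (x \<bullet> \<xi>) * f \<xi>))"
    by (rule Bochner_Integration.integral_cnj[symmetric])
  also have "\<dots> = (LINT \<xi>|lborel. cis (x \<bullet> - \<xi>) * f (- \<xi>))"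
    by (simp add: real even cis_cnj)
  also have "\<dots> = (LINT \<xi>|lborel. cis (x \<bullet> \<xi>) * f \<xi>)"
    using integral_affine[of "-1" "\<lambda>\<xi>. cis (x \<bullet> \<xi>) * f \<xi>" 0] by simp
  finally have "cnj (IFT f x) = IFT f x"
    by (simp add: IFT_def)
  then show ?thesis
    by (simp add: complex_eq_iff)
qed

text \<open>The seminorm of order 0 is the supremum norm, and the L^1 norm of \<open>v\<close> is
  the constant.\<close>

lemma tempered_distr_of:
  assumes v: "integrable lborel v"
  shows "tempered (distr_of v)"
  unfolding tempered_def
proof (intro conjI ballI allI)
  have [measurable]: "v \<in> borel_measurable borel"
    using v by (auto dest: borel_measurable_integrable)
  have i: "integrable lborel (\<lambda>x. v x * f x)" if f: "f \<in> schwartz" for f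
  proof -
    obtain B where "\<And>x. norm (f x) \<le> B" using schwartz_bounded[OF f] by blast
    then show ?thesis
      by (rule integrable_bounded_mult(2)[OF v schwartz_measurable[OF f]])
  qed
  show "distr_of v (\<lambda>x. f x + g x) = distr_of v f + distr_of v g" if "f \<in> schwartz" "g \<in> schwartz" for f g
    using i[OF that(1)] i[OF that(2)] by (simp add: distr_of_def distrib_left)
  show "distr_of v (\<lambda>x. c * f x) = c * distr_of v f" for c f
    unfolding distr_of_def integral_mult_right_zero[symmetric] by (simp only: mult_ac)
  show "\<exists>C N. \<forall>f\<in>schwartz. norm (distr_of v f) \<le> C * schwartz_seminorm N f"
  proof (intro exI ballI)
    fix f assume f: "f \<in> schwartz"
    obtain B where B: "\<And>x. norm (f x) \<le> B" using schwartz_bounded[OF f] by blast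
    let ?S = "SUP x. norm (f x)"
    have S: "norm (f x) \<le> ?S" for x
      by (rule cSUP_upper) (use B in \<open>auto intro!: bdd_aboveI\<close>)
    have "{is. length is \<le> 0} = {[] :: 3 list}" by auto
    then have eq: "schwartz_seminorm 0 f = ?S"
      by (simp add: schwartz_seminorm_def)
    have "norm (distr_of v f) \<le> (LINT x|lborel. norm (v x) * ?S)"
      unfolding distr_of_def
      by (rule Bochner_Integration.integral_norm_bound_integral[OF i[OF f]])
        (use v S in \<open>auto simp: norm_mult intro!: mult_left_mono\<close>)
    then show "norm (distr_of v f) \<le> (LINT x|lborel. norm (v x)) * schwartz_seminorm 0 f"
      by (simp add: eq)
  qed
qed

section \<open>The packets in physical space and the sum of their series\<close>

context flux_example
begin

definition wave :: "3 \<Rightarrow> R3 \<Rightarrow> 3 \<Rightarrow> R3 \<Rightarrow> complex" where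
  "wave t a i = component (\<lambda>\<xi>. cross3 \<xi> (chi (\<xi> - a) *\<^sub>R pol t)) i"

text \<open>Only bumps centred at 0 occur. A translation in frequency is a modulation in space and
  leaves moduli unchanged, so these finitely many transforms control the packets of all
  scales.\<close>

definition envelope :: "R3 \<Rightarrow> real" where
  "envelope x = norm (FT (\<lambda>\<xi>. complex_of_real (chi \<xi>)) x) + (\<Sum>t\<in>UNIV. \<Sum>i\<in>UNIV. norm (FT (wave t 0 i) x))"

lemma schwartz_chi: "(\<lambda>\<xi>. complex_of_real (chi (\<xi> - a))) \<in> schwartz"
  using lp_cutoff_bump[OF chi, of 1 "- a"] by simp

lemma schwartz_wave: "wave t a i \<in> schwartz"
  using schwartz_field_cross[OF schwartz_field_scaleR[OF schwartz_chi]]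
  by (simp add: wave_def schwartz_field_def)

lemma integrable_envelope: "integrable lborel envelope"
  unfolding envelope_def[abs_def] using schwartz_chi[of 0]
  by (intro Bochner_Integration.integrable_add Bochner_Integration.integrable_sum integrable_norm integrable_FT_schwartz schwartz_wave) simp

lemma envelope_nonneg: "0 \<le> envelope x"
  unfolding envelope_def by (intro add_nonneg_nonneg sum_nonneg norm_ge_zero)

lemma envelope_bounded: "\<exists>B. \<forall>x. envelope x \<le> B"
  unfolding envelope_def
  by (rule exI[of _ "(LINT \<xi>|lborel. norm (complex_of_real (chi \<xi>))) + (\<Sum>t\<in>UNIV. \<Sum>i\<in>UNIV. (LINT \<xi>|lborel. norm (wave t 0 i \<xi>)))"])
    (intro allI add_mono sum_mono FT_bound)

text \<open>Writing \<open>\<xi>\<close> as \<open>(\<xi> - a) + a\<close> splits the polarised bump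
  at \<open>a\<close> into a translate of the one at 0 and a constant vector times a translate of
  \<open>chi\<close>. Only the second part grows with \<open>a\<close>, and linearly.\<close>

lemma FT_wave_le:
  assumes "norm a \<le> M" "1 \<le> M"
  shows "norm (FT (wave t a i) x) \<le> M * envelope x"
proof -
  let ?c = "\<lambda>\<xi>. complex_of_real (chi \<xi>)"
  have [measurable]: "wave t 0 i \<in> borel_measurable borel"
    by (rule schwartz_measurable[OF schwartz_wave])
  have eq: "wave t a i = (\<lambda>\<xi>. 1 * wave t 0 i (\<xi> - a) + complex_of_real (cross3 a (pol t) $ i) * ?c (\<xi> - a))"
    by (rule ext) (simp add: wave_def component_def cross_mult_right cross3_component algebra_simps)
  have "FT (wave t a i) x = cis (- (a \<bullet> x)) * (FT (wave t 0 i) x + complex_of_real (cross3 a (pol t) $ i) * FT ?c x)"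
  proof -
    have i1: "integrable lborel (\<lambda>\<xi>. wave t 0 i (\<xi> - a))"
      using integrable_affine_iff[of 1 "wave t 0 i" "- a"] integrable_schwartz[OF schwartz_wave, of t 0 i] by simp
    have "FT (wave t a i) x = 1 * FT (\<lambda>\<xi>. wave t 0 i (\<xi> - a)) x + complex_of_real (cross3 a (pol t) $ i) * FT (\<lambda>\<xi>. ?c (\<xi> - a)) x"
      by (subst eq, subst FT_lincomb[OF i1 integrable_schwartz[OF schwartz_chi]]) simp
    then show ?thesis
      by (simp add: FT_translate FT_translate[of ?c] algebra_simps)
  qed
  then have "norm (FT (wave t a i) x) = norm (FT (wave t 0 i) x + complex_of_real (cross3 a (pol t) $ i) * FT ?c x)"
    by (simp only: norm_mult[of "cis _"] norm_cis mult_1_left)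
  also have "\<dots> \<le> norm (FT (wave t 0 i) x) + norm (complex_of_real (cross3 a (pol t) $ i) * FT ?c x)"
    by (rule norm_triangle_ineq)
  also have "\<dots> \<le> M * norm (FT (wave t 0 i) x) + M * norm (FT ?c x)"
  proof (rule add_mono)
    show "norm (FT (wave t 0 i) x) \<le> M * norm (FT (wave t 0 i) x)"
      using assms by (simp add: mult_le_cancel_right1)
    have "\<bar>cross3 a (pol t) $ i\<bar> \<le> M"
      using component_le_norm_cart[of "cross3 a (pol t)" i] norm_cross3_le[of a "pol t"] assms by (simp add: norm_pol)
    then show "norm (complex_of_real (cross3 a (pol t) $ i) * FT ?c x) \<le> M * norm (FT ?c x)"
      by (simp add: norm_mult mult_right_mono)
  qed
  also have "\<dots> \<le> M * envelope x"
  proof -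
    have "norm (FT (wave t 0 i) x) \<le> (\<Sum>i\<in>UNIV. norm (FT (wave t 0 i) x))"
      by (rule member_le_sum) auto
    also have "\<dots> \<le> (\<Sum>t\<in>UNIV. \<Sum>i\<in>UNIV. norm (FT (wave t 0 i) x))"
      by (rule member_le_sum) (auto intro: sum_nonneg)
    finally have "norm (FT (wave t 0 i) x) + norm (FT ?c x) \<le> envelope x"
      by (simp add: envelope_def)
    then show ?thesis
      using assms by (simp add: mult_left_mono flip: distrib_left)
  qed
  finally show ?thesis .
qed

text \<open>The 6 counts the bumps of a packet; the reflection and the power of
  \<open>2 * pi\<close> come from \<open>IFT_eq_FT\<close>.\<close>

definition dom :: "R3 \<Rightarrow> real" where "dom x = 6 * envelope (- x) / (2 * pi) ^ 3"

lemma dom_nonneg: "0 \<le> dom x"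
  using envelope_nonneg[of "- x"] by (simp add: dom_def)

lemma integrable_dom: "integrable lborel dom"
proof -
  have "integrable lborel (\<lambda>x. envelope (- x))"
    using integrable_affine_iff[of "-1" envelope 0] integrable_envelope by (simp add: borel_measurable_integrable)
  then show ?thesis
    unfolding dom_def by (intro integrable_divide_zero integrable_mult_right)
qed

lemma measurable_dom [measurable]: "dom \<in> borel_measurable borel"
  using integrable_dom by (auto dest: borel_measurable_integrable)

lemma dom_bounded: "\<exists>B. \<forall>x. dom x \<le> B"
proof -
  obtain B where "\<And>x. envelope x \<le> B" using envelope_bounded by blast
  then have "dom x \<le> 6 * B / (2 * pi) ^ 3" for x
    unfolding dom_def by (intro divide_right_mono mult_left_mono) auto
  then show ?thesis by blast
qed

lemma hat_component_schwartz: "component (hat j) i \<in> schwartz"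
  using schwartz_field_hat by (simp add: schwartz_field_def)

text \<open>The factor \<open>1 / L j\<close> in \<open>hat\<close> compensates the linear growth of
  the polarised bumps, which leaves \<open>c j\<close> times a profile common to all scales.
  Integrability of \<open>u\<close>, inversion term by term and the L^3 bounds of the blocks rest on
  this estimate.\<close>

lemma IFT_hat_le: "norm (IFT (component (hat j) i) x) \<le> c j * dom x"
proof -
  have eq: "component (hat j) i = (\<lambda>\<xi>. \<Sum>t\<in>UNIV. complex_of_real (c j / L j) * wave t (k j t) i \<xi> + complex_of_real (- c j / L j) * wave t (- k j t) i \<xi>)"
    by (rule ext) (simp add: hat_def pot_def wave_def component_def cross3_component sum_subtractf sum_distrib_left
      sum.distrib algebra_simps diff_divide_distrib sum_divide_distrib)
  have i: "integrable lborel (\<lambda>\<xi>. complex_of_real (c j / L j) * wave t (k j t) i \<xi> + complex_of_real (- c j / L j) * wave t (- k j t) i \<xi>)" for t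
    by (intro integrable_schwartz schwartz_lincomb schwartz_wave)
  have kL: "norm (k j t) \<le> L j" for t
    using rho(2) L_ge(3)[of j] by (simp add: norm_k)
  have le: "norm (FT (component (hat j) i) y) \<le> c j * (6 * envelope y)" for y
  proof -
    have "norm (FT (component (hat j) i) y) \<le> (\<Sum>t\<in>(UNIV::3 set). c j * (2 * envelope y))"
      unfolding eq FT_sum[OF i]
    proof (rule sum_norm_le)
      fix t
      have "norm (complex_of_real (c j / L j) * FT (wave t (k j t) i) y + complex_of_real (- c j / L j) * FT (wave t (- k j t) i) y)
        \<le> (c j / L j) * (L j * envelope y) + (c j / L j) * (L j * envelope y)"
        using c_pos[of j] L_ge(3)[of j]
        by (intro order_trans[OF norm_triangle_ineq] add_mono)
          (auto simp only: norm_mult norm_of_real abs_divide abs_minus_cancel abs_of_pos norm_minus_cancel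
            intro!: mult_left_mono FT_wave_le kL L_ge divide_nonneg_pos)
      then show "norm (FT (\<lambda>\<xi>. complex_of_real (c j / L j) * wave t (k j t) i \<xi> + complex_of_real (- c j / L j) * wave t (- k j t) i \<xi>) y) \<le> c j * (2 * envelope y)"
        using L_ge(3)[of j] by (subst FT_lincomb) (auto intro!: integrable_schwartz schwartz_wave)
    qed
    then show ?thesis by simp
  qed
  have "norm (IFT (component (hat j) i) x) = norm (FT (component (hat j) i) (- x)) / (2 * pi) ^ 3"
    by (simp add: IFT_eq_FT norm_divide norm_power)
  also have "\<dots> \<le> c j * (6 * envelope (- x)) / (2 * pi) ^ 3"
    by (intro divide_right_mono le) auto
  finally show ?thesis
    by (simp add: dom_def)
qed

lemma component_sums: "(\<lambda>j. component (hat j) i \<xi>) sums component U i \<xi>"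
  unfolding component_def by (intro sums_of_real bounded_linear.sums[OF bounded_linear_vec_nth hat_sums_U])

lemma component_U_suminf: "component U i \<xi> = (\<Sum>j. component (hat j) i \<xi>)"
  by (rule sums_unique[OF component_sums])

lemma norm_component_hat_le: "norm (component (hat j) i \<xi>) \<le> c j * bumps j \<xi>"
  by (rule order_trans[OF norm_component_le]) (rule norm_hat_le)

lemma integral_component_hat_le: "(LINT \<xi>|lborel. norm (component (hat j) i \<xi>)) \<le> 6 * (LINT \<xi>|lborel. chi \<xi>) * c j"
proof -
  have "(LINT \<xi>|lborel. norm (component (hat j) i \<xi>)) \<le> (LINT \<xi>|lborel. c j * bumps j \<xi>)"
    by (intro integral_mono integrable_norm integrable_schwartz hat_component_schwartz integrable_mult_right integrable_bumps norm_component_hat_le)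
  then show ?thesis by (simp add: integrable_bumps mult_ac)
qed

lemma component_hat_eq_0:
  assumes "hat j \<xi> \<noteq> 0" "m \<notin> {j}"
  shows "component (hat m) i \<xi> = 0"
proof -
  have "hat m \<xi> = 0"
    using hat_unique[OF assms(1), of m] assms(2) by blast
  then show ?thesis by (simp add: component_def)
qed

lemma summable_norm_component_hat: "summable (\<lambda>j. norm (component (hat j) i \<xi>))"
proof (cases "\<exists>j. hat j \<xi> \<noteq> 0")
  case True
  then obtain j where "hat j \<xi> \<noteq> 0" by blast
  from component_hat_eq_0[OF this, of _ i] show ?thesis
    by (intro summable_finite[of "{j}"]) simp_all
qed (simp add: component_def)

lemma summable_integral_component_hat: "summable (\<lambda>j. LINT \<xi>|lborel. norm (component (hat j) i \<xi>))"
  by (rule summable_comparison_test'[where g="\<lambda>j. 6 * (LINT \<xi>|lborel. chi \<xi>) * c j" and N=0])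
    (auto intro!: summable_mult summable_c integral_component_hat_le)

lemma integrable_component_U: "integrable lborel (component U i)"
  unfolding component_U_suminf[abs_def]
  by (intro integrable_suminf AE_I2 integrable_schwartz hat_component_schwartz summable_norm_component_hat summable_integral_component_hat)

lemma IFT_component_sums: "(\<lambda>j. IFT (component (hat j) i) x) sums IFT (component U i) x"
proof -
  have "(\<lambda>j. LINT \<xi>|lborel. cis (\<xi> \<bullet> x) * component (hat j) i \<xi>) sums (LINT \<xi>|lborel. (\<Sum>j. cis (\<xi> \<bullet> x) * component (hat j) i \<xi>))"
    by (intro sums_integral AE_I2 integrable_cis integrable_schwartz hat_component_schwartz)
      (simp_all add: norm_mult summable_norm_component_hat summable_integral_component_hat)
  then have "(\<lambda>j. (LINT \<xi>|lborel. cis (\<xi> \<bullet> x) * component (hat j) i \<xi>) / complex_of_real ((2 * pi) ^ 3)) sums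
    ((LINT \<xi>|lborel. (\<Sum>j. cis (\<xi> \<bullet> x) * component (hat j) i \<xi>)) / complex_of_real ((2 * pi) ^ 3))"
    by (rule sums_divide)
  moreover have "(\<Sum>j. cis (\<xi> \<bullet> x) * component (hat j) i \<xi>) = cis (\<xi> \<bullet> x) * component U i \<xi>" for \<xi>
    by (simp add: component_U_suminf suminf_mult[OF sums_summable[OF component_sums]])
  ultimately show ?thesis
    by (simp add: IFT_def inner_commute)
qed

text \<open>\<open>U\<close> is real and even, so its inverse transform is real and
  \<open>Re\<close> in the definition of \<open>u\<close> discards nothing.\<close>

lemma component_u: "component u i = IFT (component U i)"
proof
  fix x
  show "component u i x = IFT (component U i) x"
    using cnj_IFT_real[OF integrable_component_U, of i x] by (simp add: component_def u_def U_even)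
qed

lemma norm_component_u_le: "norm (component u i x) \<le> (\<Sum>j. c j) * dom x"
proof -
  have s: "summable (\<lambda>j. c j * dom x)" by (intro summable_mult2 summable_c)
  then have "summable (\<lambda>j. norm (IFT (component (hat j) i) x))"
    by (rule summable_comparison_test'[where N=0]) (simp add: IFT_hat_le)
  then have "norm (\<Sum>j. IFT (component (hat j) i) x) \<le> (\<Sum>j. c j * dom x)"
    by (intro order_trans[OF summable_norm] suminf_le IFT_hat_le s)
  then show ?thesis
    using IFT_component_sums by (simp add: component_u sums_iff suminf_mult2[OF summable_c])
qed

lemma continuous_component_u: "continuous_on UNIV (component u i)"
  unfolding component_u by (rule IFT_continuous[OF integrable_component_U])

lemma measurable_component_u [measurable]: "component u i \<in> borel_measurable borel"
  by (rule borel_measurable_continuous_onI[OF continuous_component_u])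

lemma integrable_component_u: "integrable lborel (component u i)"
  by (rule Bochner_Integration.integrable_bound[OF integrable_mult_right[OF integrable_dom, of "\<Sum>j. c j"]])
    (auto intro!: AE_I2 order_trans[OF norm_component_u_le])

lemma measurable_u [measurable]: "u \<in> borel_measurable borel"
proof -
  have "(\<lambda>x. u x $ i) \<in> borel_measurable borel" for i
  proof -
    have "(\<lambda>x. Re (component u i x)) \<in> borel_measurable borel" by measurable
    then show ?thesis by (simp add: component_def)
  qed
  then have "\<forall>b\<in>Basis. (\<lambda>x. u x \<bullet> b) \<in> borel_measurable borel"
    by (auto simp: Basis_vec_def inner_axis)
  then show ?thesis
    by (simp add: borel_measurable_euclidean_space[symmetric])
qed

lemma component_u_bounded: "\<exists>B. \<forall>x. norm (component u i x) \<le> B"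
  unfolding component_u using IFT_bound by blast

lemma integrable_component_u_mult: "integrable lborel (\<lambda>x. component u i x * component u m x)"
proof -
  obtain B where "\<And>x. norm (component u i x) \<le> B" using component_u_bounded by blast
  then show ?thesis
    by (rule integrable_bounded_mult(1)[OF integrable_component_u measurable_component_u])
qed

lemma integrable_norm_u_sq: "integrable lborel (\<lambda>x. (norm (u x))\<^sup>2)"
proof -
  have "integrable lborel (\<lambda>x. \<Sum>i\<in>UNIV. Re (component u i x * component u i x))"
    by (intro Bochner_Integration.integrable_sum integrable_Re integrable_component_u_mult)
  moreover have "(\<Sum>i\<in>UNIV. Re (component u i x * component u i x)) = (norm (u x))\<^sup>2" for x
    by (simp add: component_def norm_vec_def L2_set_def sum_nonneg power2_eq_square)
  ultimately show ?thesis by simp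
qed

text \<open>Inversion holds packet by packet, where the functions are Schwartz; the summable
  majorants \<open>c j * dom x\<close> allow the transform of the series to be taken term by
  term.\<close>

lemma FT_component_u: "FT (component u i) = component U i"
proof
  fix \<xi>
  let ?f = "\<lambda>j x. cis (- (x \<bullet> \<xi>)) * IFT (component (hat j) i) x"
  have le: "(LINT x|lborel. norm (?f j x)) \<le> (LINT x|lborel. dom x) * c j" for j
  proof -
    have "(LINT x|lborel. norm (?f j x)) \<le> (LINT x|lborel. c j * dom x)"
      by (intro integral_mono integrable_norm integrable_cis_minus integrable_IFT_schwartz hat_component_schwartz integrable_mult_right integrable_dom)
        (simp add: norm_mult IFT_hat_le)
    then show ?thesis by (simp add: mult.commute)
  qed
  have "(\<lambda>j. LINT x|lborel. ?f j x) sums (LINT x|lborel. (\<Sum>j. ?f j x))"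
  proof (intro sums_integral AE_I2)
    show "summable (\<lambda>j. norm (?f j x))" for x
      by (rule summable_comparison_test'[where g="\<lambda>j. c j * dom x" and N=0])
        (auto simp: norm_mult IFT_hat_le intro!: summable_mult2 summable_c)
    show "summable (\<lambda>j. LINT x|lborel. norm (?f j x))"
      by (rule summable_comparison_test'[where g="\<lambda>j. (LINT x|lborel. dom x) * c j" and N=0])
        (use le in \<open>auto intro!: summable_mult summable_c\<close>)
  qed (intro integrable_cis_minus integrable_IFT_schwartz hat_component_schwartz)
  moreover have "(LINT x|lborel. ?f j x) = component (hat j) i \<xi>" for j
    using FT_IFT_schwartz[OF hat_component_schwartz, of j i] by (simp add: FT_def fun_eq_iff)
  moreover have "(\<Sum>j. ?f j x) = cis (- (x \<bullet> \<xi>)) * component u i x" for x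
    by (simp add: component_u suminf_mult[OF sums_summable[OF IFT_component_sums]] sums_unique[OF IFT_component_sums])
  ultimately have "(\<lambda>j. component (hat j) i \<xi>) sums FT (component u i) \<xi>"
    by (simp add: FT_def)
  then show "FT (component u i) \<xi> = component U i \<xi>"
    using component_sums sums_unique2 by blast
qed

section \<open>Regularity of the vector field\<close>

lemma has_FT_u: "has_FT (vec_distr u i) (component U i)"
  unfolding vec_distr_def FT_component_u[symmetric] by (rule has_FT_distr_of[OF integrable_component_u])

text \<open>\<open>L j\<close> is itself a power of 2. Hence either
  \<open>2 * L j \<le> 2 ^ m\<close>, and the argument of \<open>chi\<close> has norm at most 1 / 2,
  or \<open>2 ^ m \<le> L j\<close>, and its norm exceeds \<open>r\<close>. No dyadic cutoff has its
  transition inside a shell.\<close>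

lemma chi_dyadic:
  assumes "r * L j < norm \<xi>" "norm \<xi> < L j"
  shows "chi (\<xi> /\<^sub>R 2 ^ m) = (if 2 * (j + n0) < m then 1 else 0)"
proof (cases "2 * (j + n0) < m")
  case True
  have "2 * L j = 2 ^ Suc (2 * (j + n0))"
    by (simp add: L_eq)
  also have "\<dots> \<le> (2::real) ^ m"
    using True by (intro power_increasing) auto
  finally have "norm (\<xi> /\<^sub>R 2 ^ m) \<le> 1 / 2"
    using assms by (simp add: divide_simps)
  then show ?thesis using chi_facts(2) True by simp
next
  case False
  then have "(2::real) ^ m \<le> 2 ^ (2 * (j + n0))"
    by (intro power_increasing) auto
  also have "\<dots> = L j"
    by (simp add: L_eq)
  finally have "r * 2 ^ m \<le> r * L j"
    using r by (intro mult_left_mono) auto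
  then have "r < norm (\<xi> /\<^sub>R 2 ^ m)"
    using assms by (simp add: divide_simps)
  then show ?thesis using chi_eq_0 False by simp
qed

text \<open>The symbol of block \<open>n\<close> is a difference of two consecutive cutoffs, and
  these differ on packet \<open>j\<close> only if \<open>2 ^ n = L j\<close>. Odd blocks and blocks
  below \<open>2 * n0\<close> are therefore empty.\<close>

lemma lp_symbol_component_U:
  "component U i \<xi> * complex_of_real (lp_symbol chi (- 1) \<xi>) = 0"
  "n = 2 * (j + n0) \<Longrightarrow> component U i \<xi> * complex_of_real (lp_symbol chi (int n) \<xi>) = component (hat j) i \<xi>"
  "(\<And>j. n \<noteq> 2 * (j + n0)) \<Longrightarrow> component U i \<xi> * complex_of_real (lp_symbol chi (int n) \<xi>) = 0"
proof -
  have s: "lp_symbol chi (int n) \<xi> = (if n = 2 * (j + n0) then 1 else 0)" "lp_symbol chi (- 1) \<xi> = 0"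
    if "hat j \<xi> \<noteq> 0" for j n
  proof -
    note d = chi_dyadic[OF hat_shell(2,3)[OF that]]
    have "lp_symbol chi (int n) \<xi> = chi (\<xi> /\<^sub>R 2 ^ Suc n) - chi (\<xi> /\<^sub>R 2 ^ n)"
      by (simp add: lp_symbol_def lp_phi_def power_int_of_nat)
    then show "lp_symbol chi (int n) \<xi> = (if n = 2 * (j + n0) then 1 else 0)"
      unfolding d by auto
    show "lp_symbol chi (- 1) \<xi> = 0"
      using d[of 0] by (simp add: lp_symbol_def)
  qed
  show "component U i \<xi> * complex_of_real (lp_symbol chi (- 1) \<xi>) = 0"
    by (rule U_cases[of \<xi>]) (auto simp: s component_def)
  show "component U i \<xi> * complex_of_real (lp_symbol chi (int n) \<xi>) = component (hat j) i \<xi>" if n: "n = 2 * (j + n0)"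
  proof (rule U_cases[of \<xi>])
    fix m assume m: "U \<xi> = hat m \<xi>" "hat m \<xi> \<noteq> 0"
    show ?thesis
    proof (cases "m = j")
      case True
      then show ?thesis using m s(1)[OF m(2), of n] n by (simp add: component_def)
    next
      case False
      then have "hat j \<xi> = 0" using hat_unique m by blast
      then show ?thesis using m s(1)[OF m(2), of n] n False by (simp add: component_def)
    qed
  qed (simp add: component_def)
  show "component U i \<xi> * complex_of_real (lp_symbol chi (int n) \<xi>) = 0" if "\<And>j. n \<noteq> 2 * (j + n0)"
    by (rule U_cases[of \<xi>]) (use that in \<open>auto simp: s component_def\<close>)
qed

lemma integrable_dom_cube: "integrable lborel (\<lambda>x. dom x ^ 3)"
proof -
  obtain B where B: "\<And>x. dom x \<le> B" using dom_bounded by blast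
  show ?thesis
  proof (rule Bochner_Integration.integrable_bound[OF integrable_mult_right[OF integrable_dom, of "B\<^sup>2"]])
    have "dom x ^ 3 \<le> B\<^sup>2 * dom x" for x
      unfolding power3_eq_cube power2_eq_square using B[of x] dom_nonneg[of x] by (intro mult_mono) auto
    then show "AE x in lborel. norm (dom x ^ 3) \<le> norm (B\<^sup>2 * dom x)"
      using dom_nonneg by (intro AE_I2) (simp add: abs_mult)
  qed measurable
qed

lemma distr_Lp_norm_le: "represents g T \<Longrightarrow> distr_Lp_norm p T \<le> Lp_norm p g"
  unfolding distr_Lp_norm_def by (rule INF_lower) simp

lemma Lp_norm_zero: "Lp_norm 3 (\<lambda>x. 0) = 0"
  by (simp add: Lp_norm_def)

lemma IFT_zero: "IFT (\<lambda>\<xi>. 0) = (\<lambda>x. 0)"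
  by (rule ext) (simp add: IFT_def)

text \<open>Each block is a single packet or zero, so the norm reduces to \<open>IFT_hat_le\<close>;
  with \<open>2 ^ n = L j\<close> the Besov weight cancels \<open>c j\<close> exactly.\<close>

lemma besov_u: "vec_distr u i \<in> besov chi (2 / 3) 3"
proof -
  let ?T = "vec_distr u i"
  let ?K = "(LINT x|lborel. dom x ^ 3) powr (1 / 3)"
  have t: "tempered ?T"
    unfolding vec_distr_def by (rule tempered_distr_of[OF integrable_component_u])
  have b: "distr_Lp_norm 3 (lp_block chi q ?T) \<le> Lp_norm 3 (IFT (\<lambda>\<xi>. component U i \<xi> * complex_of_real (lp_symbol chi q \<xi>)))" for q
    by (rule distr_Lp_norm_le[OF has_FT_block(3)[OF chi has_FT_u]])
  have "distr_Lp_norm 3 (lp_block chi (- 1) ?T) \<le> 0"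
    using b[of "- 1"] by (simp add: lp_symbol_component_U IFT_zero Lp_norm_zero)
  moreover have "ennreal ((2 ^ n) powr (2 / 3)) * distr_Lp_norm 3 (lp_block chi (int n) ?T) \<le> ennreal ?K" for n
  proof (cases "\<exists>j. n = 2 * (j + n0)")
    case True
    then obtain j where n: "n = 2 * (j + n0)" by blast
    have "distr_Lp_norm 3 (lp_block chi (int n) ?T) \<le> Lp_norm 3 (IFT (component (hat j) i))"
      using b[of "int n"] by (simp add: lp_symbol_component_U(2)[OF n])
    also have "\<dots> \<le> ennreal (c j * ?K)"
      using c_pos[of j] by (intro Lp_norm_le IFT_measurable integrable_schwartz hat_component_schwartz integrable_dom_cube dom_nonneg IFT_hat_le) auto
    finally have "ennreal ((2 ^ n) powr (2 / 3)) * distr_Lp_norm 3 (lp_block chi (int n) ?T) \<le> ennreal ((2 ^ n) powr (2 / 3)) * ennreal (c j * ?K)"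
      by (rule mult_left_mono) auto
    also have "\<dots> = ennreal ((2 ^ n) powr (2 / 3) * c j * ?K)"
      using c_pos[of j] by (simp add: ennreal_mult[symmetric] mult.assoc)
    also have "(2 ^ n) powr (2 / 3) * c j = 1"
    proof -
      have "(2::real) ^ n = L j" by (simp add: n L_eq)
      then show ?thesis
        unfolding c_def using L_ge(3)[of j] by (simp flip: powr_add)
    qed
    finally show ?thesis by simp
  next
    case False
    then have z: "component U i \<xi> * complex_of_real (lp_symbol chi (int n) \<xi>) = 0" for \<xi>
      by (intro lp_symbol_component_U(3)) auto
    have "distr_Lp_norm 3 (lp_block chi (int n) ?T) \<le> 0"
      using b[of "int n"] unfolding z IFT_zero Lp_norm_zero .
    then show ?thesis by simp
  qed
  ultimately have "besov_norm chi (2 / 3) 3 ?T \<le> 0 + ennreal ?K"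
    unfolding besov_norm_def by (intro add_mono SUP_least)
  then have "besov_norm chi (2 / 3) 3 ?T < \<infinity>"
    by (simp add: le_less_trans)
  then show ?thesis using t by (simp add: besov_def)
qed

lemma represents_U: "represents (component U i) (distr_FT (vec_distr u i))"
  unfolding represents_def
proof (intro conjI ballI)
  fix \<phi> assume p: "\<phi> \<in> schwartz"
  obtain B where B: "\<And>x. norm (\<phi> x) \<le> B" using schwartz_bounded[OF p] by blast
  show "integrable lborel (\<lambda>\<xi>. component U i \<xi> * \<phi> \<xi>)"
    by (rule integrable_bounded_mult(2)[OF integrable_component_U schwartz_measurable[OF p] B])
  show "distr_FT (vec_distr u i) \<phi> = distr_of (component U i) \<phi>"
    using FT_multiplication[OF integrable_component_u[of i] integrable_schwartz[OF p]]
    by (simp add: distr_FT_def vec_distr_def distr_of_def FT_component_u)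
qed measurable

text \<open>The packets have disjoint supports, so the squared modulus of \<open>U\<close> is the
  sum of theirs. On packet \<open>j\<close> the weight is at most \<open>2 * L j\<close>; of the two
  factors \<open>bumps\<close> one is bounded and the other integrated, which leaves the series of
  \<open>L j * c j * c j\<close>.\<close>

lemma integrable_weighted_U:
  "integrable lborel (\<lambda>\<xi>. (1 + (norm \<xi>)\<^sup>2) powr (1 / 2) * (norm (component U i \<xi>))\<^sup>2)"
proof -
  obtain B where B: "\<And>\<xi>. chi \<xi> \<le> B" "0 < B"
    using lp_cutoff_bounded[OF chi] by blast
  let ?f = "\<lambda>j \<xi>. (1 + (norm \<xi>)\<^sup>2) powr (1 / 2) * (norm (component (hat j) i \<xi>))\<^sup>2"
  have bumps_le: "bumps j \<xi> \<le> 6 * B" for j \<xi>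
  proof -
    have "bumps j \<xi> \<le> (\<Sum>t\<in>(UNIV::3 set). B + B)"
      unfolding bumps_def by (intro sum_mono add_mono B)
    then show ?thesis by simp
  qed
  have le: "?f j \<xi> \<le> (12 * B) * (L j * c j * c j) * bumps j \<xi>" for j \<xi>
  proof (cases "hat j \<xi> = 0")
    case True
    have "0 \<le> (12 * B) * (L j * c j * c j) * bumps j \<xi>"
      using c_pos[of j] L_ge(3)[of j] B(2) bumps_nonneg[of j \<xi>] by (intro mult_nonneg_nonneg) auto
    then show ?thesis using True by (simp add: component_def)
  next
    case False
    have "(1 + (norm \<xi>)\<^sup>2) powr (1 / 2) \<le> ((1 + norm \<xi>)\<^sup>2) powr (1 / 2)"
      by (intro powr_mono2) (auto simp: power2_sum)
    also have "\<dots> = 1 + norm \<xi>"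
      by (simp add: powr_half_sqrt)
    also have "\<dots> \<le> 2 * L j"
      using hat_shell(3)[OF False] L_ge(2)[of j] by linarith
    finally have w: "(1 + (norm \<xi>)\<^sup>2) powr (1 / 2) \<le> 2 * L j" .
    have "(norm (component (hat j) i \<xi>))\<^sup>2 \<le> (c j * bumps j \<xi>) * (c j * bumps j \<xi>)"
      unfolding power2_eq_square using c_pos[of j] bumps_nonneg[of j \<xi>] by (intro mult_mono norm_component_hat_le) auto
    also have "\<dots> \<le> (c j * (6 * B)) * (c j * bumps j \<xi>)"
      using c_pos[of j] bumps_nonneg[of j \<xi>] by (intro mult_right_mono mult_left_mono bumps_le) auto
    finally have "?f j \<xi> \<le> (2 * L j) * ((c j * (6 * B)) * (c j * bumps j \<xi>))"
      using w L_ge(3)[of j] by (intro mult_mono) auto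
    then show ?thesis by (simp add: mult_ac)
  qed
  have i: "integrable lborel (?f j)" for j
  proof (rule Bochner_Integration.integrable_bound[OF integrable_mult_right[OF integrable_bumps(1), of "(12 * B) * (L j * c j * c j)" j]])
    show "AE \<xi> in lborel. norm (?f j \<xi>) \<le> norm ((12 * B) * (L j * c j * c j) * bumps j \<xi>)"
    proof (rule AE_I2)
      fix \<xi>
      have "norm (?f j \<xi>) = ?f j \<xi>" by simp
      also have "\<dots> \<le> (12 * B) * (L j * c j * c j) * bumps j \<xi>" by (rule le)
      also have "\<dots> \<le> norm \<dots>" by simp
      finally show "norm (?f j \<xi>) \<le> norm ((12 * B) * (L j * c j * c j) * bumps j \<xi>)" .
    qed
  qed measurable
  have "integrable lborel (\<lambda>\<xi>. \<Sum>j. ?f j \<xi>)"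
  proof (intro integrable_suminf AE_I2 i)
    show "summable (\<lambda>j. norm (?f j \<xi>))" for \<xi>
    proof (rule U_cases[of \<xi>])
      fix j assume "hat j \<xi> \<noteq> 0"
      from component_hat_eq_0[OF this, of _ i] show ?thesis
        by (intro summable_finite[of "{j}"]) simp_all
    qed (simp add: component_def)
    have "(LINT \<xi>|lborel. norm (?f j \<xi>)) \<le> ((12 * B) * (6 * (LINT \<xi>|lborel. chi \<xi>))) * (L j * c j * c j)" for j
    proof -
      have "(LINT \<xi>|lborel. norm (?f j \<xi>)) \<le> (LINT \<xi>|lborel. (12 * B) * (L j * c j * c j) * bumps j \<xi>)"
        by (intro integral_mono integrable_norm i integrable_mult_right integrable_bumps) (simp add: le)
      then show ?thesis by (simp add: integrable_bumps mult_ac)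
    qed
    note le_int = this
    define X where "X j = (LINT \<xi>|lborel. norm (?f j \<xi>))" for j
    have "0 \<le> X j" for j
      unfolding X_def by (rule Bochner_Integration.integral_nonneg) simp
    then have "norm (X j) \<le> ((12 * B) * (6 * (LINT \<xi>|lborel. chi \<xi>))) * (L j * c j * c j)" for j
      using le_int[of j, folded X_def] by (simp only: real_norm_def abs_of_nonneg)
    then show "summable (\<lambda>j. LINT \<xi>|lborel. norm (?f j \<xi>))"
      unfolding X_def
      by (rule summable_comparison_test'[where N=0, OF summable_mult[OF summable_Lcc]])
  qed
  moreover have "(\<Sum>j. ?f j \<xi>) = (1 + (norm \<xi>)\<^sup>2) powr (1 / 2) * (norm (component U i \<xi>))\<^sup>2" for \<xi>
  proof (rule U_cases[of \<xi>])
    fix j assume j: "U \<xi> = hat j \<xi>" "hat j \<xi> \<noteq> 0"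
    have "(\<Sum>j. ?f j \<xi>) = (\<Sum>j\<in>{j}. ?f j \<xi>)"
      by (intro suminf_finite) (simp_all add: component_hat_eq_0[OF j(2), of _ i])
    then show ?thesis using j by (simp add: component_def)
  qed (simp add: component_def)
  ultimately show ?thesis by simp
qed

lemma sobolev_u: "vec_distr u i \<in> sobolev (1 / 2)"
  unfolding sobolev_def vec_distr_def[of u i, symmetric]
  using tempered_distr_of[OF integrable_component_u[of i]] represents_U[of i] integrable_weighted_U[of i]
  by (auto simp: vec_distr_def)

lemma inner_U: "\<xi> \<bullet> U \<xi> = 0"
  by (rule U_cases[of \<xi>]) (auto simp: hat_def dot_cross_self)

text \<open>Transferred to Fourier space, the pairing with a test function contains the factor
  \<open>\<xi> \<bullet> U \<xi>\<close>, which vanishes because \<open>hat\<close> is a cross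
  product with \<open>\<xi>\<close>.\<close>

lemma divergence_free_u: "divergence_free (vec_distr u)"
  unfolding divergence_free_def
proof
  fix \<phi> assume p: "\<phi> \<in> schwartz"
  let ?c = "complex_of_real ((2 * pi) ^ 3)"
  obtain B where B: "\<And>x. norm (FT \<phi> x) \<le> B" using FT_bound by blast
  note pi = integrable_schwartz[OF schwartz_partial[OF p]]
  have "distr_partial i (vec_distr u i) \<phi> = (LINT \<xi>|lborel. component U i \<xi> * - IFT (partial i \<phi>) \<xi>)" for i
    using IFT_multiplication[OF integrable_component_U[of i] pi[of i]]
    by (simp add: distr_partial_def vec_distr_def distr_of_def component_u)
  then have "(\<Sum>i\<in>UNIV. distr_partial i (vec_distr u i) \<phi>) = (\<Sum>i\<in>UNIV. (LINT \<xi>|lborel. component U i \<xi> * - IFT (partial i \<phi>) \<xi>))"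
    by simp
  also have "\<dots> = (LINT \<xi>|lborel. (\<Sum>i\<in>UNIV. component U i \<xi> * - IFT (partial i \<phi>) \<xi>))"
  proof (rule Bochner_Integration.integral_sum[symmetric])
    fix i
    have "integrable lborel (\<lambda>\<xi>. - (component U i \<xi> * IFT (partial i \<phi>) \<xi>))"
      by (intro Bochner_Integration.integrable_minus integrable_bounded_mult(2)[OF integrable_component_U IFT_measurable[OF pi] IFT_bound])
    then show "integrable lborel (\<lambda>\<xi>. component U i \<xi> * - IFT (partial i \<phi>) \<xi>)"
      by simp
  qed
  also have "\<dots> = (LINT \<xi>|lborel. of_real (\<xi> \<bullet> U \<xi>) * (\<i> * FT \<phi> (- \<xi>) / ?c))"
    by (intro Bochner_Integration.integral_cong refl)
      (simp add: IFT_eq_FT FT_partial p component_def inner_vec_def sum_distrib_right sum_distrib_left sum_divide_distrib mult_ac)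
  finally show "(\<Sum>i\<in>UNIV. distr_partial i (vec_distr u i) \<phi>) = 0"
    by (simp add: inner_U)
qed

end

section \<open>The flux as a trilinear integral in Fourier space\<close>

text \<open>The pointwise Fourier form of the splitting of the convective term into (vorticity x
  velocity) and the gradient of |u|^2 / 2. With \<open>a\<close>, \<open>b\<close>, \<open>e\<close>
  in the roles of \<open>U (\<xi> - \<zeta>)\<close>, \<open>U \<zeta>\<close> and the truncated
  field, each of the two parts of the flux density yields (velocity x vorticity) against the
  truncated vorticity, the first one up to the gradient term. The triple product expansion handles
  the first part, the Binet-Cauchy identity the second.\<close>

lemma trilinear_identity:
  fixes p q a b e :: R3
  assumes "p \<bullet> a = 0"
  defines "x \<equiv> p + q"
  shows "(\<Sum>i\<in>UNIV. \<Sum>m\<in>UNIV. - (a $ i * b $ m * (x $ i * cross3 x e $ m))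
     + (a $ i * cross3 q b $ m - cross3 q b $ i * a $ m) * (x $ i * e $ m))
    = 2 * (cross3 a (cross3 q b) \<bullet> cross3 x e) - (a \<bullet> b) * (q \<bullet> cross3 x e)"
proof -
  let ?w = "cross3 q b" and ?z = "cross3 x e"
  have bilin: "(\<Sum>i\<in>UNIV. \<Sum>m\<in>UNIV. (f $ i * g $ i) * (f' $ m * g' $ m)) = (f \<bullet> g) * (f' \<bullet> g')" for f g f' g' :: R3
    by (simp add: inner_vec_def sum_product)
  have "(\<Sum>i\<in>UNIV. \<Sum>m\<in>UNIV. - (a $ i * b $ m * (x $ i * ?z $ m)) + (a $ i * ?w $ m - ?w $ i * a $ m) * (x $ i * e $ m))
    = (\<Sum>i\<in>UNIV. \<Sum>m\<in>UNIV. - ((a $ i * x $ i) * (b $ m * ?z $ m)) + ((a $ i * x $ i) * (?w $ m * e $ m) - (?w $ i * x $ i) * (a $ m * e $ m)))"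
    by (intro sum.cong refl) (simp add: algebra_simps)
  also have "\<dots> = - ((a \<bullet> x) * (b \<bullet> ?z)) + ((a \<bullet> x) * (?w \<bullet> e) - (?w \<bullet> x) * (a \<bullet> e))"
    by (simp only: sum.distrib sum_negf sum_subtractf bilin)
  also have "(a \<bullet> x) * (?w \<bullet> e) - (?w \<bullet> x) * (a \<bullet> e) = cross3 a ?w \<bullet> ?z"
    unfolding dot_cross by (simp add: mult.commute)
  also have "a \<bullet> x = a \<bullet> q"
    using assms by (simp add: inner_add_right inner_commute)
  also have "- ((a \<bullet> q) * (b \<bullet> ?z)) = cross3 a ?w \<bullet> ?z - (a \<bullet> b) * (q \<bullet> ?z)"
    unfolding Lagrange by (simp add: inner_diff_left)
  finally show ?thesis by simp
qed

context flux_example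
begin

definition W :: "R3 \<Rightarrow> R3" where "W \<xi> = cross3 \<xi> (U \<xi>)"

text \<open>The H^(1/2) density, with \<open>1 + norm \<xi>\<close> in place of the equivalent
  \<open>(1 + (norm \<xi>)\<^sup>2) powr (1 / 2)\<close>.\<close>

definition weight :: "R3 \<Rightarrow> real" where "weight \<xi> = (1 + norm \<xi>) * (norm (U \<xi>))\<^sup>2"

lemma measurable_cross3 [measurable]:
  assumes [measurable]: "f \<in> borel_measurable M" "g \<in> borel_measurable M"
  shows "(\<lambda>x. cross3 (f x) (g x)) \<in> borel_measurable M"
proof -
  have "continuous_on UNIV (\<lambda>p::R3 \<times> R3. cross3 (fst p) (snd p))"
    by (intro continuous_on_cross continuous_intros)
  from borel_measurable_continuous_Pair[OF assms this] show ?thesis by simp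
qed

lemma measurable_W [measurable]: "W \<in> borel_measurable borel"
  unfolding W_def[abs_def] by measurable

lemma measurable_weight [measurable]: "weight \<in> borel_measurable borel"
  unfolding weight_def[abs_def] by measurable

lemma norm_W_le: "norm (W \<xi>) \<le> norm \<xi> * norm (U \<xi>)"
  unfolding W_def by (rule norm_cross3_le)

lemma weight_nonneg: "0 \<le> weight \<xi>"
  by (simp add: weight_def)

lemma integrable_weight: "integrable lborel weight"
proof (rule Bochner_Integration.integrable_bound)
  show "integrable lborel (\<lambda>\<xi>. \<Sum>i\<in>UNIV. 2 * ((1 + (norm \<xi>)\<^sup>2) powr (1 / 2) * (norm (component U i \<xi>))\<^sup>2))"
    by (intro Bochner_Integration.integrable_sum integrable_mult_right integrable_weighted_U)
  show "AE \<xi> in lborel. norm (weight \<xi>) \<le> norm (\<Sum>i\<in>UNIV. 2 * ((1 + (norm \<xi>)\<^sup>2) powr (1 / 2) * (norm (component U i \<xi>))\<^sup>2))"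
  proof (rule AE_I2)
    fix \<xi>
    have n: "(norm (U \<xi>))\<^sup>2 = (\<Sum>i\<in>UNIV. (norm (component U i \<xi>))\<^sup>2)"
      by (simp add: norm_vec_def L2_set_def sum_nonneg component_def)
    have "1 \<le> sqrt (1 + (norm \<xi>)\<^sup>2)" "norm \<xi> \<le> sqrt (1 + (norm \<xi>)\<^sup>2)"
      by (auto intro: real_le_rsqrt)
    then have "1 + norm \<xi> \<le> 2 * (1 + (norm \<xi>)\<^sup>2) powr (1 / 2)"
    proof -
      have "(1 + (norm \<xi>)\<^sup>2) powr (1 / 2) = sqrt (1 + (norm \<xi>)\<^sup>2)" by (simp add: powr_half_sqrt)
      with \<open>1 \<le> sqrt (1 + (norm \<xi>)\<^sup>2)\<close> \<open>norm \<xi> \<le> sqrt (1 + (norm \<xi>)\<^sup>2)\<close> show ?thesis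
        by linarith
    qed
    then have "weight \<xi> \<le> (2 * (1 + (norm \<xi>)\<^sup>2) powr (1 / 2)) * (\<Sum>i\<in>UNIV. (norm (component U i \<xi>))\<^sup>2)"
      unfolding weight_def n by (intro mult_right_mono sum_nonneg) auto
    also have "\<dots> = (\<Sum>i\<in>UNIV. 2 * ((1 + (norm \<xi>)\<^sup>2) powr (1 / 2) * (norm (component U i \<xi>))\<^sup>2))"
      by (simp add: sum_distrib_left mult.assoc)
    finally show "norm (weight \<xi>) \<le> norm (\<Sum>i\<in>UNIV. 2 * ((1 + (norm \<xi>)\<^sup>2) powr (1 / 2) * (norm (component U i \<xi>))\<^sup>2))"
      using weight_nonneg[of \<xi>] by (simp only: real_norm_def abs_of_nonneg)
  qed
qed measurable

text \<open>Here H^(1/2) regularity pays for the derivative in the vorticity. For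
  \<open>\<xi>\<close> in a ball, \<open>1 + norm \<zeta>\<close> is at most a constant times
  \<open>1 + norm (\<xi> - \<zeta>)\<close>; after a b \<le> a^2 + b^2 the derivative can thus be
  placed on whichever factor is squared, and each term is an integrable
  \<open>weight\<close>.\<close>

lemma integrable_conv_bound:
  "integrable (lborel \<Otimes>\<^sub>M lborel) (\<lambda>(\<zeta>, \<xi>). indicator (cball 0 R) \<xi> * ((1 + norm \<zeta>) * norm (U \<zeta>) * norm (U (\<xi> - \<zeta>))))"
proof -
  let ?I = "\<lambda>\<xi>::R3. indicator (cball 0 R) \<xi> :: real"
  have I: "integrable lborel ?I"
    by (intro integrable_real_indicator emeasure_lborel_cball_finite) auto
  have cb[measurable]: "cball (0::R3) R \<in> sets borel" by simp
  have 1: "integrable (lborel \<Otimes>\<^sub>M lborel) (\<lambda>(\<zeta>, \<xi>). ?I \<xi> * weight \<zeta>)"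
  proof (rule lborel_pair.Fubini_integrable)
    show "integrable lborel (\<lambda>\<zeta>. LINT \<xi>|lborel. norm (case (\<zeta>, \<xi>) of (\<zeta>, \<xi>) \<Rightarrow> ?I \<xi> * weight \<zeta>))"
      using integrable_weight by (simp add: abs_mult)
    show "AE \<zeta> in lborel. integrable lborel (\<lambda>\<xi>. case (\<zeta>, \<xi>) of (\<zeta>, \<xi>) \<Rightarrow> ?I \<xi> * weight \<zeta>)"
      using I by simp
  qed measurable
  have w: "integrable lborel (\<lambda>\<zeta>. weight (\<xi> - \<zeta>))" "(LINT \<zeta>|lborel. weight (\<xi> - \<zeta>)) = (LINT \<zeta>|lborel. weight \<zeta>)" for \<xi>
    using integrable_affine_iff[of "- 1" weight \<xi>] integral_affine[of "- 1" weight \<xi>] integrable_weight by simp_all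
  have 2: "integrable (lborel \<Otimes>\<^sub>M lborel) (\<lambda>(\<xi>, \<zeta>). ?I \<xi> * weight (\<xi> - \<zeta>))"
  proof (rule lborel_pair.Fubini_integrable)
    show "integrable lborel (\<lambda>\<xi>. LINT \<zeta>|lborel. norm (case (\<xi>, \<zeta>) of (\<xi>, \<zeta>) \<Rightarrow> ?I \<xi> * weight (\<xi> - \<zeta>)))"
      using I weight_nonneg by (simp add: abs_mult w(2))
    show "AE \<xi> in lborel. integrable lborel (\<lambda>\<zeta>. case (\<xi>, \<zeta>) of (\<xi>, \<zeta>) \<Rightarrow> ?I \<xi> * weight (\<xi> - \<zeta>))"
      using w(1) by simp
  qed measurable
  have 2: "integrable (lborel \<Otimes>\<^sub>M lborel) (\<lambda>(\<zeta>, \<xi>). ?I \<xi> * weight (\<xi> - \<zeta>))"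
    using lborel_pair.integrable_product_swap[OF 2] by simp
  have "integrable (lborel \<Otimes>\<^sub>M lborel) (\<lambda>p. (1 + \<bar>R\<bar>) * ((\<lambda>(\<zeta>, \<xi>). ?I \<xi> * weight \<zeta>) p + (\<lambda>(\<zeta>, \<xi>). ?I \<xi> * weight (\<xi> - \<zeta>)) p))"
    by (intro integrable_mult_right Bochner_Integration.integrable_add 1 2)
  then show ?thesis
  proof (rule Bochner_Integration.integrable_bound)
    have "?I \<xi> * ((1 + norm \<zeta>) * norm (U \<zeta>) * norm (U (\<xi> - \<zeta>))) \<le> (1 + \<bar>R\<bar>) * (?I \<xi> * weight \<zeta> + ?I \<xi> * weight (\<xi> - \<zeta>))" for \<zeta> \<xi>
    proof (cases "norm \<xi> \<le> R")
      case True
      let ?a = "norm (U \<zeta>)" and ?b = "norm (U (\<xi> - \<zeta>))" and ?m = "1 + norm \<zeta>"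
      have "?m \<le> 1 + (norm \<xi> + norm (\<xi> - \<zeta>))"
        using norm_triangle_ineq4[of \<xi> "\<xi> - \<zeta>"] by simp
      also have "\<dots> \<le> (1 + \<bar>R\<bar>) * (1 + norm (\<xi> - \<zeta>))"
      proof -
        have "(1 + \<bar>R\<bar>) * (1 + norm (\<xi> - \<zeta>)) = 1 + norm (\<xi> - \<zeta>) + \<bar>R\<bar> + \<bar>R\<bar> * norm (\<xi> - \<zeta>)"
          by (simp add: algebra_simps)
        moreover have "0 \<le> \<bar>R\<bar> * norm (\<xi> - \<zeta>)" by simp
        ultimately show ?thesis using True by linarith
      qed
      finally have m: "?m \<le> (1 + \<bar>R\<bar>) * (1 + norm (\<xi> - \<zeta>))" .
      have "0 \<le> (?a - ?b)\<^sup>2" by simp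
      then have "2 * (?a * ?b) \<le> ?a\<^sup>2 + ?b\<^sup>2"
        by (simp add: power2_diff)
      then have ab: "?a * ?b \<le> ?a\<^sup>2 + ?b\<^sup>2"
        using mult_nonneg_nonneg[OF norm_ge_zero[of "U \<zeta>"] norm_ge_zero[of "U (\<xi> - \<zeta>)"]] by linarith
      have "?m * ?a * ?b \<le> ?m * (?a\<^sup>2 + ?b\<^sup>2)"
        using mult_left_mono[OF ab, of ?m] by (simp add: mult.assoc)
      also have "\<dots> = ?m * ?a\<^sup>2 + ?m * ?b\<^sup>2"
        by (simp add: distrib_left)
      also have "\<dots> \<le> (1 + \<bar>R\<bar>) * (?m * ?a\<^sup>2) + ((1 + \<bar>R\<bar>) * (1 + norm (\<xi> - \<zeta>))) * ?b\<^sup>2"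
      proof (intro add_mono mult_right_mono m)
        have "0 \<le> ?m * ?a\<^sup>2" by (intro mult_nonneg_nonneg add_nonneg_nonneg) auto
        then show "?m * ?a\<^sup>2 \<le> (1 + \<bar>R\<bar>) * (?m * ?a\<^sup>2)"
          using mult_right_mono[of 1 "1 + \<bar>R\<bar>" "?m * ?a\<^sup>2"] by simp
      qed simp
      also have "\<dots> = (1 + \<bar>R\<bar>) * (weight \<zeta> + weight (\<xi> - \<zeta>))"
        by (simp add: weight_def algebra_simps)
      finally show ?thesis using True by simp
    qed (simp add: indicator_def)
    then show "AE p in lborel \<Otimes>\<^sub>M lborel. norm (case p of (\<zeta>, \<xi>) \<Rightarrow> ?I \<xi> * ((1 + norm \<zeta>) * norm (U \<zeta>) * norm (U (\<xi> - \<zeta>))))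
      \<le> norm ((1 + \<bar>R\<bar>) * ((case p of (\<zeta>, \<xi>) \<Rightarrow> ?I \<xi> * weight \<zeta>) + (case p of (\<zeta>, \<xi>) \<Rightarrow> ?I \<xi> * weight (\<xi> - \<zeta>))))"
      by (intro AE_I2) (auto simp: abs_mult abs_of_nonneg weight_nonneg simp del: abs_mult_pos)
  qed measurable
qed

text \<open>The double integrals of the flux are compared with the preceding bound through this
  lemma; the radius \<open>R\<close> comes from a truncated factor or from the support of a test
  function.\<close>

lemma integrable_kernel:
  fixes a :: "R3 \<Rightarrow> R3 \<Rightarrow> 'b::{banach, second_countable_topology}"
  assumes [measurable]: "(\<lambda>(\<zeta>, \<xi>). a \<zeta> \<xi>) \<in> borel_measurable (borel \<Otimes>\<^sub>M borel)"
    and A: "\<And>\<zeta> \<xi>. norm \<xi> \<le> R \<Longrightarrow> norm (a \<zeta> \<xi>) \<le> A * ((1 + norm \<zeta>) * norm (U \<zeta>) * norm (U (\<xi> - \<zeta>)))"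
    and R: "\<And>\<zeta> \<xi>. R < norm \<xi> \<Longrightarrow> a \<zeta> \<xi> = 0"
  shows "integrable (lborel \<Otimes>\<^sub>M lborel) (\<lambda>(\<zeta>, \<xi>). a \<zeta> \<xi>)"
proof -
  let ?b = "\<lambda>\<zeta> \<xi>. (1 + norm \<zeta>) * norm (U \<zeta>) * norm (U (\<xi> - \<zeta>))"
  have "integrable (lborel \<Otimes>\<^sub>M lborel) (\<lambda>p. A * (\<lambda>(\<zeta>, \<xi>). indicator (cball 0 R) \<xi> * ?b \<zeta> \<xi>) p)"
    by (rule integrable_mult_right[OF integrable_conv_bound])
  then show ?thesis
  proof (rule Bochner_Integration.integrable_bound)
    have "norm (a \<zeta> \<xi>) \<le> norm (A * (indicator (cball 0 R) \<xi> * ?b \<zeta> \<xi>))" for \<zeta> \<xi>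
    proof (cases "norm \<xi> \<le> R")
      case True
      have "A * ?b \<zeta> \<xi> \<le> norm (A * ?b \<zeta> \<xi>)" by (metis abs_ge_self real_norm_def)
      then have "norm (a \<zeta> \<xi>) \<le> norm (A * ?b \<zeta> \<xi>)"
        using A[OF True] order_trans by blast
      then show ?thesis using True by simp
    qed (use R in simp)
    then show "AE p in lborel \<Otimes>\<^sub>M lborel. norm (case p of (\<zeta>, \<xi>) \<Rightarrow> a \<zeta> \<xi>) \<le> norm (A * (case p of (\<zeta>, \<xi>) \<Rightarrow> indicator (cball 0 R) \<xi> * ?b \<zeta> \<xi>))"
      by (intro AE_I2) (simp add: split_beta)
  qed measurable
qed

subsection \<open>The Fourier transforms of the vorticity and of the products\<close>

lemma vorticity_eq: "vorticity u m = distr_diff (distr_partial (m + 1) (distr_of (component u (m + 2)))) (distr_partial (m + 2) (distr_of (component u (m + 1))))"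
  by (simp add: vorticity_def curl_def vec_distr_def)

lemma component_W: "\<i> * component W m \<xi> = \<i> * of_real (\<xi> $ (m + 1)) * component U (m + 2) \<xi> - \<i> * of_real (\<xi> $ (m + 2)) * component U (m + 1) \<xi>"
  by (simp add: W_def component_def cross3_component algebra_simps)

lemma has_FT_vorticity: "has_FT (vorticity u m) (\<lambda>\<xi>. \<i> * component W m \<xi>)"
  unfolding vorticity_eq component_W FT_component_u[symmetric]
  by (intro has_FT_distr_diff has_FT_distr_partial integrable_component_u)

text \<open>Complements \<open>has_FT_vorticity\<close>: the choice in
  \<open>sobolev_pairing\<close> refers to representation on all Schwartz functions, whereas
  \<open>has_FT\<close> tests with bounded functions of bounded support.\<close>

lemma represents_W: "represents (\<lambda>\<xi>. \<i> * component W m \<xi>) (distr_FT (vorticity u m))"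
  unfolding represents_def
proof (intro conjI ballI)
  fix \<phi> assume p: "\<phi> \<in> schwartz"
  note i = integrable_schwartz[OF p] integrable_weight_schwartz[OF p, of 2]
  note d = distr_partial_FT[OF integrable_component_u i, unfolded FT_component_u]
  show "integrable lborel (\<lambda>\<xi>. \<i> * component W m \<xi> * \<phi> \<xi>)"
    unfolding component_W left_diff_distrib by (intro Bochner_Integration.integrable_diff d(2))
  show "distr_FT (vorticity u m) \<phi> = distr_of (\<lambda>\<xi>. \<i> * component W m \<xi>) \<phi>"
    unfolding distr_FT_def vorticity_eq distr_diff_def d(1) component_W
    unfolding distr_of_def left_diff_distrib
    by (rule Bochner_Integration.integral_diff[symmetric]) (rule d(2))+
qed measurable

lemma has_FT_u_tensor_u:
  "has_FT (u_tensor_u u i m) (\<lambda>\<xi>. (LINT \<zeta>|lborel. component U m \<zeta> * component U i (\<xi> - \<zeta>)) / complex_of_real ((2 * pi) ^ 3))"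
proof -
  let ?c = "complex_of_real ((2 * pi) ^ 3)"
  have psi: "integrable lborel (\<lambda>\<eta>. component U m \<eta> / ?c)"
    by (intro integrable_divide_zero integrable_component_U)
  \<comment> \<open>Since \<open>U\<close> is even, its forward and inverse transforms agree up to
    \<open>(2 * pi) ^ 3\<close>. This presents the second factor as a transform, as
    \<open>FT_mult_FT\<close> expects.\<close>
  have um: "component u m = FT (\<lambda>\<eta>. component U m \<eta> / ?c)"
  proof
    fix x
    have "component u m x = FT (component U m) (- x) / ?c"
      by (simp add: component_u IFT_eq_FT)
    also have "FT (component U m) (- x) = FT (component U m) x"
      using integral_affine[of "-1" "\<lambda>\<xi>. cis (- (\<xi> \<bullet> x)) * component U m \<xi>" 0]
      by (simp add: FT_def component_def U_even)
    finally show "component u m x = FT (\<lambda>\<eta>. component U m \<eta> / ?c) x"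
      by (simp add: FT_def)
  qed
  have "FT (\<lambda>x. component u i x * component u m x) = (\<lambda>\<xi>. (LINT \<zeta>|lborel. component U m \<zeta> * component U i (\<xi> - \<zeta>)) / ?c)"
  proof
    fix \<xi>
    have "FT (\<lambda>x. component u i x * component u m x) \<xi> = FT (\<lambda>x. component u i x * FT (\<lambda>\<eta>. component U m \<eta> / ?c) x) (- (- \<xi>))"
      unfolding um[symmetric] by simp
    also have "\<dots> = (LINT \<eta>|lborel. component U m \<eta> / ?c * component U i (\<eta> - (- \<xi>)))"
      by (subst FT_mult_FT[OF integrable_component_u psi]) (simp only: FT_component_u)
    also have "\<dots> = (LINT \<eta>|lborel. component U m \<eta> * component U i (\<xi> + \<eta>)) / ?c"
      by (subst integral_divide_zero[symmetric]) (simp add: add.commute)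
    also have "(LINT \<eta>|lborel. component U m \<eta> * component U i (\<xi> + \<eta>)) = (LINT \<zeta>|lborel. component U m \<zeta> * component U i (\<xi> - \<zeta>))"
      using integral_affine[of "-1" "\<lambda>\<eta>. component U m \<eta> * component U i (\<xi> + \<eta>)" 0]
      by (simp add: component_def U_even)
    finally show "FT (\<lambda>x. component u i x * component u m x) \<xi> = (LINT \<zeta>|lborel. component U m \<zeta> * component U i (\<xi> - \<zeta>)) / ?c" .
  qed
  from this[symmetric] show ?thesis
    unfolding u_tensor_u_def by (simp only:) (rule has_FT_distr_of[OF integrable_component_u_mult])
qed

lemma has_FT_distr_prod_u:
  "has_FT (distr_prod (component u i) (vorticity u m))
    (\<lambda>\<eta>. (LINT \<zeta>|lborel. \<i> * component W m \<zeta> * component U i (\<eta> - \<zeta>)) / complex_of_real ((2 * pi) ^ 3))"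
proof -
  have "integrable (lborel \<Otimes>\<^sub>M lborel) (\<lambda>(\<zeta>, \<eta>). indicator (cball 0 R) \<eta> *\<^sub>R (\<i> * component W m \<zeta> * component U i (\<eta> - \<zeta>)))" for R
  proof (rule integrable_kernel[where A=1 and R=R])
    fix \<zeta> \<eta> :: R3
    have "norm (\<i> * component W m \<zeta> * component U i (\<eta> - \<zeta>)) \<le> ((1 + norm \<zeta>) * norm (U \<zeta>)) * norm (U (\<eta> - \<zeta>))"
      unfolding norm_mult
    proof (rule mult_mono)
      have "norm (component W m \<zeta>) \<le> norm (W \<zeta>)" by (rule norm_component_le)
      also have "\<dots> \<le> (1 + norm \<zeta>) * norm (U \<zeta>)"
        using norm_W_le[of \<zeta>] norm_ge_zero[of "U \<zeta>"] unfolding distrib_right mult_1_left by linarith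
      finally show "norm \<i> * norm (component W m \<zeta>) \<le> (1 + norm \<zeta>) * norm (U \<zeta>)" by simp
    qed (auto intro: norm_component_le)
    then show "norm (indicator (cball 0 R) \<eta> *\<^sub>R (\<i> * component W m \<zeta> * component U i (\<eta> - \<zeta>))) \<le> 1 * ((1 + norm \<zeta>) * norm (U \<zeta>) * norm (U (\<eta> - \<zeta>)))"
      by (simp add: indicator_def)
  qed (auto simp: indicator_def)
  from has_FT_distr_prod[OF chi integrable_component_u represents_W, unfolded FT_component_u, OF this]
  show ?thesis .
qed

subsection \<open>Sharp truncation\<close>

text \<open>The number of packets that S_Q keeps: packet \<open>j\<close> lies in block
  \<open>2 * (j + n0)\<close>, so it survives exactly if \<open>j + n0 \<le> Q div 2\<close>.
  Truncated subtraction gives 0 when \<open>Q\<close> lies below all packets.\<close>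

definition levels :: "nat \<Rightarrow> nat" where "levels Q = Suc (Q div 2) - n0"

definition Ul :: "nat \<Rightarrow> R3 \<Rightarrow> R3" where "Ul Q \<xi> = (\<Sum>j<levels Q. hat j \<xi>)"

definition Wl :: "nat \<Rightarrow> R3 \<Rightarrow> R3" where "Wl Q \<xi> = cross3 \<xi> (Ul Q \<xi>)"

lemma Ul_hat:
  assumes "hat j \<xi> \<noteq> 0"
  shows "Ul Q \<xi> = (if j < levels Q then hat j \<xi> else 0)"
proof -
  have "Ul Q \<xi> = (\<Sum>m<levels Q. if m = j then hat j \<xi> else 0)"
    unfolding Ul_def using hat_unique[OF assms] by (intro sum.cong refl) auto
  then show ?thesis by simp
qed

lemma Ul_0: "(\<And>j. hat j \<xi> = 0) \<Longrightarrow> Ul Q \<xi> = 0"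
  by (simp add: Ul_def)

lemma lp_low_hat:
  assumes "hat j \<xi> \<noteq> 0"
  shows "lp_low chi Q \<xi> = (if j < levels Q then 1 else 0)"
proof -
  have "2 * (j + n0) < Suc Q \<longleftrightarrow> j < levels Q"
  proof -
    have "2 * (j + n0) < Suc Q \<longleftrightarrow> j + n0 \<le> Q div 2"
      by (simp only: less_Suc_eq_le less_eq_div_iff_mult_less_eq[of 2] mult.commute[of 2] zero_less_numeral)
    then show ?thesis
      unfolding levels_def by linarith
  qed
  then show ?thesis
    unfolding lp_low_def chi_dyadic[OF hat_shell(2,3)[OF assms]] by simp
qed

lemma low_U: "lp_low chi Q \<xi> *\<^sub>R U \<xi> = Ul Q \<xi>"
  by (rule U_cases[of \<xi>]) (simp_all add: lp_low_hat Ul_hat Ul_0)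

text \<open>Sharpness makes the truncation idempotent on the field, which a smooth cutoff is not in
  general; in this way the second cutoff in each term of the flux is absorbed.\<close>

lemma low_Ul: "lp_low chi Q \<xi> *\<^sub>R Ul Q \<xi> = Ul Q \<xi>"
  by (rule U_cases[of \<xi>]) (simp_all add: lp_low_hat Ul_hat Ul_0)

lemma low_Wl: "lp_low chi Q \<xi> *\<^sub>R Wl Q \<xi> = Wl Q \<xi>"
  unfolding Wl_def cross_mult_right[symmetric] low_Ul ..

lemma low_Ul_component: "lp_low chi Q \<xi> * Ul Q \<xi> $ m = Ul Q \<xi> $ m"
  and low_Wl_component: "lp_low chi Q \<xi> * Wl Q \<xi> $ m = Wl Q \<xi> $ m"
  using arg_cong[OF low_Ul, of "\<lambda>v. v $ m" Q \<xi>] arg_cong[OF low_Wl, of "\<lambda>v. v $ m" Q \<xi>]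
  by (simp_all only: vector_scaleR_component real_scaleR_def)

lemma schwartz_field_Ul: "schwartz_field (Ul Q)"
  unfolding Ul_def[abs_def] by (intro schwartz_field_sum schwartz_field_hat) auto

lemma schwartz_field_Wl: "schwartz_field (Wl Q)"
  unfolding Wl_def[abs_def] by (intro schwartz_field_cross schwartz_field_Ul)

lemma Ul_even: "Ul Q (- \<xi>) = Ul Q \<xi>"
  by (simp add: Ul_def hat_even)

lemma Wl_odd: "Wl Q (- \<xi>) = - Wl Q \<xi>"
  by (simp add: Wl_def Ul_even)

lemma measurable_Ul [measurable]: "Ul Q \<in> borel_measurable borel"
  unfolding Ul_def[abs_def] by measurable

lemma measurable_Wl [measurable]: "Wl Q \<in> borel_measurable borel"
  unfolding Wl_def[abs_def] by measurable

lemma Ul_support: "2 ^ Suc Q < norm \<xi> \<Longrightarrow> Ul Q \<xi> = 0"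
  using low_U[of Q \<xi>] lp_low_facts(3)[OF chi, of Q \<xi>] by simp

lemma LP_S_u: "LP_S chi (int Q) (vec_distr u m) = IFT (component (Ul Q) m)"
  unfolding has_FT_LP_S(2)[OF chi has_FT_u]
  by (rule arg_cong[where f=IFT]) (simp add: fun_eq_iff component_def low_U[symmetric])

lemma LP_S_vorticity: "LP_S chi (int Q) (vorticity u m) = IFT (\<lambda>\<xi>. \<i> * component (Wl Q) m \<xi>)"
  unfolding has_FT_LP_S(2)[OF chi has_FT_vorticity]
  by (rule arg_cong[where f=IFT]) (simp add: fun_eq_iff component_def W_def Wl_def low_U[symmetric] cross_mult_right)

text \<open>The multiplication formula moves S_Q onto \<open>IFT g\<close>, on whose frequencies its
  symbol acts as 1 by the hypothesis \<open>low\<close>. What remains is Plancherel's formula, with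
  the reflection of a bilinear pairing.\<close>

lemma LP_S_pairing:
  assumes T: "has_FT T F" and g: "g \<in> schwartz" and low: "\<And>\<xi>. complex_of_real (lp_low chi Q \<xi>) * g (- \<xi>) = g (- \<xi>)"
  shows "integrable lborel (\<lambda>x. LP_S chi (int Q) T x * IFT g x)"
    and "(LINT x|lborel. LP_S chi (int Q) T x * IFT g x) = (LINT \<xi>|lborel. F \<xi> * g (- \<xi>)) / complex_of_real ((2 * pi) ^ 3)"
proof -
  note S = has_FT_LP_S[OF chi T, of Q]
  note I = integrable_IFT_schwartz[OF g]
  show "integrable lborel (\<lambda>x. LP_S chi (int Q) T x * IFT g x)"
    unfolding S(2) by (rule integrable_bounded_mult(1)[OF I IFT_measurable[OF S(1)] IFT_bound])
  have "(LINT x|lborel. LP_S chi (int Q) T x * IFT g x) = (LINT \<xi>|lborel. F \<xi> * complex_of_real (lp_low chi Q \<xi>) * IFT (IFT g) \<xi>)"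
    unfolding S(2) by (rule IFT_multiplication[OF S(1) I])
  also have "\<dots> = (LINT \<xi>|lborel. F \<xi> * g (- \<xi>) / complex_of_real ((2 * pi) ^ 3))"
    unfolding IFT_eq_FT[of "IFT g"] FT_IFT_schwartz[OF g] by (simp only: times_divide_eq_right mult.assoc low)
  also have "\<dots> = (LINT \<xi>|lborel. F \<xi> * g (- \<xi>)) / complex_of_real ((2 * pi) ^ 3)"
    by (rule integral_divide_zero)
  finally show "(LINT x|lborel. LP_S chi (int Q) T x * IFT g x) = (LINT \<xi>|lborel. F \<xi> * g (- \<xi>)) / complex_of_real ((2 * pi) ^ 3)" .
qed

lemma partial_LP_S_u:
  "partial i (LP_S chi (int Q) (vec_distr u m)) x = IFT (\<lambda>\<xi>. \<i> * (complex_of_real (\<xi> $ i) * component (Ul Q) m \<xi>)) x"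
proof -
  have s: "component (Ul Q) m \<in> schwartz" using schwartz_field_Ul by (simp add: schwartz_field_def)
  show ?thesis
    unfolding LP_S_u using partial_IFT(1)[OF integrable_schwartz[OF s] integrable_weight_schwartz[OF s]] by (simp add: mult.assoc)
qed

lemma partial_LP_S_vorticity:
  "partial i (LP_S chi (int Q) (vorticity u m)) x = IFT (\<lambda>\<xi>. (- 1) * (complex_of_real (\<xi> $ i) * component (Wl Q) m \<xi>)) x"
proof -
  have s: "(\<lambda>\<xi>. \<i> * component (Wl Q) m \<xi>) \<in> schwartz" using schwartz_field_Wl by (intro schwartz_cmult) (simp add: schwartz_field_def)
  have "\<i> * complex_of_real (\<xi> $ i) * (\<i> * component (Wl Q) m \<xi>) = (- 1) * (complex_of_real (\<xi> $ i) * component (Wl Q) m \<xi>)" for \<xi> :: R3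
    by (simp add: mult_ac)
  then show ?thesis
    unfolding LP_S_vorticity using partial_IFT(1)[OF integrable_schwartz[OF s] integrable_weight_schwartz[OF s]] by simp
qed

text \<open>\<open>K1\<close> and \<open>K2\<close> are the integrands of the two parts of the flux,
  with \<open>\<xi>\<close> the frequency of the truncated factor and \<open>\<zeta>\<close>,
  \<open>\<xi> - \<zeta>\<close> those of the product. The minus sign in \<open>K1\<close> is the
  square of \<open>\<i>\<close>, from the derivative and the vorticity; in \<open>K2\<close> the
  reflection of the odd factor \<open>\<xi> $ i\<close> turns this sign into plus.\<close>

definition K1 :: "nat \<Rightarrow> 3 \<Rightarrow> 3 \<Rightarrow> R3 \<Rightarrow> R3 \<Rightarrow> real" where
  "K1 Q i m \<zeta> \<xi> = - (U (\<xi> - \<zeta>) $ i * U \<zeta> $ m * (\<xi> $ i * Wl Q \<xi> $ m))"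

definition K2 :: "nat \<Rightarrow> 3 \<Rightarrow> 3 \<Rightarrow> R3 \<Rightarrow> R3 \<Rightarrow> real" where
  "K2 Q i m \<zeta> \<xi> = (U (\<xi> - \<zeta>) $ i * W \<zeta> $ m - W \<zeta> $ i * U (\<xi> - \<zeta>) $ m) * (\<xi> $ i * Ul Q \<xi> $ m)"

lemma coord_bounded:
  assumes "schwartz_field f"
  obtains B where "\<And>\<xi>. \<bar>\<xi> $ i * f \<xi> $ m\<bar> \<le> B" "0 \<le> B"
proof -
  have "(\<lambda>\<xi>. complex_of_real (\<xi> $ i) * component f m \<xi>) \<in> schwartz"
    using assms by (intro schwartz_mult_coord) (simp add: schwartz_field_def)
  then obtain B where B: "\<And>\<xi>. norm (complex_of_real (\<xi> $ i) * component f m \<xi>) \<le> B"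
    using schwartz_bounded by blast
  have "\<bar>\<xi> $ i * f \<xi> $ m\<bar> \<le> B" for \<xi>
    using B[of \<xi>] by (simp add: component_def norm_mult abs_mult)
  moreover have "0 \<le> B" using B[of 0] norm_ge_zero order_trans by blast
  ultimately show ?thesis using that by blast
qed

lemma coord_W_le: "\<bar>W \<zeta> $ m\<bar> \<le> (1 + norm \<zeta>) * norm (U \<zeta>)"
  using component_le_norm_cart[of "W \<zeta>" m] norm_W_le[of \<zeta>] norm_ge_zero[of "U \<zeta>"] unfolding distrib_right mult_1_left by linarith

lemma coord_U_le: "\<bar>U \<zeta> $ m\<bar> \<le> (1 + norm \<zeta>) * norm (U \<zeta>)"
proof -
  have "\<bar>U \<zeta> $ m\<bar> \<le> 1 * norm (U \<zeta>)" using component_le_norm_cart[of "U \<zeta>" m] by simp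
  also have "\<dots> \<le> (1 + norm \<zeta>) * norm (U \<zeta>)" by (intro mult_right_mono) auto
  finally show ?thesis .
qed

lemma integrable_K1: "integrable (lborel \<Otimes>\<^sub>M lborel) (\<lambda>(\<zeta>, \<xi>). K1 Q i m \<zeta> \<xi>)"
proof -
  obtain B where B: "\<And>\<xi>. \<bar>\<xi> $ i * Wl Q \<xi> $ m\<bar> \<le> B" "0 \<le> B"
    using coord_bounded[OF schwartz_field_Wl] by blast
  show ?thesis
  proof (rule integrable_kernel[where A=B and R="2 ^ Suc Q"])
    fix \<zeta> \<xi> :: R3
    have "norm (K1 Q i m \<zeta> \<xi>) = \<bar>U (\<xi> - \<zeta>) $ i\<bar> * \<bar>U \<zeta> $ m\<bar> * \<bar>\<xi> $ i * Wl Q \<xi> $ m\<bar>"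
      by (simp add: K1_def abs_mult mult.assoc)
    also have "\<dots> \<le> norm (U (\<xi> - \<zeta>)) * ((1 + norm \<zeta>) * norm (U \<zeta>)) * B"
      by (intro mult_mono component_le_norm_cart coord_U_le B) auto
    finally show "norm (K1 Q i m \<zeta> \<xi>) \<le> B * ((1 + norm \<zeta>) * norm (U \<zeta>) * norm (U (\<xi> - \<zeta>)))"
      by (simp add: mult_ac)
    show "2 ^ Suc Q < norm \<xi> \<Longrightarrow> K1 Q i m \<zeta> \<xi> = 0"
      by (simp add: K1_def Wl_def Ul_support)
  qed (simp add: K1_def)
qed

lemma integrable_K2: "integrable (lborel \<Otimes>\<^sub>M lborel) (\<lambda>(\<zeta>, \<xi>). K2 Q i m \<zeta> \<xi>)"
proof -
  obtain B where B: "\<And>\<xi>. \<bar>\<xi> $ i * Ul Q \<xi> $ m\<bar> \<le> B" "0 \<le> B"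
    using coord_bounded[OF schwartz_field_Ul] by blast
  show ?thesis
  proof (rule integrable_kernel[where A="2 * B" and R="2 ^ Suc Q"])
    fix \<zeta> \<xi> :: R3
    let ?b = "norm (U (\<xi> - \<zeta>)) * ((1 + norm \<zeta>) * norm (U \<zeta>))"
    have "\<bar>U (\<xi> - \<zeta>) $ i * W \<zeta> $ m\<bar> \<le> ?b" "\<bar>W \<zeta> $ i * U (\<xi> - \<zeta>) $ m\<bar> \<le> ?b"
      unfolding abs_mult mult.commute[of "\<bar>W \<zeta> $ i\<bar>"] by (intro mult_mono component_le_norm_cart coord_W_le; simp)+
    then have "\<bar>U (\<xi> - \<zeta>) $ i * W \<zeta> $ m - W \<zeta> $ i * U (\<xi> - \<zeta>) $ m\<bar> \<le> 2 * ?b"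
      by linarith
    then have "norm (K2 Q i m \<zeta> \<xi>) \<le> (2 * ?b) * B"
      unfolding K2_def real_norm_def abs_mult[of "_ - _"] by (intro mult_mono B) auto
    then show "norm (K2 Q i m \<zeta> \<xi>) \<le> 2 * B * ((1 + norm \<zeta>) * norm (U \<zeta>) * norm (U (\<xi> - \<zeta>)))"
      by (simp add: mult_ac)
    show "2 ^ Suc Q < norm \<xi> \<Longrightarrow> K2 Q i m \<zeta> \<xi> = 0"
      by (simp add: K2_def Ul_support)
  qed (simp add: K2_def)
qed

lemma double_integral_of_real:
  assumes "integrable (lborel \<Otimes>\<^sub>M lborel) (\<lambda>(\<zeta>, \<xi>). f \<zeta> \<xi> :: real)"
  shows "(LINT \<xi>|lborel. LINT \<zeta>|lborel. complex_of_real (f \<zeta> \<xi>)) = of_real (LINT p|(lborel \<Otimes>\<^sub>M lborel). (case p of (\<zeta>, \<xi>) \<Rightarrow> f \<zeta> \<xi>))"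
  using lborel_pair.integral_snd[OF assms] by (simp add: integral_complex_of_real)

lemma flux_term1:
  "integrable lborel (\<lambda>x. LP_S chi (int Q) (u_tensor_u u i m) x * partial i (LP_S chi (int Q) (vorticity u m)) x)"
  "(LINT x|lborel. LP_S chi (int Q) (u_tensor_u u i m) x * partial i (LP_S chi (int Q) (vorticity u m)) x) =
    of_real (LINT p|(lborel \<Otimes>\<^sub>M lborel). (case p of (\<zeta>, \<xi>) \<Rightarrow> K1 Q i m \<zeta> \<xi>)) / (complex_of_real ((2 * pi) ^ 3))\<^sup>2"
proof -
  let ?c = "complex_of_real ((2 * pi) ^ 3)"
  define g where "g \<xi> = (- 1) * (complex_of_real (\<xi> $ i) * component (Wl Q) m \<xi>)" for \<xi> :: R3
  have g: "g \<in> schwartz"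
    unfolding g_def[abs_def] using schwartz_field_Wl by (intro schwartz_cmult schwartz_mult_coord) (simp add: schwartz_field_def)
  have gm: "g (- \<xi>) = - complex_of_real (\<xi> $ i * Wl Q \<xi> $ m)" for \<xi>
    by (simp add: g_def component_def Wl_odd)
  have low: "complex_of_real (lp_low chi Q \<xi>) * g (- \<xi>) = g (- \<xi>)" for \<xi>
  proof -
    have "lp_low chi Q \<xi> * (\<xi> $ i * Wl Q \<xi> $ m) = \<xi> $ i * Wl Q \<xi> $ m"
      by (simp only: mult.left_commute[of "lp_low chi Q \<xi>"] low_Wl_component)
    then show ?thesis
      unfolding gm mult_minus_right of_real_mult[symmetric] by (simp only:)
  qed
  note P = LP_S_pairing[OF has_FT_u_tensor_u[of i m] g low]
  show "integrable lborel (\<lambda>x. LP_S chi (int Q) (u_tensor_u u i m) x * partial i (LP_S chi (int Q) (vorticity u m)) x)"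
    unfolding partial_LP_S_vorticity g_def[symmetric] by (rule P(1))
  have eq: "(LINT \<zeta>|lborel. component U m \<zeta> * component U i (\<xi> - \<zeta>)) / ?c * g (- \<xi>) = (LINT \<zeta>|lborel. complex_of_real (K1 Q i m \<zeta> \<xi>)) / ?c" for \<xi>
  proof -
    have "complex_of_real (K1 Q i m \<zeta> \<xi>) = component U m \<zeta> * component U i (\<xi> - \<zeta>) * g (- \<xi>)" for \<zeta>
      by (simp add: K1_def gm component_def)
    then have "(LINT \<zeta>|lborel. complex_of_real (K1 Q i m \<zeta> \<xi>)) = (LINT \<zeta>|lborel. component U m \<zeta> * component U i (\<xi> - \<zeta>)) * g (- \<xi>)"
      by (simp only: integral_mult_left_zero)
    then show ?thesis by (simp only: times_divide_eq_left)
  qed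
  have "(LINT x|lborel. LP_S chi (int Q) (u_tensor_u u i m) x * partial i (LP_S chi (int Q) (vorticity u m)) x)
    = (LINT \<xi>|lborel. (LINT \<zeta>|lborel. component U m \<zeta> * component U i (\<xi> - \<zeta>)) / ?c * g (- \<xi>)) / ?c"
    unfolding partial_LP_S_vorticity g_def[symmetric] by (rule P(2))
  also have "\<dots> = (LINT \<xi>|lborel. (LINT \<zeta>|lborel. complex_of_real (K1 Q i m \<zeta> \<xi>)) / ?c) / ?c"
    unfolding eq ..
  finally have "(LINT x|lborel. LP_S chi (int Q) (u_tensor_u u i m) x * partial i (LP_S chi (int Q) (vorticity u m)) x)
    = (LINT \<xi>|lborel. LINT \<zeta>|lborel. complex_of_real (K1 Q i m \<zeta> \<xi>)) / ?c / ?c"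
    by (simp only: integral_divide_zero)
  then show "(LINT x|lborel. LP_S chi (int Q) (u_tensor_u u i m) x * partial i (LP_S chi (int Q) (vorticity u m)) x) =
    of_real (LINT p|(lborel \<Otimes>\<^sub>M lborel). (case p of (\<zeta>, \<xi>) \<Rightarrow> K1 Q i m \<zeta> \<xi>)) / ?c\<^sup>2"
    unfolding double_integral_of_real[OF integrable_K1] by (simp add: power2_eq_square)
qed

lemma flux_term2:
  "integrable lborel (\<lambda>x. LP_S chi (int Q) (u_wedge_vorticity u i m) x * partial i (LP_S chi (int Q) (vec_distr u m)) x)"
  "(LINT x|lborel. LP_S chi (int Q) (u_wedge_vorticity u i m) x * partial i (LP_S chi (int Q) (vec_distr u m)) x) =
    of_real (LINT p|(lborel \<Otimes>\<^sub>M lborel). (case p of (\<zeta>, \<xi>) \<Rightarrow> K2 Q i m \<zeta> \<xi>)) / (complex_of_real ((2 * pi) ^ 3))\<^sup>2"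
proof -
  let ?c = "complex_of_real ((2 * pi) ^ 3)"
  define g where "g \<xi> = \<i> * (complex_of_real (\<xi> $ i) * component (Ul Q) m \<xi>)" for \<xi> :: R3
  have g: "g \<in> schwartz"
    unfolding g_def[abs_def] using schwartz_field_Ul by (intro schwartz_cmult schwartz_mult_coord) (simp add: schwartz_field_def)
  have gm: "g (- \<xi>) = - \<i> * complex_of_real (\<xi> $ i * Ul Q \<xi> $ m)" for \<xi>
    by (simp add: g_def component_def Ul_even)
  have low: "complex_of_real (lp_low chi Q \<xi>) * g (- \<xi>) = g (- \<xi>)" for \<xi>
  proof -
    have "lp_low chi Q \<xi> * (\<xi> $ i * Ul Q \<xi> $ m) = \<xi> $ i * Ul Q \<xi> $ m"
      by (simp only: mult.left_commute[of "lp_low chi Q \<xi>"] low_Ul_component)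
    then show ?thesis
      unfolding gm mult.left_commute[of "complex_of_real (lp_low chi Q \<xi>)"] of_real_mult[symmetric] by (simp only:)
  qed
  have T: "has_FT (u_wedge_vorticity u i m) (\<lambda>\<eta>. (LINT \<zeta>|lborel. \<i> * component W m \<zeta> * component U i (\<eta> - \<zeta>)) / ?c
     - (LINT \<zeta>|lborel. \<i> * component W i \<zeta> * component U m (\<eta> - \<zeta>)) / ?c)"
    unfolding u_wedge_vorticity_def by (intro has_FT_distr_diff has_FT_distr_prod_u)
  note P = LP_S_pairing[OF T g low]
  show "integrable lborel (\<lambda>x. LP_S chi (int Q) (u_wedge_vorticity u i m) x * partial i (LP_S chi (int Q) (vec_distr u m)) x)"
    unfolding partial_LP_S_u g_def[symmetric] by (rule P(1))
  \<comment> \<open>The two halves of the wedge product are separate convolutions. Joining them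
    under one integral requires that each converges, which Fubini provides for almost every
    \<open>\<xi>\<close>.\<close>
  have conv: "AE \<xi> in lborel. integrable lborel (\<lambda>\<zeta>. \<i> * component W a \<zeta> * component U b (\<xi> - \<zeta>) * g (- \<xi>))" for a b
  proof -
    obtain B where B: "\<And>\<xi>. \<bar>\<xi> $ i * Ul Q \<xi> $ m\<bar> \<le> B" "0 \<le> B"
      using coord_bounded[OF schwartz_field_Ul] by blast
    have [measurable]: "g \<in> borel_measurable borel" by (rule schwartz_measurable[OF g])
    have "integrable (lborel \<Otimes>\<^sub>M lborel) (\<lambda>(\<zeta>, \<xi>). \<i> * component W a \<zeta> * component U b (\<xi> - \<zeta>) * g (- \<xi>))"
    proof (rule integrable_kernel[where A=B and R="2 ^ Suc Q"])
      fix \<zeta> \<xi> :: R3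
      have "norm (\<i> * component W a \<zeta> * component U b (\<xi> - \<zeta>) * g (- \<xi>)) = \<bar>W \<zeta> $ a\<bar> * \<bar>U (\<xi> - \<zeta>) $ b\<bar> * \<bar>\<xi> $ i * Ul Q \<xi> $ m\<bar>"
        unfolding gm component_def by (simp add: norm_mult abs_mult)
      also have "\<dots> \<le> ((1 + norm \<zeta>) * norm (U \<zeta>)) * norm (U (\<xi> - \<zeta>)) * B"
        by (intro mult_mono component_le_norm_cart coord_W_le B) auto
      finally show "norm (\<i> * component W a \<zeta> * component U b (\<xi> - \<zeta>) * g (- \<xi>)) \<le> B * ((1 + norm \<zeta>) * norm (U \<zeta>) * norm (U (\<xi> - \<zeta>)))"
        by (simp add: mult_ac)
      show "2 ^ Suc Q < norm \<xi> \<Longrightarrow> \<i> * component W a \<zeta> * component U b (\<xi> - \<zeta>) * g (- \<xi>) = 0"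
        by (simp add: gm Ul_support)
    qed measurable
    from lborel_pair.integrable_product_swap[OF this]
    have "integrable (lborel \<Otimes>\<^sub>M lborel) (\<lambda>(\<xi>, \<zeta>). \<i> * component W a \<zeta> * component U b (\<xi> - \<zeta>) * g (- \<xi>))"
      by (simp add: split_beta)
    from lborel_pair.AE_integrable_fst[OF this] show ?thesis .
  qed
  have "(LINT x|lborel. LP_S chi (int Q) (u_wedge_vorticity u i m) x * partial i (LP_S chi (int Q) (vec_distr u m)) x)
    = (LINT \<xi>|lborel. ((LINT \<zeta>|lborel. \<i> * component W m \<zeta> * component U i (\<xi> - \<zeta>)) / ?c
     - (LINT \<zeta>|lborel. \<i> * component W i \<zeta> * component U m (\<xi> - \<zeta>)) / ?c) * g (- \<xi>)) / ?c"
    unfolding partial_LP_S_u g_def[symmetric] by (rule P(2))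
  also have "(LINT \<xi>|lborel. ((LINT \<zeta>|lborel. \<i> * component W m \<zeta> * component U i (\<xi> - \<zeta>)) / ?c
     - (LINT \<zeta>|lborel. \<i> * component W i \<zeta> * component U m (\<xi> - \<zeta>)) / ?c) * g (- \<xi>)) = (LINT \<xi>|lborel. (LINT \<zeta>|lborel. complex_of_real (K2 Q i m \<zeta> \<xi>)) / ?c)"
  proof (rule integral_cong_AE)
    show "AE \<xi> in lborel. ((LINT \<zeta>|lborel. \<i> * component W m \<zeta> * component U i (\<xi> - \<zeta>)) / ?c
     - (LINT \<zeta>|lborel. \<i> * component W i \<zeta> * component U m (\<xi> - \<zeta>)) / ?c) * g (- \<xi>) = (LINT \<zeta>|lborel. complex_of_real (K2 Q i m \<zeta> \<xi>)) / ?c"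
      using conv[of m i] conv[of i m]
    proof eventually_elim
      case (elim \<xi>)
      have "complex_of_real (K2 Q i m \<zeta> \<xi>) = \<i> * component W m \<zeta> * component U i (\<xi> - \<zeta>) * g (- \<xi>) - \<i> * component W i \<zeta> * component U m (\<xi> - \<zeta>) * g (- \<xi>)" for \<zeta>
        unfolding gm by (simp add: K2_def component_def algebra_simps)
      then have "(LINT \<zeta>|lborel. complex_of_real (K2 Q i m \<zeta> \<xi>)) = (LINT \<zeta>|lborel. \<i> * component W m \<zeta> * component U i (\<xi> - \<zeta>) * g (- \<xi>))
         - (LINT \<zeta>|lborel. \<i> * component W i \<zeta> * component U m (\<xi> - \<zeta>) * g (- \<xi>))"
        using elim by (simp only: Bochner_Integration.integral_diff)
      then show ?case
        by (simp only: integral_mult_left_zero diff_divide_distrib left_diff_distrib times_divide_eq_left)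
    qed
    have [measurable]: "g \<in> borel_measurable borel" by (rule schwartz_measurable[OF g])
    show "(\<lambda>\<xi>. ((LINT \<zeta>|lborel. \<i> * component W m \<zeta> * component U i (\<xi> - \<zeta>)) / ?c
     - (LINT \<zeta>|lborel. \<i> * component W i \<zeta> * component U m (\<xi> - \<zeta>)) / ?c) * g (- \<xi>)) \<in> borel_measurable lborel"
      by measurable
    show "(\<lambda>\<xi>. (LINT \<zeta>|lborel. complex_of_real (K2 Q i m \<zeta> \<xi>)) / ?c) \<in> borel_measurable lborel"
      unfolding K2_def by measurable
  qed
  finally have "(LINT x|lborel. LP_S chi (int Q) (u_wedge_vorticity u i m) x * partial i (LP_S chi (int Q) (vec_distr u m)) x)
    = (LINT \<xi>|lborel. LINT \<zeta>|lborel. complex_of_real (K2 Q i m \<zeta> \<xi>)) / ?c / ?c"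
    by (simp only: integral_divide_zero)
  then show "(LINT x|lborel. LP_S chi (int Q) (u_wedge_vorticity u i m) x * partial i (LP_S chi (int Q) (vec_distr u m)) x) =
    of_real (LINT p|(lborel \<Otimes>\<^sub>M lborel). (case p of (\<zeta>, \<xi>) \<Rightarrow> K2 Q i m \<zeta> \<xi>)) / ?c\<^sup>2"
    unfolding double_integral_of_real[OF integrable_K2] by (simp add: power2_eq_square)
qed

section \<open>Conservation of helicity and the reduction to triads\<close>

definition Wh :: "nat \<Rightarrow> R3 \<Rightarrow> R3" where "Wh Q \<xi> = W \<xi> - Wl Q \<xi>"

text \<open>What is left after the two cancellations below: the vorticity removed by the truncation,
  at \<open>\<zeta>\<close>, acting on the vorticity kept, at \<open>\<xi>\<close>.\<close>

definition triad :: "nat \<Rightarrow> R3 \<Rightarrow> R3 \<Rightarrow> real" where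
  "triad Q \<zeta> \<xi> = cross3 (U (\<xi> - \<zeta>)) (Wh Q \<zeta>) \<bullet> Wl Q \<xi>"

lemma norm_Wl_le: "norm (Wl Q \<xi>) \<le> norm (W \<xi>)"
proof -
  have "Wl Q \<xi> = W \<xi> \<or> Wl Q \<xi> = 0"
    by (rule U_cases[of \<xi>]) (auto simp: Wl_def W_def Ul_hat Ul_0)
  then show ?thesis by auto
qed

lemma Wl_bounded: obtains B where "\<And>\<xi>. norm (Wl Q \<xi>) \<le> B" "0 \<le> B"
proof -
  have "\<exists>B. \<forall>\<xi>. norm (component (Wl Q) i \<xi>) \<le> B" for i
    using schwartz_field_Wl[of Q] schwartz_bounded unfolding schwartz_field_def by metis
  then obtain B where B: "\<And>i \<xi>. norm (component (Wl Q) i \<xi>) \<le> B i" by metis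
  have "norm (Wl Q \<xi>) \<le> (\<Sum>i\<in>UNIV. B i)" for \<xi>
    using B by (intro order_trans[OF norm_le_l1_cart] sum_mono) (simp add: component_def)
  moreover from this[of 0] have "0 \<le> (\<Sum>i\<in>UNIV. B i)" using norm_ge_zero order_trans by blast
  ultimately show ?thesis using that by blast
qed

lemma integrable_triple:
  assumes [measurable]: "V \<in> borel_measurable borel" and V: "\<And>\<zeta>. norm (V \<zeta>) \<le> norm (W \<zeta>)"
  shows "integrable (lborel \<Otimes>\<^sub>M lborel) (\<lambda>(\<zeta>, \<xi>). cross3 (U (\<xi> - \<zeta>)) (V \<zeta>) \<bullet> Wl Q \<xi>)"
proof -
  obtain B where B: "\<And>\<xi>. norm (Wl Q \<xi>) \<le> B" "0 \<le> B" using Wl_bounded by blast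
  show ?thesis
  proof (rule integrable_kernel[where A=B and R="2 ^ Suc Q"])
    fix \<zeta> \<xi> :: R3
    have v: "norm (V \<zeta>) \<le> (1 + norm \<zeta>) * norm (U \<zeta>)"
      using V[of \<zeta>] norm_W_le[of \<zeta>] norm_ge_zero[of "U \<zeta>"] unfolding distrib_right mult_1_left by linarith
    have "norm (cross3 (U (\<xi> - \<zeta>)) (V \<zeta>) \<bullet> Wl Q \<xi>) \<le> norm (cross3 (U (\<xi> - \<zeta>)) (V \<zeta>)) * norm (Wl Q \<xi>)"
      unfolding real_norm_def by (rule Cauchy_Schwarz_ineq2)
    also have "\<dots> \<le> (norm (U (\<xi> - \<zeta>)) * ((1 + norm \<zeta>) * norm (U \<zeta>))) * B"
      by (intro mult_mono order_trans[OF norm_cross3_le] B v) auto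
    finally show "norm (cross3 (U (\<xi> - \<zeta>)) (V \<zeta>) \<bullet> Wl Q \<xi>) \<le> B * ((1 + norm \<zeta>) * norm (U \<zeta>) * norm (U (\<xi> - \<zeta>)))"
      by (simp add: mult_ac)
    show "2 ^ Suc Q < norm \<xi> \<Longrightarrow> cross3 (U (\<xi> - \<zeta>)) (V \<zeta>) \<bullet> Wl Q \<xi> = 0"
      by (simp add: Wl_def Ul_support)
  qed measurable
qed

lemma integrable_triad: "integrable (lborel \<Otimes>\<^sub>M lborel) (\<lambda>(\<zeta>, \<xi>). triad Q \<zeta> \<xi>)"
  unfolding triad_def
proof (rule integrable_triple)
  show "norm (Wh Q \<zeta>) \<le> norm (W \<zeta>)" for \<zeta>
    unfolding Wh_def by (rule U_cases[of \<zeta>]) (auto simp: Wl_def W_def Ul_hat Ul_0)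
qed (simp add: Wh_def[abs_def])

text \<open>The part with \<open>U \<bullet> U\<close> vanishes by the symmetry \<open>\<zeta> \<mapsto> \<xi> - \<zeta>\<close>.\<close>

lemma integral_symmetric_part:
  "(LINT \<zeta>|lborel. (U (\<xi> - \<zeta>) \<bullet> U \<zeta>) * (\<zeta> \<bullet> Wl Q \<xi>)) = 0"
proof -
  let ?f = "\<lambda>\<zeta>. (U (\<xi> - \<zeta>) \<bullet> U \<zeta>) * (\<zeta> \<bullet> Wl Q \<xi>)"
  have "(LINT \<zeta>|lborel. ?f \<zeta>) = (LINT \<zeta>|lborel. ?f (\<xi> - \<zeta>))"
    using integral_affine[of "-1" ?f \<xi>] by simp
  also have "\<dots> = (LINT \<zeta>|lborel. - ?f \<zeta>)"
  proof (intro Bochner_Integration.integral_cong refl)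
    fix \<zeta>
    have "\<xi> \<bullet> Wl Q \<xi> = 0" by (simp add: Wl_def dot_cross_self)
    then show "?f (\<xi> - \<zeta>) = - ?f \<zeta>"
      by (simp add: inner_diff_left inner_commute)
  qed
  finally show ?thesis by simp
qed

text \<open>The interactions among low frequencies only cancel by antisymmetry: helicity is conserved.\<close>

lemma integral_low_part:
  "(LINT p|(lborel \<Otimes>\<^sub>M lborel). (case p of (\<zeta>, \<xi>) \<Rightarrow> cross3 (U (\<xi> - \<zeta>)) (Wl Q \<zeta>) \<bullet> Wl Q \<xi>)) = 0"
proof -
  let ?f = "\<lambda>\<zeta> \<xi>. cross3 (U (\<xi> - \<zeta>)) (Wl Q \<zeta>) \<bullet> Wl Q \<xi>"
  have anti: "?f \<xi> \<zeta> = - ?f \<zeta> \<xi>" for \<zeta> \<xi>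
  proof -
    have "U (\<zeta> - \<xi>) = U (\<xi> - \<zeta>)" using U_even[of "\<xi> - \<zeta>"] by simp
    then have "?f \<xi> \<zeta> = cross3 (Wl Q \<xi>) (Wl Q \<zeta>) \<bullet> U (\<xi> - \<zeta>)"
      by (simp only: cross_triple[of "U (\<xi> - \<zeta>)" "Wl Q \<xi>" "Wl Q \<zeta>"])
    also have "\<dots> = - (cross3 (Wl Q \<zeta>) (Wl Q \<xi>) \<bullet> U (\<xi> - \<zeta>))"
      by (subst cross_skew) (rule inner_minus_left)
    also have "\<dots> = - ?f \<zeta> \<xi>"
      by (simp only: cross_triple[of "U (\<xi> - \<zeta>)" "Wl Q \<zeta>" "Wl Q \<xi>"])
    finally show ?thesis .
  qed
  have "(LINT p|(lborel \<Otimes>\<^sub>M lborel). (case p of (\<zeta>, \<xi>) \<Rightarrow> ?f \<zeta> \<xi>)) = (LINT p|(lborel \<Otimes>\<^sub>M lborel). (case p of (\<zeta>, \<xi>) \<Rightarrow> ?f \<xi> \<zeta>))"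
    using lborel_pair.integral_product_swap[of "\<lambda>(\<zeta>, \<xi>). ?f \<zeta> \<xi>"] by simp
  also have "\<dots> = (LINT p|(lborel \<Otimes>\<^sub>M lborel). - (case p of (\<zeta>, \<xi>) \<Rightarrow> ?f \<zeta> \<xi>))"
  proof (intro Bochner_Integration.integral_cong refl)
    fix p :: "R3 \<times> R3"
    show "(case p of (\<zeta>, \<xi>) \<Rightarrow> ?f \<xi> \<zeta>) = - (case p of (\<zeta>, \<xi>) \<Rightarrow> ?f \<zeta> \<xi>)"
      using anti[of "snd p" "fst p"] by (simp only: split_beta)
  qed
  finally show ?thesis by simp
qed

text \<open>In physical space the flux is twice the integral of (u x \<omega>) . S_Q \<omega>, and
  S_Q \<omega> in place of \<omega> contributes nothing. Of the power \<open>(2 * pi) ^ 6\<close>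
  one half comes from the convolution and one from the pairing.\<close>

lemma helicity_flux_triad:
  "helicity_flux chi u (int Q) = of_real (2 / (2 * pi) ^ 6 * (LINT p|(lborel \<Otimes>\<^sub>M lborel). (case p of (\<zeta>, \<xi>) \<Rightarrow> triad Q \<zeta> \<xi>)))"
proof -
  let ?c = "complex_of_real ((2 * pi) ^ 3)"
  let ?P = "lborel \<Otimes>\<^sub>M lborel :: (R3 \<times> R3) measure"
  let ?I = "\<lambda>f :: R3 \<Rightarrow> R3 \<Rightarrow> real. (LINT p|?P. (case p of (\<zeta>, \<xi>) \<Rightarrow> f \<zeta> \<xi>))"
  let ?f1 = "\<lambda>\<zeta> \<xi>. cross3 (U (\<xi> - \<zeta>)) (W \<zeta>) \<bullet> Wl Q \<xi>"
  let ?f2 = "\<lambda>\<zeta> \<xi>. (U (\<xi> - \<zeta>) \<bullet> U \<zeta>) * (\<zeta> \<bullet> Wl Q \<xi>)"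
  let ?fl = "\<lambda>\<zeta> \<xi>. cross3 (U (\<xi> - \<zeta>)) (Wl Q \<zeta>) \<bullet> Wl Q \<xi>"
  let ?K = "\<lambda>p. \<Sum>i\<in>UNIV. \<Sum>m\<in>UNIV. (case p of (\<zeta>, \<xi>) \<Rightarrow> K1 Q i m \<zeta> \<xi>) + (case p of (\<zeta>, \<xi>) \<Rightarrow> K2 Q i m \<zeta> \<xi>)"
  have K: "?K p = 2 * (case p of (\<zeta>, \<xi>) \<Rightarrow> ?f1 \<zeta> \<xi>) - (case p of (\<zeta>, \<xi>) \<Rightarrow> ?f2 \<zeta> \<xi>)" for p
  proof (cases p)
    case (Pair \<zeta> \<xi>)
    show ?thesis
      using trilinear_identity[OF inner_U, of "\<xi> - \<zeta>" "U \<zeta>" \<zeta> "Ul Q \<xi>"]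
      unfolding Pair prod.case K1_def K2_def W_def Wl_def by (simp only: diff_add_cancel)
  qed
  have iK: "integrable ?P ?K"
    by (intro Bochner_Integration.integrable_sum Bochner_Integration.integrable_add integrable_K1 integrable_K2)
  have i1: "integrable ?P (\<lambda>(\<zeta>, \<xi>). ?f1 \<zeta> \<xi>)"
    by (rule integrable_triple) auto
  \<comment> \<open>The gradient term inherits its integrability from the identity \<open>K\<close>,
    as a difference of integrable functions.\<close>
  have i2: "integrable ?P (\<lambda>(\<zeta>, \<xi>). ?f2 \<zeta> \<xi>)"
  proof -
    have "integrable ?P (\<lambda>p. 2 * (case p of (\<zeta>, \<xi>) \<Rightarrow> ?f1 \<zeta> \<xi>) - ?K p)"
      by (intro Bochner_Integration.integrable_diff integrable_mult_right i1 iK)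
    then show ?thesis
      unfolding K by simp
  qed
  have "helicity_flux chi u (int Q) = (\<Sum>i\<in>UNIV. \<Sum>m\<in>UNIV. of_real (?I (K1 Q i m)) / ?c\<^sup>2 + of_real (?I (K2 Q i m)) / ?c\<^sup>2)"
    unfolding helicity_flux_def
    by (simp only: Bochner_Integration.integral_sum Bochner_Integration.integral_add Bochner_Integration.integrable_add
        Bochner_Integration.integrable_sum flux_term1 flux_term2)
  also have "\<dots> = of_real (\<Sum>i\<in>UNIV. \<Sum>m\<in>UNIV. ?I (K1 Q i m) + ?I (K2 Q i m)) / ?c\<^sup>2"
    by (simp only: of_real_sum of_real_add sum_divide_distrib add_divide_distrib)
  also have "(\<Sum>i\<in>UNIV. \<Sum>m\<in>UNIV. ?I (K1 Q i m) + ?I (K2 Q i m)) = (LINT p|?P. ?K p)"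
    by (simp only: Bochner_Integration.integral_sum Bochner_Integration.integral_add Bochner_Integration.integrable_add
        Bochner_Integration.integrable_sum integrable_K1 integrable_K2)
  also have "\<dots> = 2 * ?I ?f1 - ?I ?f2"
    unfolding K by (simp only: Bochner_Integration.integral_diff integral_mult_right_zero integrable_mult_right i1 i2)
  also have "?I ?f2 = 0"
    unfolding lborel_pair.integral_snd[OF i2, symmetric] integral_symmetric_part by simp
  also have "?I ?f1 = ?I (triad Q)"
  proof -
    have "?I ?f1 = (LINT p|?P. (case p of (\<zeta>, \<xi>) \<Rightarrow> triad Q \<zeta> \<xi>) + (case p of (\<zeta>, \<xi>) \<Rightarrow> ?fl \<zeta> \<xi>))"
      by (intro Bochner_Integration.integral_cong refl) (auto simp: triad_def Wh_def inner_diff_left Cross3.right_diff_distrib split: prod.splits)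
    also have "\<dots> = ?I (triad Q) + ?I ?fl"
      by (intro Bochner_Integration.integral_add integrable_triad integrable_triple norm_Wl_le measurable_Wl)
    finally show ?thesis by (simp only: integral_low_part add_0_right)
  qed
  finally show ?thesis
    by (simp add: power_mult_distrib flip: power_mult of_real_power)
qed

section \<open>The resonant triads\<close>

text \<open>One of the six bumps of a packet, centred at \<open>s *\<^sub>R k j t\<close>; the
  prefactor \<open>s\<close> is the oddness of \<open>pot\<close>.\<close>

definition atom :: "nat \<Rightarrow> 3 \<Rightarrow> real \<Rightarrow> R3 \<Rightarrow> R3" where
  "atom j t s \<xi> = (s * (c j / L j) * chi (\<xi> - s *\<^sub>R k j t)) *\<^sub>R cross3 \<xi> (pol t)"

definition near :: "nat \<Rightarrow> 3 \<Rightarrow> real \<Rightarrow> R3 \<Rightarrow> bool" where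
  "near j t s \<xi> \<longleftrightarrow> \<bar>s\<bar> = 1 \<and> norm (\<xi> - s *\<^sub>R k j t) < 1"

lemma khat_components: "khat t $ 1 = (if t = 1 then 1 else - (1 / 8))"
  "khat t $ 2 = (if t = 1 then 0 else if t = 2 then h else - h)"
  by (auto simp: khat_def vector_3)

lemma h_bounds: "99 / 100 \<le> h" "h \<le> 1"
proof -
  show "99 / 100 \<le> h"
    using h_pos by (intro power2_le_imp_le[of "99 / 100" h]) (auto simp: h_sq power_divide)
  show "h \<le> 1"
    by (intro power2_le_imp_le[of h 1]) (auto simp: h_sq)
qed

lemma near_shell: "near j t s \<xi> \<Longrightarrow> r * L j < norm \<xi>" "near j t s \<xi> \<Longrightarrow> norm \<xi> < L j"
  unfolding near_def using near_k_shell by blast+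

text \<open>The shells determine the scale. Two different vectors \<open>s *\<^sub>R khat t\<close>
  differ by at least 1 / 4 in one of the first two coordinates, and the factor
  \<open>rho * L j\<close>, at least 75, magnifies this far beyond the distance 2 that a common
  point allows.\<close>

lemma near_unique:
  assumes "near j t s \<xi>" "near j' t' s' \<xi>"
  shows "j' = j \<and> t' = t \<and> s' = s"
proof -
  have j: "j' = j"
    using shells_disjoint near_shell[OF assms(1)] near_shell[OF assms(2)] by blast
  have s: "s = 1 \<or> s = - 1" "s' = 1 \<or> s' = - 1"
    using assms by (auto simp: near_def)
  have x: "75 \<le> rho * L j"
    using mult_mono[OF rho(1) L_ge(4)[of j]] rho(1) by simp
  have "norm (s *\<^sub>R k j t - s' *\<^sub>R k j t') < 2"
    using norm_triangle_ineq4[of "\<xi> - s' *\<^sub>R k j t'" "\<xi> - s *\<^sub>R k j t"] assms j by (simp add: near_def)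
  then have "\<bar>(s *\<^sub>R k j t - s' *\<^sub>R k j t') $ i\<bar> < 2" for i
    using component_le_norm_cart[of "s *\<^sub>R k j t - s' *\<^sub>R k j t'" i] by linarith
  then have "\<bar>(rho * L j) * (s * khat t $ i - s' * khat t' $ i)\<bar> < 2" for i
    by (simp add: k_def algebra_simps)
  moreover have "75 * \<bar>d\<bar> \<le> \<bar>(rho * L j) * d\<bar>" for d
    unfolding abs_mult[of "rho * L j"] by (intro mult_right_mono order_trans[OF x abs_ge_self] abs_ge_zero)
  ultimately have "\<bar>s * khat t $ i - s' * khat t' $ i\<bar> < 2 / 75" for i
  proof -
    assume *: "\<And>i. \<bar>rho * L j * (s * khat t $ i - s' * khat t' $ i)\<bar> < 2"
      and **: "\<And>d. 75 * \<bar>d\<bar> \<le> \<bar>rho * L j * d\<bar>"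
    have "75 * \<bar>s * khat t $ i - s' * khat t' $ i\<bar> < 2"
      by (rule le_less_trans[OF ** *])
    then show ?thesis by simp
  qed
  from this[of 1] this[of 2] have "t' = t \<and> s' = s"
    using s exhaust_3[of t] exhaust_3[of t'] h_bounds
    by (elim disjE) (simp_all add: khat_components)
  with j show ?thesis by simp
qed

lemma atom_near: "atom j t s \<xi> \<noteq> 0 \<Longrightarrow> \<bar>s\<bar> = 1 \<Longrightarrow> near j t s \<xi>"
  using lp_cutoff_support[OF chi] by (auto simp: atom_def near_def)

lemma hat_atoms: "hat j \<xi> = (\<Sum>t\<in>UNIV. atom j t 1 \<xi> + atom j t (- 1) \<xi>)"
proof -
  have "hat j \<xi> = (\<Sum>t\<in>UNIV. (c j / L j) *\<^sub>R ((chi (\<xi> - k j t) - chi (\<xi> + k j t)) *\<^sub>R cross3 \<xi> (pol t)))"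
    unfolding hat_def pot_def sum_3 cross_add_right cross_mult_right scaleR_add_right ..
  also have "\<dots> = (\<Sum>t\<in>UNIV. atom j t 1 \<xi> + atom j t (- 1) \<xi>)"
    by (intro sum.cong refl) (simp add: atom_def scaleR_diff_left scaleR_diff_right right_diff_distrib flip: scaleR_add_left)
  finally show ?thesis .
qed

lemma near_hat:
  assumes n: "near j t s \<xi>"
  shows "hat j \<xi> = atom j t s \<xi>"
proof -
  have s: "s = 1 \<or> s = - 1" using n by (auto simp: near_def)
  have z: "atom j t' s' \<xi> = 0" if "\<bar>s'\<bar> = 1" "\<not> (t' = t \<and> s' = s)" for t' s'
    using near_unique[OF n atom_near[of j t' s' \<xi>]] that by blast
  have "atom j t' 1 \<xi> + atom j t' (- 1) \<xi> = (if t' = t then atom j t s \<xi> else 0)" for t'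
    using z[of 1 t'] z[of "- 1" t'] s by auto
  then show ?thesis by (simp add: hat_atoms)
qed

lemma near_U:
  assumes n: "near j t s \<xi>"
  shows "U \<xi> = atom j t s \<xi>" "Ul Q \<xi> = (if j < levels Q then atom j t s \<xi> else 0)"
proof -
  have z: "hat m \<xi> = 0" if "m \<noteq> j" for m
    using shells_disjoint[OF hat_shell(2,3)[of m \<xi>] near_shell[OF n]] that by blast
  have "U \<xi> = hat j \<xi> \<and> Ul Q \<xi> = (if j < levels Q then hat j \<xi> else 0)"
  proof (cases "hat j \<xi> = 0")
    case True
    then have "hat m \<xi> = 0" for m using z[of m] by (cases "m = j") auto
    then show ?thesis using U_eq_0 Ul_0 True by auto
  next
    case False
    then show ?thesis using U_eq_hat Ul_hat by blast
  qed
  then show "U \<xi> = atom j t s \<xi>" "Ul Q \<xi> = (if j < levels Q then atom j t s \<xi> else 0)"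
    by (simp_all add: near_hat[OF n])
qed

lemma U_near:
  assumes "U \<xi> \<noteq> 0"
  obtains j t s where "near j t s \<xi>"
proof (rule U_cases[of \<xi>])
  fix j assume "hat j \<xi> \<noteq> 0"
  then show ?thesis
    using bumps_support[OF hat_shell(1)] that unfolding near_def by blast
qed (use assms in simp)

text \<open>Comparing lengths forces the two high frequencies into the same shell; comparing the first
  two coordinates leaves only the triangle \<open>khat 2 + khat 3 = - khat 1 / 4\<close>.\<close>

lemma triad_geometry:
  assumes n1: "near a t1 s1 (\<xi> - \<zeta>)" and n2: "near b t2 s2 \<zeta>" and n3: "near l t3 s3 \<xi>" and lb: "l < b"
  shows "a = b" "b = Suc l" "t3 = 1" "s2 = s1" "s3 = - s1" "t1 = 2 \<and> t2 = 3 \<or> t1 = 3 \<and> t2 = 2"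
proof -
  have s: "s1 = 1 \<or> s1 = - 1" "s2 = 1 \<or> s2 = - 1" "s3 = 1 \<or> s3 = - 1"
    using assms by (auto simp: near_def)
  have nk: "norm (s' *\<^sub>R k j t) = rho * L j" if "\<bar>s'\<bar> = 1" for s' j t
    using that by (simp add: norm_k)
  have close: "\<bar>norm x - rho * L j\<bar> < 1" if "near j t s' x" for j t s' x
    using that norm_triangle_ineq3[of x "s' *\<^sub>R k j t"] nk[of s' j t] unfolding near_def by linarith
  \<comment> \<open>Three bumps of radius 1 cause an error of 3; division by \<open>rho\<close>,
    which is at least 3 / 4, makes it 4.\<close>
  have div: "x \<le> y + 4" if "rho * x \<le> rho * y + 3" for x y
  proof -
    have "rho * (x - y) \<le> rho * 4" using that rho(1) by (simp add: algebra_simps)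
    then show ?thesis using rho(1) by simp
  qed
  have tri: "norm (\<xi> - \<zeta>) \<le> norm \<xi> + norm \<zeta>" "norm \<zeta> \<le> norm \<xi> + norm (\<xi> - \<zeta>)"
    using norm_triangle_ineq4[of \<xi> \<zeta>] norm_triangle_ineq4[of \<xi> "\<xi> - \<zeta>"] by simp_all
  have ineq: "rho * L a \<le> rho * (L b + L l) + 3" "rho * L b \<le> rho * (L a + L l) + 3"
    using close[OF n1] close[OF n2] close[OF n3] tri unfolding distrib_left by linarith+
  from div[OF ineq(1)] have La: "L a \<le> L b + L l + 4" .
  from div[OF ineq(2)] have Lb: "L b \<le> L a + L l + 4" .
  have Ll: "4 * L l \<le> L b" using L_less[OF lb] .
  have big: "100 \<le> L l" "100 \<le> L a" "100 \<le> L b" by (rule L_ge)+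
  show ab: "a = b"
  proof (rule ccontr)
    assume "a \<noteq> b"
    then consider "a < b" | "b < a" by linarith
    then show False
    proof cases
      case 1
      then show ?thesis using L_less[OF 1] Lb Ll big by linarith
    next
      case 2
      then show ?thesis using L_less[OF 2] La Ll big by linarith
    qed
  qed
  let ?d = "s1 *\<^sub>R k b t1 + s2 *\<^sub>R k b t2 - s3 *\<^sub>R k l t3"
  have "norm ?d < 3"
  proof -
    have "?d = (\<xi> - s3 *\<^sub>R k l t3) - ((\<xi> - \<zeta> - s1 *\<^sub>R k b t1) + (\<zeta> - s2 *\<^sub>R k b t2))"
      by simp
    also have "norm \<dots> \<le> norm (\<xi> - s3 *\<^sub>R k l t3) + (norm (\<xi> - \<zeta> - s1 *\<^sub>R k b t1) + norm (\<zeta> - s2 *\<^sub>R k b t2))"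
      by (intro order_trans[OF norm_triangle_ineq4] add_left_mono norm_triangle_ineq)
    also have "\<dots> < 3"
      using assms ab by (simp add: near_def)
    finally show ?thesis .
  qed
  then have d: "\<bar>?d $ i\<bar> < 3" for i
    using component_le_norm_cart[of ?d i] by linarith
  have coord: "\<bar>L b * (s1 * khat t1 $ i + s2 * khat t2 $ i) - L l * (s3 * khat t3 $ i)\<bar> < 4" for i
  proof -
    let ?e = "L b * (s1 * khat t1 $ i + s2 * khat t2 $ i) - L l * (s3 * khat t3 $ i)"
    have "?d $ i = rho * ?e"
      by (simp add: k_def algebra_simps)
    then have "rho * \<bar>?e\<bar> < 3"
      using d[of i] rho(1) by (simp add: abs_mult)
    moreover have "3 / 4 * \<bar>?e\<bar> \<le> rho * \<bar>?e\<bar>"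
      using rho(1) by (intro mult_right_mono) auto
    ultimately have "3 / 4 * \<bar>?e\<bar> < 3" by (rule le_less_trans[rotated])
    moreover have "X < 4" if "3 / 4 * X < 3" for X :: real
      using that by simp
    ultimately show ?thesis by blast
  qed
  define y z yh zh where "y = L b" and "z = L l" and "yh = L b * h" and "zh = L l * h"
  have yz: "4 * z \<le> y" "100 \<le> z" "4 * zh \<le> yh" "99 / 100 * z \<le> zh" "zh \<le> z" "99 / 100 * y \<le> yh" "yh \<le> y"
    using Ll big h_bounds mult_right_mono[OF Ll, of h] mult_left_mono[OF h_bounds(1), of "L l"] mult_left_mono[OF h_bounds(2), of "L l"]
      mult_left_mono[OF h_bounds(1), of "L b"] mult_left_mono[OF h_bounds(2), of "L b"]
    by (simp_all add: y_def z_def yh_def zh_def mult.commute)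
  \<comment> \<open>If the high scale is not the next one, it is larger by a factor of at least 16,
    which the last comparison of first coordinates rules out.\<close>
  have gap: "b = Suc l \<or> 16 * z \<le> y"
  proof (cases "b = Suc l")
    case False
    then have "Suc l < b" using lb by simp
    from L_less[OF this] show ?thesis by (simp add: L_Suc y_def z_def)
  qed simp
  define e f where "e t = khat t $ 1" and "f t = (if t = 1 then 0 else if t = 2 then 1 else - 1 :: real)" for t :: 3
  have khat_f: "khat t $ 2 = h * f t" for t
    by (simp add: f_def khat_components)
  have e: "e 1 = 1" "e 2 = - (1 / 8)" "e 3 = - (1 / 8)" and f: "f 1 = 0" "f 2 = 1" "f 3 = - 1"
    by (simp_all add: e_def f_def khat_components)
  have c1: "\<bar>y * (s1 * e t1 + s2 * e t2) - z * (s3 * e t3)\<bar> < 4"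
    using coord[of 1] by (simp only: y_def z_def e_def)
  have c2: "\<bar>yh * (s1 * f t1 + s2 * f t2) - zh * (s3 * f t3)\<bar> < 4"
    using coord[of 2] by (simp add: yh_def zh_def khat_f algebra_simps)
  have le1: "\<bar>s3 * e t3\<bar> \<le> 1" "\<bar>s3 * f t3\<bar> \<le> 1"
    using s(3) exhaust_3[of t3] by (auto simp: e f)
  \<comment> \<open>The threshold 3 / 10 separates the possible values: the sums of two signed first
    coordinates have modulus 0, 1 / 4 or at least 7 / 8, and those of the normalised second
    coordinates have modulus 0, 1 or 2.\<close>
  have small: "\<bar>w\<bar> < 3 / 10" if "\<bar>x * w - x' * v\<bar> < 4" "\<bar>v\<bar> \<le> 1" "4 * x' \<le> x" "99 \<le> x'" for x x' w v :: real
  proof -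
    have "\<bar>x' * v\<bar> \<le> x' * 1"
      unfolding abs_mult using that by (intro mult_mono) auto
    then have "\<bar>x * w\<bar> < 4 + x / 4"
      using that by linarith
    then have "x * \<bar>w\<bar> < 4 + x / 4"
      using that by (simp add: abs_mult)
    also have "\<dots> \<le> x * (3 / 10)"
      using that by simp
    finally show ?thesis
      using that by simp
  qed
  have s12: "\<bar>s1 * e t1 + s2 * e t2\<bar> < 3 / 10" "\<bar>s1 * f t1 + s2 * f t2\<bar> < 3 / 10"
    using small[OF c1 le1(1)] small[OF c2 le1(2)] yz by simp_all
  have "(t1 = t2 \<and> s2 = - s1) \<or> (s2 = s1 \<and> (t1 = 2 \<and> t2 = 3 \<or> t1 = 3 \<and> t2 = 2))"
    using s(1,2) exhaust_3[of t1] exhaust_3[of t2] s12 by (elim disjE) (simp_all add: e f)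
  \<comment> \<open>Two opposite high bumps would leave a low frequency near 0. There is none:
    \<open>z\<close> is at least 100, so even a coordinate 1 / 8 gives more than the error
    4.\<close>
  moreover have "\<not> (t1 = t2 \<and> s2 = - s1)"
  proof
    assume *: "t1 = t2 \<and> s2 = - s1"
    have "\<bar>z * (s3 * e t3)\<bar> < 4" "\<bar>zh * (s3 * f t3)\<bar> < 4"
      using c1 c2 * by simp_all
    then show False
      using s(3) exhaust_3[of t3] yz by (elim disjE) (simp_all add: e f)
  qed
  ultimately have A: "s2 = s1" "t1 = 2 \<and> t2 = 3 \<or> t1 = 3 \<and> t2 = 2"
    by blast+
  have t3: "t3 = 1"
  proof (rule ccontr)
    assume "t3 \<noteq> 1"
    moreover have "\<bar>zh * (s3 * f t3)\<bar> < 4"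
      using c2 A by (auto simp: f)
    ultimately show False
      using s(3) exhaust_3[of t3] yz by (elim disjE) (simp_all add: f)
  qed
  \<comment> \<open>The first coordinate of \<open>khat 2 + khat 3\<close> is - 1 / 4. Equal signs
    of \<open>s1\<close> and \<open>s3\<close> would add two large numbers; opposite signs force
    \<open>y\<close> to within 16 of \<open>4 * z\<close>.\<close>
  have "\<bar>y * (- (s1 / 4)) - z * s3\<bar> < 4"
    using c1 A t3 by (auto simp: e)
  then have s3: "s3 = - s1" and "y - 4 * z < 16"
    using s(1,3) yz by (elim disjE; simp)+
  then have "b = Suc l"
    using gap yz by linarith
  with A t3 s3 have "b = Suc l \<and> t3 = 1 \<and> s2 = s1 \<and> s3 = - s1 \<and> (t1 = 2 \<and> t2 = 3 \<or> t1 = 3 \<and> t2 = 2)"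
    by blast
  then show "b = Suc l" "t3 = 1" "s2 = s1" "s3 = - s1" "t1 = 2 \<and> t2 = 3 \<or> t1 = 3 \<and> t2 = 2"
    by blast+
qed

definition resonance :: "nat \<Rightarrow> 3 \<Rightarrow> 3 \<Rightarrow> real \<Rightarrow> R3 \<Rightarrow> R3 \<Rightarrow> real" where
  "resonance l t1 t2 s \<zeta> \<xi> = cross3 (atom (Suc l) t1 s (\<xi> - \<zeta>)) (cross3 \<zeta> (atom (Suc l) t2 s \<zeta>)) \<bullet> cross3 \<xi> (atom l 1 (- s) \<xi>)"

lemma resonance_near:
  assumes "resonance l t1 t2 s \<zeta> \<xi> \<noteq> 0" "\<bar>s\<bar> = 1"
  shows "near (Suc l) t1 s (\<xi> - \<zeta>)" "near (Suc l) t2 s \<zeta>" "near l 1 (- s) \<xi>"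
proof -
  have "atom (Suc l) t1 s (\<xi> - \<zeta>) \<noteq> 0" "atom (Suc l) t2 s \<zeta> \<noteq> 0" "atom l 1 (- s) \<xi> \<noteq> 0"
    using assms(1) by (auto simp: resonance_def)
  then show "near (Suc l) t1 s (\<xi> - \<zeta>)" "near (Suc l) t2 s \<zeta>" "near l 1 (- s) \<xi>"
    using assms(2) by (auto intro: atom_near)
qed

lemma near_triad:
  assumes "near (Suc l) t1 s (\<xi> - \<zeta>)" "near (Suc l) t2 s \<zeta>" "near l 1 (- s) \<xi>" "levels Q = Suc l"
  shows "triad Q \<zeta> \<xi> = resonance l t1 t2 s \<zeta> \<xi>"
  using assms(4) by (simp add: triad_def resonance_def Wh_def W_def Wl_def near_U[OF assms(1)] near_U[OF assms(2)] near_U[OF assms(3)])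

text \<open>\<open>Wh\<close> puts \<open>\<zeta>\<close> on a removed scale and \<open>Wl\<close>
  puts \<open>\<xi>\<close> on a kept one, which is the order of scales that
  \<open>triad_geometry\<close> asks for. As the two scales must be adjacent, they are
  \<open>Suc l\<close> and \<open>l\<close>.\<close>

lemma triad_near:
  assumes "triad Q \<zeta> \<xi> \<noteq> 0" "levels Q = Suc l"
  obtains t1 t2 s where "near (Suc l) t1 s (\<xi> - \<zeta>)" "near (Suc l) t2 s \<zeta>" "near l 1 (- s) \<xi>"
    "t1 = 2 \<and> t2 = 3 \<or> t1 = 3 \<and> t2 = 2"
proof -
  have nz: "U (\<xi> - \<zeta>) \<noteq> 0" "Wh Q \<zeta> \<noteq> 0" "Wl Q \<xi> \<noteq> 0"
    using assms(1) by (auto simp: triad_def)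
  obtain a t1 s1 where n1: "near a t1 s1 (\<xi> - \<zeta>)" using U_near[OF nz(1)] by blast
  have "U \<zeta> \<noteq> 0" "U \<xi> \<noteq> 0"
    using nz(2,3) low_U[of Q \<zeta>] low_U[of Q \<xi>] by (auto simp: Wh_def W_def Wl_def)
  then obtain b t2 s2 l' t3 s3 where n2: "near b t2 s2 \<zeta>" and n3: "near l' t3 s3 \<xi>"
    using U_near by metis
  have b: "\<not> b < levels Q"
    using nz(2) near_U[OF n2] by (auto simp: Wh_def W_def Wl_def)
  have l': "l' < levels Q"
    using nz(3) near_U(2)[OF n3, of Q] by (auto simp: Wl_def split: if_splits)
  have "l' < b" using b l' by simp
  note g = triad_geometry[OF n1 n2 n3 this]
  have "l' = l" "b = Suc l" using g(2) b l' assms(2) by auto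
  then show ?thesis
    using that[of t1 s1 t2] n1 n2 n3 g by simp
qed

text \<open>By \<open>near_unique\<close> at most one of the four terms is nonzero at a given pair
  of frequencies. The sum is thus a case distinction in a form that can be integrated term by
  term.\<close>

lemma triad_eq:
  assumes Q: "levels Q = Suc l"
  shows "triad Q \<zeta> \<xi> = (resonance l 2 3 1 \<zeta> \<xi> + resonance l 3 2 1 \<zeta> \<xi>) + (resonance l 2 3 (- 1) \<zeta> \<xi> + resonance l 3 2 (- 1) \<zeta> \<xi>)"
proof (cases "triad Q \<zeta> \<xi> = 0")
  case True
  have "resonance l t1 t2 s \<zeta> \<xi> = 0" if "\<bar>s\<bar> = 1" for t1 t2 s
    using near_triad[OF resonance_near[OF _ that] Q] True by metis
  then show ?thesis using True by simp
next
  case False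
  obtain t1 t2 s where n: "near (Suc l) t1 s (\<xi> - \<zeta>)" "near (Suc l) t2 s \<zeta>" "near l 1 (- s) \<xi>"
    and t: "t1 = 2 \<and> t2 = 3 \<or> t1 = 3 \<and> t2 = 2"
    using triad_near[OF False Q] by blast
  have s: "s = 1 \<or> s = - 1" using n by (auto simp: near_def)
  have z: "resonance l t1' t2' s' \<zeta> \<xi> = 0" if "\<bar>s'\<bar> = 1" "\<not> (t1' = t1 \<and> s' = s)" for t1' t2' s'
    using near_unique[OF n(1) resonance_near(1)[of l t1' t2' s' \<zeta> \<xi>]] that by blast
  have e: "triad Q \<zeta> \<xi> = resonance l t1 t2 s \<zeta> \<xi>" by (rule near_triad[OF n Q])
  have "(2::3) \<noteq> 3" "(3::3) \<noteq> 2" "(1::real) \<noteq> - 1" "(- 1::real) \<noteq> 1" by auto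
  then show ?thesis
    using s t e z[of 1 2 3] z[of 1 3 2] z[of "- 1" 2 3] z[of "- 1" 3 2]
    by (elim disjE conjE) simp_all
qed

lemma measurable_atom [measurable]: "atom j t s \<in> borel_measurable borel"
  unfolding atom_def[abs_def] by measurable

lemma integrable_resonance:
  assumes s: "\<bar>s\<bar> = 1"
  shows "integrable (lborel \<Otimes>\<^sub>M lborel) (\<lambda>(\<zeta>, \<xi>). resonance l t1 t2 s \<zeta> \<xi>)"
proof -
  \<comment> \<open>The least truncation that keeps scale \<open>l\<close>; its \<open>triad\<close>
    majorises each single resonance.\<close>
  define Q where "Q = 2 * (l + n0)"
  have Q: "levels Q = Suc l" by (simp add: levels_def Q_def)
  show ?thesis
  proof (rule Bochner_Integration.integrable_bound[OF integrable_triad[of Q]])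
    have "\<bar>resonance l t1 t2 s \<zeta> \<xi>\<bar> \<le> \<bar>triad Q \<zeta> \<xi>\<bar>" for \<zeta> \<xi>
    proof (cases "resonance l t1 t2 s \<zeta> \<xi> = 0")
      case False
      then show ?thesis using near_triad[OF resonance_near[OF False s] Q] by simp
    qed simp
    then show "AE p in lborel \<Otimes>\<^sub>M lborel. norm (case p of (\<zeta>, \<xi>) \<Rightarrow> resonance l t1 t2 s \<zeta> \<xi>) \<le> norm (case p of (\<zeta>, \<xi>) \<Rightarrow> triad Q \<zeta> \<xi>)"
      by (intro AE_I2) (simp add: split_beta)
    show "(\<lambda>(\<zeta>, \<xi>). resonance l t1 t2 s \<zeta> \<xi>) \<in> borel_measurable (lborel \<Otimes>\<^sub>M lborel)"
      unfolding resonance_def by measurable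
  qed
qed

text \<open>The interaction in units of \<open>L (Suc l)\<close>: \<open>x\<close> and
  \<open>y\<close> are displacements from the centres of the two high bumps, and the low frequency
  is the sum \<open>A + B\<close>. It is homogeneous of degree 5 in \<open>(A, B)\<close>.\<close>

definition symb :: "3 \<Rightarrow> 3 \<Rightarrow> R3 \<Rightarrow> R3 \<Rightarrow> real" where
  "symb t1 t2 y x = (let A = rho *\<^sub>R khat t1 + x; B = rho *\<^sub>R khat t2 + y in
     cross3 (cross3 A (pol t1)) (cross3 B (cross3 B (pol t2))) \<bullet> cross3 (A + B) (cross3 (A + B) (pol 1)))"

definition bumps3 :: "R3 \<Rightarrow> R3 \<Rightarrow> real" where
  "bumps3 y x = chi x * chi y * chi (x + y)"

definition amp :: real where "amp = 4 powr (5 / 3)"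

text \<open>The degree 5 of \<open>symb\<close> against three normalisations \<open>1 / L\<close>
  leaves two powers of the scale, which the three amplitudes cancel. The remaining constant comes
  from \<open>c l / L l\<close>: at a scale smaller by 4 it contributes
  \<open>4 powr (2 / 3)\<close> times 4.\<close>

lemma amp_eq: "(c (Suc l) / L (Suc l)) * (c (Suc l) / L (Suc l)) * (c l / L l) * L (Suc l) ^ 5 = amp"
proof -
  define x where "x = L (Suc l)"
  have x: "0 < x" unfolding x_def by (rule L_ge)
  have l: "L l = x / 4" by (simp add: x_def L_Suc)
  have "c (Suc l) = x powr (- 2 / 3)" "c l = x powr (- 2 / 3) * 4 powr (2 / 3)"
    using x by (simp_all add: c_def l x_def[symmetric] powr_divide powr_minus_divide)
  moreover have "x powr (- 2 / 3) * x powr (- 2 / 3) * x powr (- 2 / 3) = 1 / x\<^sup>2"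
  proof -
    have "x powr (- 2 / 3) * x powr (- 2 / 3) * x powr (- 2 / 3) = x powr (- 2)"
      using x by (simp flip: powr_add)
    also have "\<dots> = 1 / x\<^sup>2"
      using x powr_realpow[of x 2] by (simp add: powr_minus_divide)
    finally show ?thesis .
  qed
  moreover have "(4::real) powr (2 / 3) * 4 = 4 powr (5 / 3)"
  proof -
    have "(4::real) powr (5 / 3) = 4 powr (2 / 3 + 1)" by simp
    then show ?thesis unfolding powr_add by simp
  qed
  moreover have "(p / x) * (p / x) * (p * q / (x / 4)) * x ^ 5 = (p * p * p) * (q * 4) * x\<^sup>2" for p q
    using x by (simp add: field_simps power2_eq_square eval_nat_numeral)
  ultimately show ?thesis
    using x unfolding amp_def x_def[symmetric] l by simp
qed

lemma k_sum: "t1 = 2 \<and> t2 = 3 \<or> t1 = 3 \<and> t2 = 2 \<Longrightarrow> k (Suc l) t1 + k (Suc l) t2 = - k l 1"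
  by (auto simp: k_def khat_simps L_Suc vec_eq_iff forall_3 vector_3 simp flip: scaleR_add_right)

text \<open>The variables are centred at the wave vectors; as these close exactly by
  \<open>k_sum\<close>, the low bump is evaluated at \<open>x + y\<close>. The factor
  \<open>s\<close> occurs an even number of times, so both signs give the same value, and the minus
  sign is that of the low bump at \<open>- s\<close>.\<close>

lemma resonance_shift:
  assumes s: "\<bar>s\<bar> = 1" and t: "t1 = 2 \<and> t2 = 3 \<or> t1 = 3 \<and> t2 = 2"
  shows "resonance l t1 t2 s (s *\<^sub>R k (Suc l) t2 + s *\<^sub>R y) ((s *\<^sub>R k (Suc l) t2 + s *\<^sub>R y) + s *\<^sub>R k (Suc l) t1 + s *\<^sub>R x)
    = - amp * (bumps3 y x * symb t1 t2 (y /\<^sub>R L (Suc l)) (x /\<^sub>R L (Suc l)))"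
proof -
  let ?L = "L (Suc l)" and ?g = "c (Suc l) / L (Suc l)" and ?g' = "c l / L l"
  define A B where "A = rho *\<^sub>R khat t1 + x /\<^sub>R ?L" and "B = rho *\<^sub>R khat t2 + y /\<^sub>R ?L"
  have L0: "?L \<noteq> 0" using L_ge(3)[of "Suc l"] by simp
  have A: "k (Suc l) t1 + x = ?L *\<^sub>R A" and B: "k (Suc l) t2 + y = ?L *\<^sub>R B"
    using L0 by (simp_all add: A_def B_def k_def scaleR_add_right mult.commute)
  let ?\<zeta> = "(s * ?L) *\<^sub>R B" and ?p = "(s * ?L) *\<^sub>R A" and ?\<xi> = "(s * ?L) *\<^sub>R (A + B)"
  have \<zeta>: "s *\<^sub>R k (Suc l) t2 + s *\<^sub>R y = ?\<zeta>"
    by (simp only: scaleR_add_right[symmetric] B scaleR_scaleR)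
  have p: "s *\<^sub>R k (Suc l) t1 + s *\<^sub>R x = ?p"
    by (simp only: scaleR_add_right[symmetric] A scaleR_scaleR)
  have \<xi>: "?\<zeta> + s *\<^sub>R k (Suc l) t1 + s *\<^sub>R x = ?\<xi>"
    unfolding add.assoc p scaleR_add_right by (rule add.commute)
  have ss: "s * s = 1" using s by (metis abs_mult_self_eq mult_1)
  have chis: "chi (s *\<^sub>R v) = chi v" for v
    using s chi_facts(3)[of v] by (cases "s = 1") (auto simp: abs_if split: if_splits)
  have 1: "atom (Suc l) t1 s ?p = (?g * chi x * ?L) *\<^sub>R cross3 A (pol t1)"
  proof -
    have "?p - s *\<^sub>R k (Suc l) t1 = s *\<^sub>R x" by (simp flip: p)
    then show ?thesis
      unfolding atom_def by (simp add: chis cross_mult_left ss mult_ac flip: mult.assoc[of s s])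
  qed
  have 2: "atom (Suc l) t2 s ?\<zeta> = (?g * chi y * ?L) *\<^sub>R cross3 B (pol t2)"
  proof -
    have "?\<zeta> - s *\<^sub>R k (Suc l) t2 = s *\<^sub>R y" by (simp flip: \<zeta>)
    then show ?thesis
      unfolding atom_def by (simp add: chis cross_mult_left ss mult_ac flip: mult.assoc[of s s])
  qed
  have 3: "atom l 1 (- s) ?\<xi> = (- (?g' * chi (x + y) * ?L)) *\<^sub>R cross3 (A + B) (pol 1)"
  proof -
    have "?\<xi> = s *\<^sub>R ((k (Suc l) t1 + x) + (k (Suc l) t2 + y))"
      unfolding A B by (simp add: scaleR_add_right)
    also have "(k (Suc l) t1 + x) + (k (Suc l) t2 + y) = - k l 1 + (x + y)"
      unfolding k_sum[OF t, symmetric] by simp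
    finally have "?\<xi> - (- s) *\<^sub>R k l 1 = s *\<^sub>R (x + y)"
      by (simp add: scaleR_add_right scaleR_diff_right)
    then show ?thesis
      unfolding atom_def by (simp add: chis cross_mult_left ss mult_ac flip: mult.assoc[of s s])
  qed
  have d: "?\<xi> - ?\<zeta> = ?p" by (simp add: scaleR_add_right)
  have p5: "w ^ 5 = w * w * w * w * w" for w :: real
    by (simp add: eval_nat_numeral)
  have "resonance l t1 t2 s ?\<zeta> ?\<xi> = - (s * s) * (?g * ?g * ?g' * ?L ^ 5) * (chi x * chi y * chi (x + y)) *
    (cross3 (cross3 A (pol t1)) (cross3 B (cross3 B (pol t2))) \<bullet> cross3 (A + B) (cross3 (A + B) (pol 1)))"
    unfolding resonance_def d 1 2 3 cross_mult_left cross_mult_right inner_scaleR_left inner_scaleR_right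
    by (simp only: p5 mult_minus_left mult_minus_right mult_ac)
  then show ?thesis
    unfolding \<zeta> \<xi> ss amp_eq bumps3_def symb_def Let_def A_def[symmetric] B_def[symmetric] by simp
qed

lemma integral_resonance:
  assumes s: "\<bar>s\<bar> = 1" and t: "t1 = 2 \<and> t2 = 3 \<or> t1 = 3 \<and> t2 = 2"
  shows "(LINT p|(lborel \<Otimes>\<^sub>M lborel). (case p of (\<zeta>, \<xi>) \<Rightarrow> resonance l t1 t2 s \<zeta> \<xi>))
    = - amp * (LINT y|lborel. LINT x|lborel. bumps3 y x * symb t1 t2 (y /\<^sub>R L (Suc l)) (x /\<^sub>R L (Suc l)))"
proof -
  let ?r = "resonance l t1 t2 s"
  let ?k1 = "s *\<^sub>R k (Suc l) t1" and ?k2 = "s *\<^sub>R k (Suc l) t2"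
  have m: "?r \<zeta> \<in> borel_measurable borel" for \<zeta>
    unfolding resonance_def by measurable
  have m2: "(\<lambda>\<zeta>. LINT x|lborel. ?r \<zeta> (\<zeta> + ?k1 + s *\<^sub>R x)) \<in> borel_measurable borel"
    unfolding resonance_def by measurable
  have "(LINT p|(lborel \<Otimes>\<^sub>M lborel). (case p of (\<zeta>, \<xi>) \<Rightarrow> ?r \<zeta> \<xi>)) = (LINT \<zeta>|lborel. LINT \<xi>|lborel. ?r \<zeta> \<xi>)"
    by (rule lborel_pair.integral_fst[OF integrable_resonance[OF s], symmetric])
  also have "\<dots> = (LINT \<zeta>|lborel. LINT x|lborel. ?r \<zeta> (\<zeta> + ?k1 + s *\<^sub>R x))"
    by (intro Bochner_Integration.integral_cong refl integral_affine[OF s m, symmetric])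
  also have "\<dots> = (LINT y|lborel. LINT x|lborel. ?r (?k2 + s *\<^sub>R y) ((?k2 + s *\<^sub>R y) + ?k1 + s *\<^sub>R x))"
    by (rule integral_affine[OF s m2, symmetric])
  also have "\<dots> = - amp * (LINT y|lborel. LINT x|lborel. bumps3 y x * symb t1 t2 (y /\<^sub>R L (Suc l)) (x /\<^sub>R L (Suc l)))"
    unfolding resonance_shift[OF s t] by simp
  finally show ?thesis .
qed

section \<open>The limit of the flux\<close>

lemma symb_le:
  assumes "norm x \<le> 1" "norm y \<le> 1"
  shows "\<bar>symb t1 t2 y x\<bar> \<le> 128"
proof -
  define A B where "A = rho *\<^sub>R khat t1 + x" and "B = rho *\<^sub>R khat t2 + y"
  have "norm A \<le> norm (rho *\<^sub>R khat t1) + norm x" "norm B \<le> norm (rho *\<^sub>R khat t2) + norm y"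
    unfolding A_def B_def by (rule norm_triangle_ineq)+
  then have A: "norm A \<le> 2" and B: "norm B \<le> 2"
    using assms rho by (auto simp: norm_khat)
  have AB: "norm (A + B) \<le> 4"
    using norm_triangle_ineq[of A B] A B by linarith
  have c1: "norm (cross3 v (pol t)) \<le> R" if "norm v \<le> R" for v t R
    using norm_cross3_le[of v "pol t"] that by (simp add: norm_pol)
  have c2: "norm (cross3 v (cross3 v (pol t))) \<le> R * R" if "norm v \<le> R" for v t R
    using that order_trans[OF norm_ge_zero that] by (intro order_trans[OF norm_cross3_le] mult_mono c1) auto
  have "\<bar>symb t1 t2 y x\<bar> \<le> norm (cross3 (cross3 A (pol t1)) (cross3 B (cross3 B (pol t2)))) * norm (cross3 (A + B) (cross3 (A + B) (pol 1)))"
    unfolding symb_def Let_def A_def[symmetric] B_def[symmetric] by (rule Cauchy_Schwarz_ineq2)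
  also have "\<dots> \<le> (2 * (2 * 2)) * (4 * 4)"
    by (intro mult_mono order_trans[OF norm_cross3_le] c1[OF A] c2[OF B] c2[OF AB]) auto
  finally show ?thesis by simp
qed

section \<open>The overlap of three bumps and the limit of the weighted overlap\<close>

lemma bumps3_nonneg: "0 \<le> bumps3 y x"
  unfolding bumps3_def using chi_facts(1) by (intro mult_nonneg_nonneg)

lemma bumps3_support: "bumps3 y x \<noteq> 0 \<Longrightarrow> norm x \<le> 1 \<and> norm y \<le> 1"
  using lp_cutoff_support[OF chi] by (auto simp: bumps3_def intro: less_imp_le)

lemma measurable_bumps3 [measurable]: "(\<lambda>p. bumps3 (fst p) (snd p)) \<in> borel_measurable (borel \<Otimes>\<^sub>M borel)"
  unfolding bumps3_def by measurable

lemma measurable_symb [measurable]: "(\<lambda>p. symb t1 t2 (a *\<^sub>R fst p) (a *\<^sub>R snd p)) \<in> borel_measurable (borel \<Otimes>\<^sub>M borel)"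
  unfolding symb_def Let_def by measurable

lemma integrable_bumps3: "integrable (lborel \<Otimes>\<^sub>M lborel) (\<lambda>p. bumps3 (fst p) (snd p))"
proof -
  obtain B where B: "\<And>\<xi>. chi \<xi> \<le> B" "0 < B"
    using lp_cutoff_bounded[OF chi] by blast
  have "integrable (lborel \<Otimes>\<^sub>M lborel) (\<lambda>(y, x). B * (chi y * chi x))"
  proof (rule lborel_pair.Fubini_integrable)
    show "integrable lborel (\<lambda>y. LINT x|lborel. norm (case (y, x) of (y, x) \<Rightarrow> B * (chi y * chi x)))"
      using integrable_chi by (simp add: abs_mult)
    show "AE y in lborel. integrable lborel (\<lambda>x. case (y, x) of (y, x) \<Rightarrow> B * (chi y * chi x))"
      using integrable_chi by simp
  qed measurable
  then show ?thesis
  proof (rule Bochner_Integration.integrable_bound)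
    have "bumps3 y x \<le> B * (chi y * chi x)" for y x
      unfolding bumps3_def using mult_left_mono[OF B(1)[of "x + y"], of "chi x * chi y"] chi_facts(1) by (simp add: mult_ac)
    then show "AE p in lborel \<Otimes>\<^sub>M lborel. norm (bumps3 (fst p) (snd p)) \<le> norm (case p of (y, x) \<Rightarrow> B * (chi y * chi x))"
      using bumps3_nonneg by (intro AE_I2) (simp add: split_beta abs_of_nonneg abs_mult chi_facts(1) less_imp_le[OF B(2)])
  qed measurable
qed

lemma integral_bumps3_pos: "0 < (LINT p|(lborel \<Otimes>\<^sub>M lborel). bumps3 (fst p) (snd p))"
proof -
  \<comment> \<open>Radius 1 / 4 keeps \<open>x\<close>, \<open>y\<close> and \<open>x + y\<close>
    within the ball of radius 1 / 2, where \<open>chi\<close> is 1.\<close>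
  let ?b = "ball (0::R3) (1 / 4)"
  let ?S = "?b \<times> ?b"
  have fin: "emeasure (lborel \<Otimes>\<^sub>M lborel) ?S = emeasure lborel ?b * emeasure lborel ?b"
    by (rule lborel.emeasure_pair_measure_Times) auto
  have fin2: "emeasure (lborel \<Otimes>\<^sub>M lborel) ?S < \<infinity>"
    unfolding fin using emeasure_lborel_ball_finite[of "0::R3" "1 / 4"] by (simp add: ennreal_mult_less_top)
  have "measure (lborel \<Otimes>\<^sub>M lborel) ?S = measure lborel ?b * measure lborel ?b"
    unfolding measure_def fin by (simp add: enn2real_mult)
  then have "0 < measure (lborel \<Otimes>\<^sub>M lborel) ?S"
    using content_ball_pos[of "1 / 4" "0::R3"] by simp
  also have "\<dots> = (LINT p|(lborel \<Otimes>\<^sub>M lborel). indicator ?S p)"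
    by simp
  also have "\<dots> \<le> (LINT p|(lborel \<Otimes>\<^sub>M lborel). bumps3 (fst p) (snd p))"
  proof (rule integral_mono[OF _ integrable_bumps3])
    show "integrable (lborel \<Otimes>\<^sub>M lborel) (indicator ?S :: R3 \<times> R3 \<Rightarrow> real)"
      by (intro integrable_real_indicator fin2) auto
    fix p :: "R3 \<times> R3"
    show "indicator ?S p \<le> bumps3 (fst p) (snd p)"
    proof (cases "p \<in> ?S")
      case True
      then have "norm (fst p) \<le> 1 / 4" "norm (snd p) \<le> 1 / 4" by auto
      then have "norm (snd p + fst p) \<le> 1 / 2" using norm_triangle_ineq[of "snd p" "fst p"] by linarith
      then show ?thesis
        using chi_facts(2) \<open>norm (fst p) \<le> 1 / 4\<close> \<open>norm (snd p) \<le> 1 / 4\<close> by (simp add: bumps3_def indicator_def)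
    next
      case False
      then show ?thesis using bumps3_nonneg by simp
    qed
  qed
  finally show ?thesis .
qed

lemma symb_tendsto: "(\<lambda>l. symb t1 t2 (y /\<^sub>R L (Suc l)) (x /\<^sub>R L (Suc l))) \<longlonglongrightarrow> symb t1 t2 0 0"
proof -
  have "(\<lambda>l. inverse (L (Suc l))) \<longlonglongrightarrow> 0"
  proof -
    have "inverse (L (Suc l)) = (1 / 4) ^ l * inverse (4 ^ Suc n0)" for l
      by (simp add: L_def power_add field_simps)
    moreover have "(\<lambda>l. (1 / 4) ^ l * inverse (4 ^ Suc n0)) \<longlonglongrightarrow> (0::real)"
      by (intro tendsto_mult_left_zero LIMSEQ_power_zero) simp
    ultimately show ?thesis by (simp only:)
  qed
  from tendsto_scaleR[OF this tendsto_const[of x]] tendsto_scaleR[OF this tendsto_const[of y]]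
  have x: "(\<lambda>l. x /\<^sub>R L (Suc l)) \<longlonglongrightarrow> 0" and y: "(\<lambda>l. y /\<^sub>R L (Suc l)) \<longlonglongrightarrow> 0"
    by simp_all
  have cr: "((\<lambda>l. cross3 (f l) (g l)) \<longlonglongrightarrow> cross3 a b)" if "f \<longlonglongrightarrow> a" "g \<longlonglongrightarrow> b" for f g :: "nat \<Rightarrow> R3" and a b
  proof -
    have "continuous_on UNIV (\<lambda>p::R3 \<times> R3. cross3 (fst p) (snd p))"
      by (intro continuous_on_cross continuous_on_fst continuous_on_snd continuous_on_id)
    then have "isCont (\<lambda>p::R3 \<times> R3. cross3 (fst p) (snd p)) (a, b)"
      by (simp add: continuous_on_eq_continuous_at)
    from isCont_tendsto_compose[OF this tendsto_Pair[OF that]] show ?thesis by simp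
  qed
  show ?thesis
    unfolding symb_def Let_def
    by (intro tendsto_inner cr tendsto_add tendsto_const x y)
qed

text \<open>The bumps have fixed width while \<open>symb\<close> varies on the scale
  \<open>L (Suc l)\<close>, so it freezes at its value for the centres; \<open>symb_le\<close>
  supplies the majorant.\<close>

lemma bumps3_symb:
  "(\<lambda>l. LINT y|lborel. LINT x|lborel. bumps3 y x * symb t1 t2 (y /\<^sub>R L (Suc l)) (x /\<^sub>R L (Suc l)))
    \<longlonglongrightarrow> (LINT p|(lborel \<Otimes>\<^sub>M lborel). bumps3 (fst p) (snd p)) * symb t1 t2 0 0"
proof -
  let ?P = "lborel \<Otimes>\<^sub>M lborel :: (R3 \<times> R3) measure"
  let ?f = "\<lambda>l p. bumps3 (fst p) (snd p) * symb t1 t2 (fst p /\<^sub>R L (Suc l)) (snd p /\<^sub>R L (Suc l))"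
  have bound: "norm (?f l p) \<le> bumps3 (fst p) (snd p) * 128" for l p
  proof (cases "bumps3 (fst p) (snd p) = 0")
    case False
    note s = bumps3_support[OF False]
    have "norm (v /\<^sub>R L (Suc l)) \<le> 1" if "norm v \<le> 1" for v :: R3
      using that L_ge(2)[of "Suc l"] by (simp add: divide_simps)
    then show ?thesis
      using bumps3_nonneg[of "fst p" "snd p"] s unfolding real_norm_def abs_mult
      by (intro mult_mono symb_le) auto
  qed simp
  have m: "?f l \<in> borel_measurable ?P" for l by measurable
  have i: "integrable ?P (?f l)" for l
  proof (rule Bochner_Integration.integrable_bound[OF integrable_mult_left[OF integrable_bumps3, of 128] m])
    show "AE p in ?P. norm (?f l p) \<le> norm (bumps3 (fst p) (snd p) * 128)"
      using bound bumps3_nonneg by (intro AE_I2) (simp only: real_norm_def abs_of_nonneg[OF mult_nonneg_nonneg] zero_le_numeral)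
  qed
  have "(\<lambda>l. LINT p|?P. ?f l p) \<longlonglongrightarrow> (LINT p|?P. bumps3 (fst p) (snd p) * symb t1 t2 0 0)"
  proof (rule integral_dominated_convergence[where w="\<lambda>p. bumps3 (fst p) (snd p) * 128"])
    show "AE p in ?P. (\<lambda>l. ?f l p) \<longlonglongrightarrow> bumps3 (fst p) (snd p) * symb t1 t2 0 0"
      by (intro AE_I2 tendsto_mult tendsto_const symb_tendsto)
    show "AE p in ?P. norm (?f l p) \<le> bumps3 (fst p) (snd p) * 128" for l
      by (intro AE_I2 bound)
    show "integrable ?P (\<lambda>p. bumps3 (fst p) (snd p) * 128)"
      by (rule integrable_mult_left[OF integrable_bumps3])
  qed (use m in \<open>auto intro: borel_measurable_integrable integrable_bumps3\<close>)
  moreover have "(LINT p|?P. ?f l p) = (LINT y|lborel. LINT x|lborel. bumps3 y x * symb t1 t2 (y /\<^sub>R L (Suc l)) (x /\<^sub>R L (Suc l)))" for l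
    using lborel_pair.integral_fst'[OF i[of l]] by simp
  ultimately show ?thesis by simp
qed

text \<open>For the order 2, 3 the velocity at \<open>khat 2\<close> and the vorticity at
  \<open>khat 3\<close> are both vertical and have cross product 0. For the order 3, 2 both are
  horizontal, and their cross product is vertical like the low vorticity. The two orders therefore
  cannot cancel.\<close>

lemma symb_values: "symb 2 3 0 0 = 0" "symb 3 2 0 0 = - (rho ^ 5 * h\<^sup>2 / 64)"
proof -
  show "symb 2 3 0 0 = 0"
    unfolding symb_def Let_def khat_simps inner_vec_def sum_3
    by (simp add: cross_components vector_3)
  show "symb 3 2 0 0 = - (rho ^ 5 * h\<^sup>2 / 64)"
    unfolding symb_def Let_def khat_simps inner_vec_def sum_3
    by (simp add: cross_components vector_3 power2_eq_square eval_nat_numeral)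
qed

text \<open>The factor 2 counts the signs \<open>s = 1\<close> and \<open>s = - 1\<close>, whose
  resonances have equal integrals.\<close>

definition total :: "nat \<Rightarrow> real" where
  "total l = - (2 * amp) * ((LINT y|lborel. LINT x|lborel. bumps3 y x * symb 2 3 (y /\<^sub>R L (Suc l)) (x /\<^sub>R L (Suc l)))
    + (LINT y|lborel. LINT x|lborel. bumps3 y x * symb 3 2 (y /\<^sub>R L (Suc l)) (x /\<^sub>R L (Suc l))))"

lemma helicity_flux_total:
  assumes Q: "levels Q = Suc l"
  shows "helicity_flux chi u (int Q) = of_real (2 / (2 * pi) ^ 6 * total l)"
proof -
  let ?P = "lborel \<Otimes>\<^sub>M lborel :: (R3 \<times> R3) measure"
  let ?r = "\<lambda>t1 t2 s p. (case p of (\<zeta>, \<xi>) \<Rightarrow> resonance l t1 t2 s \<zeta> \<xi>)"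
  have i1: "integrable ?P (?r t1 t2 1)" and i2: "integrable ?P (?r t1 t2 (- 1))" for t1 t2
    by (intro integrable_resonance; simp)+
  have "(LINT p|?P. (case p of (\<zeta>, \<xi>) \<Rightarrow> triad Q \<zeta> \<xi>)) = (LINT p|?P. (?r 2 3 1 p + ?r 3 2 1 p) + (?r 2 3 (- 1) p + ?r 3 2 (- 1) p))"
    unfolding triad_eq[OF Q] by (intro Bochner_Integration.integral_cong refl) (simp add: split_beta)
  also have "\<dots> = ((LINT p|?P. ?r 2 3 1 p) + (LINT p|?P. ?r 3 2 1 p)) + ((LINT p|?P. ?r 2 3 (- 1) p) + (LINT p|?P. ?r 3 2 (- 1) p))"
    by (simp only: Bochner_Integration.integral_add Bochner_Integration.integrable_add i1 i2)
  also have "\<dots> = total l"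
    by (simp add: integral_resonance total_def algebra_simps)
  finally show ?thesis
    by (simp only: helicity_flux_triad)
qed

lemma total_tendsto: "\<exists>a. total \<longlonglongrightarrow> a \<and> 0 < a"
proof (intro exI conjI)
  let ?I = "(LINT p|(lborel \<Otimes>\<^sub>M lborel). bumps3 (fst p) (snd p))"
  show "total \<longlonglongrightarrow> - (2 * amp) * (?I * symb 2 3 0 0 + ?I * symb 3 2 0 0)"
    unfolding total_def[abs_def] by (intro tendsto_mult tendsto_const tendsto_add bumps3_symb)
  have "0 < amp" by (simp add: amp_def)
  moreover have "0 < rho ^ 5 * h\<^sup>2 / 64"
    using rho(1) h_pos by simp
  ultimately have "0 < 2 * amp * (?I * (rho ^ 5 * h\<^sup>2 / 64))"
    using integral_bumps3_pos by (intro mult_pos_pos) auto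
  then show "0 < - (2 * amp) * (?I * symb 2 3 0 0 + ?I * symb 3 2 0 0)"
    by (simp add: symb_values)
qed

text \<open>For \<open>2 * n0 \<le> Q\<close>, when at least one packet is kept, the flux depends on
  \<open>Q\<close> only through the last scale kept, \<open>Q div 2 - n0\<close>. Even and odd
  truncations therefore share one limit, and the lower limit of the modulus is a genuine
  limit.\<close>

lemma liminf_helicity_flux: "0 < liminf (\<lambda>Q::nat. ereal (norm (helicity_flux chi u (int Q))))"
proof -
  obtain a where a: "total \<longlonglongrightarrow> a" "0 < a"
    using total_tendsto by blast
  have f: "filterlim (\<lambda>Q::nat. Q div 2 - n0) at_top sequentially"
    unfolding filterlim_at_top
  proof
    fix m
    show "\<forall>\<^sub>F Q in sequentially. m \<le> Q div 2 - n0"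
      by (rule eventually_sequentiallyI[of "2 * (m + n0)"]) presburger
  qed
  have "(\<lambda>Q. norm (complex_of_real (2 / (2 * pi) ^ 6 * total (Q div 2 - n0)))) \<longlonglongrightarrow> norm (complex_of_real (2 / (2 * pi) ^ 6 * a))"
    by (intro tendsto_intros filterlim_compose[OF a(1) f])
  moreover have "\<forall>\<^sub>F Q in sequentially. norm (complex_of_real (2 / (2 * pi) ^ 6 * total (Q div 2 - n0))) = norm (helicity_flux chi u (int Q))"
  proof (rule eventually_sequentiallyI[of "2 * n0"])
    fix Q assume "2 * n0 \<le> Q"
    then have "levels Q = Suc (Q div 2 - n0)"
      unfolding levels_def by linarith
    from helicity_flux_total[OF this]
    show "norm (complex_of_real (2 / (2 * pi) ^ 6 * total (Q div 2 - n0))) = norm (helicity_flux chi u (int Q))"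
      by simp
  qed
  ultimately have "(\<lambda>Q. norm (helicity_flux chi u (int Q))) \<longlonglongrightarrow> norm (complex_of_real (2 / (2 * pi) ^ 6 * a))"
    by (rule Lim_transform_eventually)
  then have "(\<lambda>Q. ereal (norm (helicity_flux chi u (int Q)))) \<longlonglongrightarrow> ereal (norm (complex_of_real (2 / (2 * pi) ^ 6 * a)))"
    by (rule tendsto_ereal)
  from lim_imp_Liminf[OF _ this]
  have "liminf (\<lambda>Q::nat. ereal (norm (helicity_flux chi u (int Q)))) = ereal (norm (complex_of_real (2 / (2 * pi) ^ 6 * a)))"
    by simp
  moreover have "0 < norm (complex_of_real (2 / (2 * pi) ^ 6 * a))"
    using a(2) by (simp add: norm_mult norm_divide)
  ultimately show ?thesis by simp
qed

end

text \<open>The closed support of \<open>chi\<close> is compact in the open unit ball, so the norm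
  attains on it a maximum below 1. This maximum, raised to 1 / 2 where necessary, is
  \<open>r\<close>; \<open>n0\<close> then exists because the powers of 4 are unbounded.\<close>

lemma flux_example_exists:
  assumes chi: "lp_cutoff chi"
  obtains r n0 where "flux_example chi r n0"
proof -
  let ?K = "closure {\<xi>. chi \<xi> \<noteq> 0}"
  have sub: "?K \<subseteq> ball 0 1"
    using chi unfolding lp_cutoff_def by (elim conjE)
  have "compact ?K"
    unfolding compact_eq_bounded_closed using bounded_subset[OF bounded_ball sub] by simp
  have "0 \<in> ?K"
    using lp_cutoff_facts(2)[OF chi, of 0] by (intro subsetD[OF closure_subset]) simp
  then have "?K \<noteq> {}" by (metis empty_iff)
  from continuous_attains_sup[OF \<open>compact ?K\<close> this continuous_on_norm_id]
  have "\<exists>x\<in>?K. \<forall>y\<in>?K. norm y \<le> norm x" .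
  then obtain x where x: "x \<in> ?K" "\<And>y. y \<in> ?K \<Longrightarrow> norm y \<le> norm x"
    by (elim bexE) simp
  define r where "r = max (1 / 2) (norm x)"
  have r: "1 / 2 \<le> r" "r < 1"
    using subsetD[OF sub x(1)] by (simp_all add: r_def)
  obtain n0 where "100 / (1 - r) < 4 ^ n0"
    using real_arch_pow[of 4 "100 / (1 - r)"] by auto
  then have "100 \<le> 4 ^ n0 * (1 - r)"
    using r(2) pos_divide_less_eq[of "1 - r" 100 "4 ^ n0"] by linarith
  moreover have "chi \<xi> = 0" if "r < norm \<xi>" for \<xi>
  proof (rule ccontr)
    assume "chi \<xi> \<noteq> 0"
    then have "norm \<xi> \<le> norm x"
      by (intro x(2) subsetD[OF closure_subset]) simp
    then show False using that by (simp add: r_def)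
  qed
  ultimately have "flux_example chi r n0"
    using chi r by unfold_locales
  then show ?thesis by (rule that)
qed

theorem mainTheorem7:
  fixes chi :: "real ^ 3 \<Rightarrow> real"
  assumes "lp_cutoff chi"
  shows "\<exists>u :: real ^ 3 \<Rightarrow> real ^ 3.
    u \<in> borel_measurable lborel \<and>
    integrable lborel (\<lambda>x. (norm (u x))\<^sup>2) \<and>
    divergence_free (vec_distr u) \<and>
    (\<forall>i. vec_distr u i \<in> besov chi (2 / 3) 3 \<inter> sobolev (1 / 2)) \<and>
    0 < liminf (\<lambda>Q::nat. ereal (norm (helicity_flux chi u (int Q))))"
proof -
  obtain r n0 where "flux_example chi r n0"
    using flux_example_exists[OF assms] .
  then interpret flux_example chi r n0 .
  show ?thesis
    using integrable_norm_u_sq divergence_free_u besov_u sobolev_u liminf_helicity_flux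
    by (intro exI[of _ u]) simp
qed

end
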